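(* Let $m \geq 1$, $n \geq 1$, and $N_x \in \mathbb{Z}$ be integers, and suppose $u_0,u_1:[0,\infty)\to\mathbb{R}$ ($m+2$ and $m+1$ times weakly differentiable, respectively) satisfy $$\begin{cases} (1+x)^{n} (u_0(x) - 2\pi N_x) \in L^1([0,\infty)),\\ (1+x)^{n}\partial^i u_0(x) \in L^1([0,\infty)), \quad i = 1, \dots, m+2,\\ (1+x)^{n}\partial^i u_1(x) \in L^1([0,\infty)), \quad i = 0,1, \dots, m+1. \end{cases}$$ Then the spectral functions $a(k)$ and $b(k)$ have the following properties: (a) $a(k)$ and $b(k)$ are continuous for $\operatorname{Im} k \geq 0$ and analytic for $\operatorname{Im} k > 0$. (b) For $j = 1, \dots, n$, the derivatives $a^{(j)}(k)$ and $b^{(j)}(k)$ are well-defined and continuous on $\bar{\mathbb{C}}_+ \setminus \{0\}$. (c) There exist complex constants $\{a_i, b_i, \hat{a}_i, \hat{b}_i\}_{i=1}^m$ such that the following expansions hold uniformly for each $j = 0, 1, \dots, n$: $$\begin{pmatrix} b^{(j)}(k) \\ a^{(j)}(k) \end{pmatrix} = \begin{pmatrix} \frac{d^j}{dk^j}\big(\frac{b_1}{k} + \cdots + \frac{b_m}{k^m}\big) \\ \frac{d^j}{dk^j}\big(1 + \frac{a_1}{k} + \cdots + \frac{a_m}{k^m}\big) \end{pmatrix} + O\bigg(\frac{1}{k^{m+1}}\bigg),\qquad k \to \infty, \ \operatorname{Im} k \geq 0,$$ and $$\begin{pmatrix} b^{(j)}(k) \\ a^{(j)}(k) \end{pmatrix}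 = G_0(0) \begin{pmatrix} \frac{d^j}{dk^j}\big(\hat{b}_1k + \cdots + \hat{b}_mk^m\big) \\ \frac{d^j}{dk^j}\big(1 + \hat{a}_1k + \cdots + \hat{a}_mk^m\big) \end{pmatrix} + O\big(k^{m+1-2j}\big),\qquad k \to 0, \ \operatorname{Im} k \geq 0.$$ (d) $a(k) = \overline{a(-\bar{k})}$ and $b(k) = \overline{b(-\bar{k})}$ for $\operatorname{Im} k \geq 0$. (e) $|a(k)|^2 +|b(k)|^2 = 1$ for $k \in \mathbb{R}$.
   Context: Pauli matrices: $\sigma_1=\begin{pmatrix}0&1\\1&0\end{pmatrix}$, $\sigma_2=\begin{pmatrix}0&-i\\i&0\end{pmatrix}$, $\sigma_3=\begin{pmatrix}1&0\\0&-1\end{pmatrix}$; $e^{\alpha\hat\sigma_3}A=e^{\alpha\sigma_3}Ae^{-\alpha\sigma_3}$ for a $2\times2$ matrix $A$. $\bar{\mathbb{C}}_\pm=\{k:\pm\operatorname{Im}k\ge0\}$. $\theta_1=\theta_1(k)=\frac14(k-\frac1k)$ and $$\mathsf{U}(x,k)=-\frac{i(u_{0x}+u_1)}{4}\sigma_2+\frac{i\sin u_0}{4k}\sigma_1+\frac{i(\cos u_0-1)}{4k}\sigma_3.$$ $X(x,k)$ is the unique $2\times2$-matrix valued solution of the Volterra equation $$X(x,k)=I+\int_\infty^xe^{i\theta_1(x'-x)\hat\sigma_3}(\mathsf{U}X)(x',k)dx',\qquad x\ge0,$$ read columnwise: the first column is defined for $k\in\bar{\mathbb{C}}_-\setminus\{0\}$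 and the second for $k\in\bar{\mathbb{C}}_+\setminus\{0\}$. It has the symmetry $X(x,k)=\sigma_2\overline{X(x,\bar k)}\sigma_2$. The spectral functions $a,b$ are defined by $$X(0,k)=\begin{pmatrix}\overline{a(\bar k)}&b(k)\\-\overline{b(\bar k)}&a(k)\end{pmatrix},$$ i.e. $(b(k),a(k))^T$ is the second column of $X(0,k)$, $k\in\bar{\mathbb{C}}_+\setminus\{0\}$; values at $k=0$ are understood as limits (continuous extension). $$G_0(x)=(-1)^{N_x}\begin{pmatrix}\cos\frac{u_0(x)}2&-\sin\frac{u_0(x)}2\\ \sin\frac{u_0(x)}2&\cos\frac{u_0(x)}2\end{pmatrix}.$$ *)

theory Defs
  imports "HOL-Complex_Analysis.Complex_Analysis" "HOL-Library.Landau_Symbols"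
begin

text \<open>Functions on the half-line are represented by functions on all of \<open>real\<close>; only their
  values on \<open>{0..}\<close> are ever used.\<close>

subsection \<open>Weak derivatives on the half-line\<close>

definition test_function :: "(real \<Rightarrow> real) \<Rightarrow> bool" where
  "test_function \<phi> \<longleftrightarrow>
     (\<forall>i x. (deriv ^^ i) \<phi> field_differentiable (at x)) \<and>
     compact (closure {x. \<phi> x \<noteq> 0}) \<and> closure {x. \<phi> x \<noteq> 0} \<subseteq> {0<..}"

definition is_weak_deriv :: "nat \<Rightarrow> (real \<Rightarrow> real) \<Rightarrow> (real \<Rightarrow> real) \<Rightarrow> bool" where
  "is_weak_deriv i f g \<longleftrightarrow>
     (\<forall>c d. 0 < c \<longrightarrow> f absolutely_integrable_on {c..d} \<and> g absolutely_integrable_on {c..d}) \<and>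
     (\<forall>\<phi>. test_function \<phi> \<longrightarrow>
        (LINT x:{0<..}|lebesgue. f x * (deriv ^^ i) \<phi> x)
          = (-1) ^ i * (LINT x:{0<..}|lebesgue. g x * \<phi> x))"

definition weakly_differentiable :: "nat \<Rightarrow> (real \<Rightarrow> real) \<Rightarrow> bool" where
  "weakly_differentiable r f \<longleftrightarrow> (\<forall>i\<le>r. \<exists>g. is_weak_deriv i f g)"

text \<open>Weak derivatives are determined only almost everywhere, so a representative is chosen.
  The choice is immaterial, since they are only used inside Lebesgue integrals.\<close>

definition wderiv :: "nat \<Rightarrow> (real \<Rightarrow> real) \<Rightarrow> real \<Rightarrow> real" where
  "wderiv i f = (if i = 0 then f else (SOME g. is_weak_deriv i f g))"

subsection \<open>The Volterra equation\<close>

definition pauli1 :: "complex^2^2" where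
  "pauli1 = vector [vector [0, 1], vector [1, 0]]"

definition pauli2 :: "complex^2^2" where
  "pauli2 = vector [vector [0, -\<i>], vector [\<i>, 0]]"

definition pauli3 :: "complex^2^2" where
  "pauli3 = vector [vector [1, 0], vector [0, -1]]"

text \<open>The matrix exponential of \<open>\<alpha> \<sigma>\<^sub>3\<close>, where \<open>\<sigma>\<^sub>3\<close> is the diagonal matrix \<open>pauli3\<close>.\<close>

definition exp_pauli3 :: "complex \<Rightarrow> complex^2^2" where
  "exp_pauli3 \<alpha> = vector [vector [exp \<alpha>, 0], vector [0, exp (- \<alpha>)]]"

definition exp_hat_pauli3 :: "complex \<Rightarrow> complex^2^2 \<Rightarrow> complex^2^2" where
  "exp_hat_pauli3 \<alpha> A = exp_pauli3 \<alpha> ** A ** exp_pauli3 (- \<alpha>)"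

definition theta1 :: "complex \<Rightarrow> complex" where
  "theta1 k = (k - 1 / k) / 4"

definition pot_U :: "(real \<Rightarrow> real) \<Rightarrow> (real \<Rightarrow> real) \<Rightarrow> real \<Rightarrow> complex \<Rightarrow> complex^2^2" where
  "pot_U u0 u1 x k =
     mat (- (\<i> * of_real (wderiv 1 u0 x + u1 x) / 4)) ** pauli2
     + mat (\<i> * of_real (sin (u0 x)) / (4 * k)) ** pauli1
     + mat (\<i> * of_real (cos (u0 x) - 1) / (4 * k)) ** pauli3"

text \<open>The \<open>j\<close>-th column of the Volterra equation for the matrix function \<open>Y\<close>, in the class of
  bounded continuous columns. The \<open>j\<close>-th column of the integrand only involves the \<open>j\<close>-th column
  of \<open>Y\<close>; the other column of \<open>Y\<close> is unconstrained. The minus sign is due to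
  the integral running from infinity to \<open>x\<close>.\<close>

definition volterra_column ::
  "(real \<Rightarrow> real) \<Rightarrow> (real \<Rightarrow> real) \<Rightarrow> complex \<Rightarrow> 2 \<Rightarrow> (real \<Rightarrow> complex^2^2) \<Rightarrow> bool" where
  "volterra_column u0 u1 k j Y \<longleftrightarrow>
     continuous_on {0..} (\<lambda>x. column j (Y x)) \<and>
     bounded ((\<lambda>x. column j (Y x)) ` {0..}) \<and>
     (\<forall>x\<ge>0. column j (Y x) = column j (mat 1)
        - (LINT x':{x..}|lebesgue.
             column j (exp_hat_pauli3 (\<i> * theta1 k * of_real (x' - x))
                         (pot_U u0 u1 x' k ** Y x'))))"

text \<open>The solution \<open>X\<close>, read columnwise: the first column is meaningful for nonzero \<open>k\<close> in the
  closed lower half-plane, the second one for nonzero \<open>k\<close> in the closed upper half-plane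
  (and both for \<open>x \<ge> 0\<close>).\<close>

definition sol_X :: "(real \<Rightarrow> real) \<Rightarrow> (real \<Rightarrow> real) \<Rightarrow> real \<Rightarrow> complex \<Rightarrow> complex^2^2" where
  "sol_X u0 u1 x k =
     (\<chi> i j. (THE v. \<exists>Y. volterra_column u0 u1 k j Y \<and> v = Y x $ i $ j))"

subsection \<open>Spectral functions\<close>

abbreviation closed_upper :: "complex set" where
  "closed_upper \<equiv> {k. Im k \<ge> 0}"

definition spec_a :: "(real \<Rightarrow> real) \<Rightarrow> (real \<Rightarrow> real) \<Rightarrow> complex \<Rightarrow> complex" where
  "spec_a u0 u1 k =
     (if k = 0 then Lim (at 0 within closed_upper) (\<lambda>z. sol_X u0 u1 0 z $ 2 $ 2)
      else sol_X u0 u1 0 k $ 2 $ 2)"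

definition spec_b :: "(real \<Rightarrow> real) \<Rightarrow> (real \<Rightarrow> real) \<Rightarrow> complex \<Rightarrow> complex" where
  "spec_b u0 u1 k =
     (if k = 0 then Lim (at 0 within closed_upper) (\<lambda>z. sol_X u0 u1 0 z $ 1 $ 2)
      else sol_X u0 u1 0 k $ 1 $ 2)"

definition mat_G0 :: "(real \<Rightarrow> real) \<Rightarrow> int \<Rightarrow> real \<Rightarrow> complex^2^2" where
  "mat_G0 u0 N x = mat ((-1) powi N) **
     vector [vector [of_real (cos (u0 x / 2)), - of_real (sin (u0 x / 2))],
             vector [of_real (sin (u0 x / 2)), of_real (cos (u0 x / 2))]]"

subsection \<open>Complex derivatives up to the boundary\<close>

text \<open>The library's \<open>deriv\<close> only covers two-sided derivatives. At a boundary point of \<open>S\<close>,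
  differentiation is understood relative to \<open>S\<close>; at an interior point this is the usual
  complex derivative.\<close>

definition deriv_within :: "complex set \<Rightarrow> (complex \<Rightarrow> complex) \<Rightarrow> complex \<Rightarrow> complex" where
  "deriv_within S f k = (THE D. (f has_field_derivative D) (at k within S))"

abbreviation punctured_upper :: "complex set" where
  "punctured_upper \<equiv> closed_upper - {0}"

abbreviation nderiv :: "nat \<Rightarrow> (complex \<Rightarrow> complex) \<Rightarrow> complex \<Rightarrow> complex" where
  "nderiv j \<equiv> (deriv_within punctured_upper ^^ j)"

text \<open>Existence and continuity of the \<open>j\<close>-th derivative; existence refers to the
  function \<open>nderiv (j - 1) f\<close>, so it is meaningful for \<open>j \<ge> 1\<close> once all lower orders exist.\<close>

definition nderiv_exists_continuous :: "nat \<Rightarrow> (complex \<Rightarrow> complex) \<Rightarrow> bool" where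
  "nderiv_exists_continuous j f \<longleftrightarrow>
     (\<forall>k\<in>punctured_upper. nderiv (j - 1) f field_differentiable (at k within punctured_upper)) \<and>
     continuous_on punctured_upper (nderiv j f)"

end

theory Submission
  imports Defs
begin

text \<open>At a fixed \<open>k\<close> with \<open>Im k \<ge> 0\<close>, \<open>k \<noteq> 0\<close>, the second column \<open>v\<close> of \<open>X\<close> solves a Volterra equation whose
component \<open>c\<close> contains the exponential \<open>exp ((t - x) phase c k)\<close>, where \<open>phase 1 k = \<i> (k - 1 / k) / 2\<close> and
\<open>phase 2 k = 0\<close>. The real parts of the phases are nonpositive, so the kernel is bounded by the
coefficients alone. Differentiating the kernel in \<open>k\<close> costs a factor \<open>t - x\<close> for each derivative, and
the weight \<open>(1 + x) ^ n\<close> pays for \<open>n\<close> of them. The Volterra operator is therefore applied to a whole jet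
(a function together with its first \<open>n\<close> derivatives in \<open>k\<close>). With respect to the weight \<open>exp (l \<mu> x)\<close>, where
\<open>\<mu>\<close> is the tail integral of a bound of the kernel and \<open>l\<close> is large, it halves norms
(\<open>jet_op_jet_family\<close>), so the Picard series of all \<open>n\<close> derivatives converge together, uniformly for
\<open>k\<close> away from \<open>0\<close>.

The expansion at infinity comes from a formal series in \<open>1 / k\<close> (\<open>formal_series\<close>): the equation of the first
component determines its next coefficient algebraically, the equation of the second one by an
integration from infinity, and each step uses up one derivative of the data. The truncated series
solves the differential equation up to an error which is \<open>1 / k ^ (m + 1)\<close> times a function in the weighted
\<open>L\<^sup>1\<close> class. The difference to the true solution solves the same Volterra equation with this small forcing, so
it is small together with its derivatives (\<open>expansion_at_infinity\<close>).

The behaviour at \<open>0\<close> needs no separate analysis. The rotation by the angle \<open>u\<^sub>0 / 2\<close>, which at \<open>x = 0\<close> is the matrix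
\<open>G\<^sub>0(0)\<close> up to the sign \<open>(-1) ^ N\<close>, carries the equation with data \<open>(- u\<^sub>0, u\<^sub>1)\<close> at the point \<open>- 1 / k\<close> to the equation
with data \<open>(u\<^sub>0, u\<^sub>1)\<close> at \<open>k\<close> (\<open>gauge_transformation\<close>). Hence an expansion at infinity for the former
data is an expansion at \<open>0\<close> for the latter. The \<open>j\<close>-th derivative of \<open>R (- 1 / k)\<close> involves powers of
\<open>1 / k\<close> up to \<open>2 j\<close>, which explains the loss in the error term at \<open>0\<close>.

The two symmetries are soft: conjugation combined with \<open>k \<mapsto> - cnj k\<close> preserves the equation, and for real \<open>k\<close> the
coefficient matrix is anti-Hermitian, so \<open>|v|\<^sup>2\<close> is constant in \<open>x\<close> and equal to its value \<open>1\<close> at infinity.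

Since the hypotheses speak of weak derivatives, they are first translated into absolutely continuous
functions (\<open>prim\<close>) by the lemma of du Bois-Reymond (\<open>weak_derivative_primitive\<close>); all later calculus uses
only these.\<close>

section \<open>Parametric integrals and absolutely continuous functions\<close>

lemma dominated_absolutely_integrable:
  fixes h :: "'a::euclidean_space \<Rightarrow> 'b::euclidean_space"
  assumes "h \<in> borel_measurable (lebesgue_on T)" "w integrable_on T" "T \<in> sets lebesgue"
    "\<And>t. t \<in> T \<Longrightarrow> norm (h t) \<le> w t"
  shows "h absolutely_integrable_on T"
  using absolutely_integrable_integrable_bound[OF assms(4) _ assms(2)]
    measurable_bounded_by_integrable_imp_integrable[OF assms(1,2,4,3)] by blast

lemma continuous_dominated_absolutely_integrable:
  fixes h :: "real \<Rightarrow> 'b::euclidean_space"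
  assumes "continuous_on T h" "w integrable_on T" "T \<in> sets lebesgue"
    "\<And>t. t \<in> T \<Longrightarrow> norm (h t) \<le> w t"
  shows "h absolutely_integrable_on T"
  by (rule dominated_absolutely_integrable[OF _ assms(2-4)])
     (rule continuous_imp_measurable_on_sets_lebesgue[OF assms(1,3)])

lemma continuous_on_parametric_integral:
  fixes h :: "'p::metric_space \<Rightarrow> real \<Rightarrow> complex"
  assumes meas: "\<And>k. k \<in> S \<Longrightarrow> h k \<in> borel_measurable (lebesgue_on T)"
    and w: "w integrable_on T" and T: "T \<in> sets lebesgue"
    and bound: "\<And>k t. k \<in> S \<Longrightarrow> t \<in> T \<Longrightarrow> norm (h k t) \<le> w t"
    and cont: "\<And>t. t \<in> T \<Longrightarrow> continuous_on S (\<lambda>k. h k t)"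
  shows "continuous_on S (\<lambda>k. integral T (h k))"
  unfolding continuous_on_sequentially comp_def
proof safe
  fix u a assume a: "a \<in> S" "\<forall>n. u n \<in> S" "u \<longlonglongrightarrow> a"
  show "(\<lambda>n. integral T (h (u n))) \<longlonglongrightarrow> integral T (h a)"
  proof (rule dominated_convergence(2)[OF _ w])
    show "h (u n) integrable_on T" for n
      by (rule measurable_bounded_by_integrable_imp_integrable[OF meas w bound T]) (use a in auto)
    show "(\<lambda>n. h (u n) t) \<longlonglongrightarrow> h a t" if "t \<in> T" for t
      using cont[OF that] a unfolding continuous_on_sequentially comp_def by blast
  qed (use a bound in auto)
qed

text \<open>Dominated convergence applies although the domain of integration moves: for \<open>x \<longlongrightarrow> a\<close> the
integrands, extended by \<open>0\<close> to the left of \<open>x\<close>, converge at every point other than \<open>a\<close>.\<close>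

lemma continuous_on_tail_integral:
  fixes h :: "real \<Rightarrow> real \<Rightarrow> complex"
  assumes meas: "\<And>x. x \<ge> 0 \<Longrightarrow> h x \<in> borel_measurable (lebesgue_on {x..})"
    and w: "w integrable_on {0..}"
    and bound: "\<And>x t. 0 \<le> x \<Longrightarrow> x \<le> t \<Longrightarrow> norm (h x t) \<le> w t"
    and cont: "\<And>t. t \<ge> 0 \<Longrightarrow> continuous_on {0..t} (\<lambda>x. h x t)"
  shows "continuous_on {0..} (\<lambda>x. integral {x..} (h x))"
  unfolding continuous_on_sequentially comp_def
proof safe
  fix u and a :: real assume a: "a \<ge> 0" "\<forall>n. u n \<in> {0..}" "u \<longlonglongrightarrow> a"
  define H where "H = (\<lambda>x t. if x \<le> t then h x t else 0)"
  define T where "T = {0..} - {a}"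
  have T: "T \<in> sets lebesgue" unfolding T_def by auto
  have w0: "w t \<ge> 0" if "t \<ge> 0" for t using bound[of t t] that norm_ge_zero order_trans by blast
  have wT: "w integrable_on T"
    unfolding T_def by (rule integrable_spike_set[OF w]) (auto intro: negligible_subset[of "{a}"])
  have eq: "integral {x..} (h x) = integral T (H x)" if "x \<ge> 0" for x
  proof -
    have "integral {x..} (h x) = integral {0..} (H x)"
      unfolding H_def using integral_restrict_Int[of "{0..}" "{x..}" "h x"] that
      by (simp add: Int_absorb1 inf.commute)
    also have "\<dots> = integral T (H x)"
      unfolding T_def by (rule integral_spike_set) (auto intro: negligible_subset[of "{a}"])
    finally show ?thesis .
  qed
  have "(\<lambda>n. integral T (H (u n))) \<longlonglongrightarrow> integral T (H a)"
  proof (rule dominated_convergence(2)[OF _ wT])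
    show "H (u n) integrable_on T" for n
    proof (rule measurable_bounded_by_integrable_imp_integrable[OF _ wT _ T])
      have "u n \<ge> 0" using a by auto
      then have "(\<lambda>t. if t \<in> {u n..} then h (u n) t else 0) \<in> borel_measurable lebesgue"
        by (intro borel_measurable_if_I meas) auto
      then show "H (u n) \<in> borel_measurable (lebesgue_on T)"
        unfolding H_def by (simp add: measurable_restrict_space1)
      show "norm (H (u n) t) \<le> w t" if "t \<in> T" for t
        using bound[of "u n" t] w0[of t] that a unfolding H_def T_def by auto
    qed
    show "norm (H (u n) t) \<le> w t" if "t \<in> T" for n t
      using bound[of "u n" t] w0[of t] that a unfolding H_def T_def by auto
    show "(\<lambda>n. H (u n) t) \<longlonglongrightarrow> H a t" if "t \<in> T" for t
    proof (cases "a < t")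
      case True
      have ev: "\<forall>\<^sub>F n in sequentially. u n < t" using order_tendstoD(2)[OF a(3) True] .
      have "(\<lambda>n. h (min (u n) t) t) \<longlonglongrightarrow> h a t"
      proof (rule continuous_on_tendsto_compose[OF cont[of t]])
        show "(\<lambda>n. min (u n) t) \<longlonglongrightarrow> a"
          using tendsto_min[OF a(3) tendsto_const[of t]] True by (simp add: min_def)
      qed (use a True in \<open>auto simp: eventually_sequentially\<close>)
      moreover have "\<forall>\<^sub>F n in sequentially. h (min (u n) t) t = H (u n) t"
        using ev by eventually_elim (auto simp: H_def min_def)
      ultimately have "(\<lambda>n. H (u n) t) \<longlonglongrightarrow> h a t" by (rule Lim_transform_eventually)
      then show ?thesis using True by (simp add: H_def)
    next
      case False
      then have "t < a" using that by (auto simp: T_def)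
      have "\<forall>\<^sub>F n in sequentially. t < u n" using order_tendstoD(1)[OF a(3) \<open>t < a\<close>] .
      then have "\<forall>\<^sub>F n in sequentially. H a t = H (u n) t"
        by eventually_elim (use \<open>t < a\<close> in \<open>auto simp: H_def\<close>)
      then show ?thesis by (rule Lim_transform_eventually[OF tendsto_const])
    qed
  qed
  then show "(\<lambda>n. integral {u n..} (h (u n))) \<longlonglongrightarrow> integral {a..} (h a)"
    using eq a by auto
qed

text \<open>Convexity of \<open>S\<close> gives the mean value inequality, so the bound of the derivative also dominates the
difference quotients. The set \<open>S\<close> may have boundary points, because the real axis is needed too.\<close>

lemma has_field_derivative_parametric_integral:
  fixes h :: "complex \<Rightarrow> real \<Rightarrow> complex"
  assumes S: "convex S" and T: "T \<in> sets lebesgue" and w: "w integrable_on T"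
    and meas: "\<And>k. k \<in> S \<Longrightarrow> h k \<in> borel_measurable (lebesgue_on T)"
    and bound: "\<And>k t. k \<in> S \<Longrightarrow> t \<in> T \<Longrightarrow> norm (h k t) \<le> w t"
    and meas': "\<And>k. k \<in> S \<Longrightarrow> h' k \<in> borel_measurable (lebesgue_on T)"
    and bound': "\<And>k t. k \<in> S \<Longrightarrow> t \<in> T \<Longrightarrow> norm (h' k t) \<le> w t"
    and deriv: "\<And>k t. k \<in> S \<Longrightarrow> t \<in> T \<Longrightarrow> ((\<lambda>k. h k t) has_field_derivative h' k t) (at k within S)"
    and a: "a \<in> S"
  shows "((\<lambda>k. integral T (h k)) has_field_derivative integral T (h' a)) (at a within S)"
  unfolding has_field_derivative_iff tendsto_at_iff_sequentially comp_def
proof safe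
  fix u :: "nat \<Rightarrow> complex" assume u: "\<forall>n. u n \<in> S - {a}" "u \<longlonglongrightarrow> a"
  have int: "h k integrable_on T" if "k \<in> S" for k
    by (rule measurable_bounded_by_integrable_imp_integrable[OF meas[OF that] w bound[OF that] T])
  have "(\<lambda>n. integral T (\<lambda>t. (h (u n) t - h a t) / (u n - a))) \<longlonglongrightarrow> integral T (h' a)"
  proof (rule dominated_convergence(2)[OF _ w])
    show "(\<lambda>t. (h (u n) t - h a t) / (u n - a)) integrable_on T" for n
      unfolding divide_inverse by (intro integrable_on_mult_left integrable_diff int) (use u a in auto)
    show "norm ((h (u n) t - h a t) / (u n - a)) \<le> w t" if "t \<in> T" for n t
    proof -
      have "norm (h (u n) t - h a t) \<le> w t * norm (u n - a)"
        by (rule field_differentiable_bound[OF S]) (use deriv bound' that u a in auto)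
      moreover have "norm (u n - a) > 0" using u by auto
      ultimately show ?thesis by (simp add: norm_divide divide_le_eq)
    qed
    show "(\<lambda>n. (h (u n) t - h a t) / (u n - a)) \<longlonglongrightarrow> h' a t" if "t \<in> T" for t
      using deriv[OF a that] u
      unfolding has_field_derivative_iff tendsto_at_iff_sequentially comp_def by blast
  qed
  moreover have "integral T (\<lambda>t. (h (u n) t - h a t) / (u n - a))
      = (integral T (h (u n)) - integral T (h a)) / (u n - a)" for n
  proof -
    have "u n \<in> S" using u by auto
    then show ?thesis using integral_diff[OF int int[OF a]] by simp
  qed
  ultimately show "(\<lambda>n. (integral T (h (u n)) - integral T (h a)) / (u n - a))
      \<longlonglongrightarrow> integral T (h' a)" by (simp only:)
qed

lemma absolutely_integrable_on_imp_integrable_on: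
  fixes f :: "'a::euclidean_space \<Rightarrow> 'b::euclidean_space"
  shows "f absolutely_integrable_on S \<Longrightarrow> f integrable_on S"
  by (rule set_lebesgue_integral_eq_integral(1))

lemma tendsto_integral_at_top:
  fixes f :: "real \<Rightarrow> 'a::euclidean_space"
  assumes "f absolutely_integrable_on {x..}"
  shows "((\<lambda>R. integral {x..R} f) \<longlongrightarrow> integral {x..} f) at_top"
proof -
  have "((\<lambda>R. LINT t:{x..R}|lebesgue. f t) \<longlongrightarrow> (LINT t:{x..}|lebesgue. f t)) at_top"
    by (rule tendsto_set_lebesgue_integral_at_top) (use assms in auto)
  moreover have "f absolutely_integrable_on {x..R}" for R
    using assms by (rule set_integrable_subset) auto
  ultimately show ?thesis using assms by (simp add: set_lebesgue_integral_eq_integral)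
qed

lemma integral_split_tail:
  fixes f :: "real \<Rightarrow> 'a::euclidean_space"
  assumes "f absolutely_integrable_on {x..}" "x \<le> R"
  shows "integral {x..} f = integral {x..R} f + integral {R..} f"
proof -
  have 1: "f integrable_on {x..R}" "f integrable_on {R..}"
    by (rule absolutely_integrable_on_imp_integrable_on[OF set_integrable_subset[OF assms(1)]];
        use assms in auto)+
  have "integral ({x..R} \<union> {R..}) f = integral {x..R} f + integral {R..} f"
    by (rule integral_Un[OF 1]) (auto intro: negligible_subset[of "{R}"])
  moreover have "{x..R} \<union> {R..} = {x..}" using assms by auto
  ultimately show ?thesis by simp
qed

lemma tail_integral_tendsto_0:
  fixes f :: "real \<Rightarrow> 'a::euclidean_space"
  assumes "f absolutely_integrable_on {x..}"
  shows "((\<lambda>R. integral {R..} f) \<longlongrightarrow> 0) at_top"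
proof -
  have "((\<lambda>R. integral {x..} f - integral {x..R} f) \<longlongrightarrow> integral {x..} f - integral {x..} f) at_top"
    by (intro tendsto_intros tendsto_integral_at_top assms)
  moreover have "\<forall>\<^sub>F R in at_top. integral {x..} f - integral {x..R} f = integral {R..} f"
    using eventually_ge_at_top[of x] by eventually_elim (simp add: integral_split_tail[OF assms])
  ultimately have "((\<lambda>R. integral {R..} f) \<longlongrightarrow> integral {x..} f - integral {x..} f) at_top"
    by (rule Lim_transform_eventually)
  then show ?thesis by simp
qed

text \<open>Absolute continuity on bounded intervals, in integrated form. The values of \<open>f'\<close> matter only almost
everywhere, whereas those of \<open>f\<close> are meaningful at every point.\<close>

definition prim :: "(real \<Rightarrow> 'a::euclidean_space) \<Rightarrow> (real \<Rightarrow> 'a) \<Rightarrow> bool" where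
  "prim f f' \<longleftrightarrow> (\<forall>R. f' absolutely_integrable_on {0..R}) \<and>
                  (\<forall>x\<ge>0. f x = f 0 + integral {0..x} f')"

lemma prim_integrable: "prim f f' \<Longrightarrow> 0 \<le> x \<Longrightarrow> f' absolutely_integrable_on {x..y}"
  unfolding prim_def by (rule set_integrable_subset[of _ "{0..y}"]) auto

lemma prim_eq: "prim f f' \<Longrightarrow> 0 \<le> x \<Longrightarrow> f x = f 0 + integral {0..x} f'"
  unfolding prim_def by blast

lemma prim_increment:
  assumes "prim f f'" "0 \<le> x" "x \<le> y"
  shows "f y - f x = integral {x..y} f'"
proof -
  have "integral {0..x} f' + integral {x..y} f' = integral {0..y} f'"
    by (rule Henstock_Kurzweil_Integration.integral_combine[OF assms(2,3)
          absolutely_integrable_on_imp_integrable_on[OF prim_integrable[OF assms(1) order_refl]]])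
  then show ?thesis
    unfolding prim_eq[OF assms(1,2)] prim_eq[OF assms(1) order_trans[OF assms(2,3)]]
    by (simp add: algebra_simps)
qed

lemma prim_continuous:
  assumes "prim f f'"
  shows "continuous_on {0..} f"
proof -
  have "continuous_on {0..<R} f" for R
  proof (rule continuous_on_subset[of "{0..R}"])
    have "continuous_on {0..R} (\<lambda>x. f 0 + integral {0..x} f')"
      by (intro continuous_intros indefinite_integral_continuous_1
            absolutely_integrable_on_imp_integrable_on[OF prim_integrable[OF assms order_refl]])
    then show "continuous_on {0..R} f"
      by (rule continuous_on_eq) (use prim_eq[OF assms] in \<open>rule sym, simp only: atLeastAtMost_iff\<close>)
  qed auto
  then have "continuous (at x within {0..}) f" if "x \<ge> 0" for x
  proof -
    have "at x within {0..} = at x within {0..<x+1}"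
      by (rule at_within_nhd[of x "{..<x+1}"]) auto
    then show ?thesis using \<open>continuous_on {0..<x+1} f\<close> that
      by (auto simp: continuous_on_eq_continuous_within)
  qed
  then show ?thesis by (auto simp: continuous_on_eq_continuous_within)
qed

text \<open>Pointwise differentiation is not available for absolutely continuous functions. On a short interval
the increment of \<open>f g\<close> differs from the integral of \<open>f' g + f g'\<close> by at most \<open>e\<close> times the integral of
\<open>norm f' + norm g'\<close>. This estimate is additive over adjacent intervals, so bisection
extends it to all of \<open>{0..x}\<close>.\<close>

lemma prim_product:
  fixes f g :: "real \<Rightarrow> 'a::{euclidean_space, real_normed_field}"
  assumes f: "prim f f'" and g: "prim g g'"
  shows "prim (\<lambda>x. f x * g x) (\<lambda>x. f' x * g x + f x * g' x)"
proof -
  define h where "h = (\<lambda>t. f' t * g t + f t * g' t)"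
  have bm: "u \<in> borel_measurable (lebesgue_on {x..y})" "bounded (u ` {x..y})"
    if "prim u u'" "0 \<le> x" for u u' :: "real \<Rightarrow> 'a" and x y
  proof -
    have c: "continuous_on {x..y} u"
      by (rule continuous_on_subset[OF prim_continuous[OF that(1)]]) (use that in auto)
    show "bounded (u ` {x..y})"
      by (intro compact_imp_bounded compact_continuous_image c) auto
    show "u \<in> borel_measurable (lebesgue_on {x..y})"
      by (rule continuous_imp_measurable_on_sets_lebesgue[OF c]) auto
  qed
  have bmult: "bilinear (\<lambda>x y :: 'a. x * y)"
    unfolding bilinear_conv_bounded_bilinear by (rule bounded_bilinear_mult)
  have bmult': "bilinear (\<lambda>x y :: 'a. y * x)"
    unfolding bilinear_conv_bounded_bilinear by (rule bounded_bilinear.flip[OF bounded_bilinear_mult])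
  have h1: "(\<lambda>t. f' t * g t) absolutely_integrable_on {x..y}"
       and h2: "(\<lambda>t. f t * g' t) absolutely_integrable_on {x..y}" if "0 \<le> x" for x y
    by (rule absolutely_integrable_bounded_measurable_product[OF bmult' bm(1)[OF g that] _ bm(2)[OF g that] prim_integrable[OF f that]], simp)
       (rule absolutely_integrable_bounded_measurable_product[OF bmult bm(1)[OF f that] _ bm(2)[OF f that] prim_integrable[OF g that]], simp)
  have hint: "h absolutely_integrable_on {x..y}" if "0 \<le> x" for x y
    unfolding h_def using h1[OF that] h2[OF that] by (rule set_integral_add(1))
  define w where "w = (\<lambda>t. norm (f' t) + norm (g' t))"
  have wint: "w absolutely_integrable_on {x..y}" if "0 \<le> x" for x y
    unfolding w_def
    by (intro set_integral_add(1) absolutely_integrable_norm[unfolded comp_def] prim_integrable[OF f] prim_integrable[OF g] that)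
  have *: "f x * g x = f 0 * g 0 + integral {0..x} h" if x: "0 \<le> x" for x
  proof -
    have "norm (f x * g x - f 0 * g 0 - integral {0..x} h) \<le> e * integral {0..x} w" if "e > 0" for e
    proof -
      define P where "P = (\<lambda>a b. 0 \<le> a \<longrightarrow> norm (f b * g b - f a * g a - integral {a..b} h) \<le> e * integral {a..b} w)"
      have "P 0 x"
      proof (rule Bolzano[OF x])
        fix a b c assume A: "P a b" "P b c" "a \<le> b" "b \<le> c"
        show "P a c" unfolding P_def
        proof
          assume "0 \<le> a"
          have ih: "integral {a..b} h + integral {b..c} h = integral {a..c} h" and
            iw: "integral {a..b} w + integral {b..c} w = integral {a..c} w"
            by (rule Henstock_Kurzweil_Integration.integral_combine[OF A(3,4)
                  absolutely_integrable_on_imp_integrable_on[OF hint[OF \<open>0 \<le> a\<close>]]],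
                rule Henstock_Kurzweil_Integration.integral_combine[OF A(3,4)
                  absolutely_integrable_on_imp_integrable_on[OF wint[OF \<open>0 \<le> a\<close>]]])
          have 1: "f c * g c - f a * g a - integral {a..c} h =
               (f b * g b - f a * g a - integral {a..b} h) + (f c * g c - f b * g b - integral {b..c} h)"
            unfolding ih[symmetric] by simp
          have "0 \<le> b" using A \<open>0 \<le> a\<close> by simp
          then have "norm (f b * g b - f a * g a - integral {a..b} h) \<le> e * integral {a..b} w"
            "norm (f c * g c - f b * g b - integral {b..c} h) \<le> e * integral {b..c} w"
            using A(1,2) \<open>0 \<le> a\<close> unfolding P_def by blast+
          then show "norm (f c * g c - f a * g a - integral {a..c} h) \<le> e * integral {a..c} w"
            unfolding 1 iw[symmetric] distrib_left by (intro norm_triangle_le add_mono)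
        qed
      next
        fix y assume y: "0 \<le> y" "y \<le> x"
        have near: "\<exists>d>0. \<forall>z\<ge>0. dist z y < d \<longrightarrow> dist (u z) (u y) < e/2"
          if "prim u u'" for u u' :: "real \<Rightarrow> 'a"
        proof -
          have "continuous (at y within {0..}) u"
            using prim_continuous[OF that] y(1) unfolding continuous_on_eq_continuous_within by auto
          from this[unfolded continuous_within_eps_delta, rule_format, of "e/2"] \<open>e > 0\<close>
          show ?thesis by auto
        qed
        from near[OF f] obtain d1 where d1: "d1 > 0" "\<And>z. z \<ge> 0 \<Longrightarrow> dist z y < d1 \<Longrightarrow> dist (f z) (f y) < e/2"
          by blast
        from near[OF g] obtain d2 where d2: "d2 > 0" "\<And>z. z \<ge> 0 \<Longrightarrow> dist z y < d2 \<Longrightarrow> dist (g z) (g y) < e/2"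
          by blast
        show "\<exists>d>0. \<forall>a b. a \<le> y \<and> y \<le> b \<and> b - a < d \<longrightarrow> P a b"
        proof (intro exI[of _ "min d1 d2"] conjI allI impI)
          fix a b assume ab: "a \<le> y \<and> y \<le> b \<and> b - a < min d1 d2"
          show "P a b" unfolding P_def
          proof
            assume a0: "0 \<le> a"
            have close: "dist (f z) (f u) < e" "dist (g z) (g u) < e" if "z \<in> {a..b}" "u \<in> {a..b}" for z u
            proof -
              have "dist z y < d1" "dist u y < d1" "dist z y < d2" "dist u y < d2"
                using that ab unfolding dist_real_def atLeastAtMost_iff min_less_iff_conj by arith+
              then show "dist (f z) (f u) < e" "dist (g z) (g u) < e"
                using d1(2)[of z] d1(2)[of u] d2(2)[of z] d2(2)[of u] that a0
                  dist_triangle_half_l[of "f z" "f y" e "f u"] dist_triangle_half_l[of "g z" "g y" e "g u"]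
                by auto
            qed
            have i1: "f b - f a = integral {a..b} f'" "g b - g a = integral {a..b} g'"
              using prim_increment[OF f a0] prim_increment[OF g a0] ab by auto
            have I: "f' integrable_on {a..b}" "g' integrable_on {a..b}" "h integrable_on {a..b}"
               "w integrable_on {a..b}"
              by (rule absolutely_integrable_on_imp_integrable_on[OF prim_integrable[OF f a0]]
                  absolutely_integrable_on_imp_integrable_on[OF prim_integrable[OF g a0]]
                  absolutely_integrable_on_imp_integrable_on[OF hint[OF a0]]
                  absolutely_integrable_on_imp_integrable_on[OF wint[OF a0]])+
            have "f b * g b - f a * g a - integral {a..b} h
              = integral {a..b} f' * g b + f a * integral {a..b} g' - integral {a..b} h"
              unfolding i1[symmetric] by (simp add: algebra_simps)
            also have "\<dots> = integral {a..b} (\<lambda>t. f' t * g b + f a * g' t - h t)"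
              by (rule integral_unique[symmetric])
                 (intro has_integral_diff has_integral_add has_integral_mult_left has_integral_mult_right
                    integrable_integral I)
            also have "norm \<dots> \<le> integral {a..b} (\<lambda>t. e * w t)"
            proof (rule integral_norm_bound_integral)
              show "(\<lambda>t. f' t * g b + f a * g' t - h t) integrable_on {a..b}"
                using I by (intro integrable_diff integrable_add integrable_on_mult_left integrable_on_mult_right) auto
              show "(\<lambda>t. e * w t) integrable_on {a..b}"
                using I by (intro integrable_on_mult_right)
              fix t assume t: "t \<in> {a..b}"
              have "f' t * g b + f a * g' t - h t = f' t * (g b - g t) + (f a - f t) * g' t"
                unfolding h_def by (simp add: algebra_simps)
              also have "norm \<dots> \<le> norm (f' t) * norm (g b - g t) + norm (f a - f t) * norm (g' t)"
                by (rule order_trans[OF norm_triangle_ineq]) (simp add: norm_mult)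
              also have "\<dots> \<le> norm (f' t) * e + e * norm (g' t)"
                using close(2)[of b t] close(1)[of a t] t ab
                by (intro add_mono mult_left_mono mult_right_mono) (auto simp: dist_norm)
              finally show "norm (f' t * g b + f a * g' t - h t) \<le> e * w t"
                unfolding w_def by (simp add: algebra_simps)
            qed
            finally show "norm (f b * g b - f a * g a - integral {a..b} h) \<le> e * integral {a..b} w"
              by simp
          qed
        qed (use d1 d2 in auto)
      qed
      then show ?thesis by (simp add: P_def)
    qed
    then have "norm (f x * g x - f 0 * g 0 - integral {0..x} h) \<le> 0"
    proof -
      let ?c = "integral {0..x} w"
      let ?n = "norm (f x * g x - f 0 * g 0 - integral {0..x} h)"
      assume A: "\<And>e. e > 0 \<Longrightarrow> ?n \<le> e * ?c"
      have "?n \<le> 0 + d" if "d > 0" for d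
      proof -
        have "?n \<le> (d / (\<bar>?c\<bar> + 1)) * ?c" by (rule A) (use that in simp)
        also have "\<dots> \<le> (d / (\<bar>?c\<bar> + 1)) * (\<bar>?c\<bar> + 1)"
          by (rule mult_left_mono) (use that in auto)
        also have "\<dots> = d" by simp
        finally show ?thesis by simp
      qed
      then show ?thesis by (rule field_le_epsilon)
    qed
    then show ?thesis by (simp add: diff_eq_eq add.commute)
  qed
  show ?thesis unfolding prim_def h_def[symmetric] using hint[OF order_refl] * by blast
qed

section \<open>Smooth bumps and the lemma of du Bois-Reymond\<close>

text \<open>The classical smooth function \<open>exp (- 1 / x)\<close>; the denominators \<open>x ^ p\<close> make the family closed under
differentiation up to linear combinations.\<close>

definition flat :: "nat \<Rightarrow> real \<Rightarrow> real" where
  "flat p x = (if x > 0 then exp (- 1 / x) / x ^ p else 0)"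

lemma flat_tendsto_0: "(flat p \<longlongrightarrow> 0) (at 0)"
proof -
  have r: "(flat p \<longlongrightarrow> 0) (at_right 0)"
  proof -
    have "((\<lambda>x::real. (inverse x) ^ p / exp (inverse x)) \<longlongrightarrow> 0) (at_right 0)"
      by (rule filterlim_compose[OF tendsto_power_div_exp_0 filterlim_inverse_at_top_right])
    moreover have "\<forall>\<^sub>F x in at_right 0. (inverse x) ^ p / exp (inverse x) = flat p x"
      unfolding eventually_at_right_field
      by (intro exI[of _ 1]) (auto simp: flat_def exp_minus power_inverse field_simps)
    ultimately show ?thesis by (rule Lim_transform_eventually)
  qed
  have l: "(flat p \<longlongrightarrow> 0) (at_left 0)"
  proof (rule Lim_transform_eventually[OF tendsto_const])
    show "\<forall>\<^sub>F x in at_left 0. 0 = flat p x"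
      unfolding eventually_at_left_field by (intro exI[of _ "-1"]) (auto simp: flat_def)
  qed
  show ?thesis using r l filterlim_split_at by blast
qed

lemma flat_has_derivative:
  "(flat p has_field_derivative flat (p + 2) x - real p * flat (p + 1) x) (at x)"
proof -
  consider "x < 0" | "x > 0" | "x = 0" by linarith
  then show ?thesis
  proof cases
    case 1
    have "((\<lambda>x. 0) has_field_derivative 0) (at x)" by simp
    then have "(flat p has_field_derivative 0) (at x)"
      by (rule has_field_derivative_transform_within[where d="-x"]) (use 1 in \<open>auto simp: flat_def dist_real_def\<close>)
    then show ?thesis using 1 by (simp add: flat_def)
  next
    case 2
    have "((\<lambda>x. exp (- 1 / x) * inverse (x ^ p)) has_field_derivative
       (exp (- 1 / x) * (1 / x\<^sup>2)) * inverse (x ^ p) +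
        exp (- 1 / x) * (- (inverse (x ^ p) * (real p * x ^ (p - 1)) * inverse (x ^ p)))) (at x)"
      by (rule derivative_eq_intros refl | use 2 in \<open>simp add: power2_eq_square field_simps\<close>)+
    moreover have "(exp (- 1 / x) * (1 / x\<^sup>2)) * inverse (x ^ p) +
        exp (- 1 / x) * (- (inverse (x ^ p) * (real p * x ^ (p - 1)) * inverse (x ^ p)))
       = flat (p + 2) x - real p * flat (p + 1) x"
      using 2 by (cases p) (auto simp: flat_def field_simps power2_eq_square)
    ultimately have "((\<lambda>x. exp (- 1 / x) * inverse (x ^ p)) has_field_derivative
       flat (p + 2) x - real p * flat (p + 1) x) (at x)" by simp
    then show ?thesis
      by (rule has_field_derivative_transform_within[where d=x])
         (use 2 in \<open>auto simp: flat_def dist_real_def divide_inverse\<close>)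
  next
    case 3
    have "flat p h / h = flat (p + 1) h" for h by (auto simp: flat_def)
    then have "((\<lambda>h. flat p h / h) \<longlongrightarrow> 0) (at 0)"
      using flat_tendsto_0[of "p+1"] by simp
    then have "(flat p has_field_derivative 0) (at 0)"
      unfolding has_field_derivative_iff by (simp add: flat_def)
    then show ?thesis using 3 by (simp add: flat_def)
  qed
qed

text \<open>An algebra of functions that contains the bumps below and is closed under differentiation, so that
smoothness follows without computing any higher derivative.\<close>

inductive flat_combination :: "(real \<Rightarrow> real) \<Rightarrow> bool" where
  const: "flat_combination (\<lambda>x. c)"
| flat: "flat_combination (\<lambda>x. flat p (\<alpha> * x + \<beta>))"
| add: "flat_combination f \<Longrightarrow> flat_combination g \<Longrightarrow> flat_combination (\<lambda>x. f x + g x)"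
| mult: "flat_combination f \<Longrightarrow> flat_combination g \<Longrightarrow> flat_combination (\<lambda>x. f x * g x)"

lemma flat_combination_derivative:
  "flat_combination f \<Longrightarrow> \<exists>f'. flat_combination f' \<and> (\<forall>x. (f has_field_derivative f' x) (at x))"
proof (induction rule: flat_combination.induct)
  case (const c)
  show ?case by (intro exI[of _ "\<lambda>x. 0"] conjI flat_combination.intros allI) simp
next
  case (flat p \<alpha> \<beta>)
  let ?D = "\<lambda>x. \<alpha> * flat (p + 2) (\<alpha> * x + \<beta>) + (- \<alpha> * real p) * flat (p + 1) (\<alpha> * x + \<beta>)"
  have "((\<lambda>x. flat p (\<alpha> * x + \<beta>)) has_field_derivative ?D x) (at x)" for x
  proof -
    have "((\<lambda>x. \<alpha> * x + \<beta>) has_field_derivative \<alpha>) (at x)"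
      by (auto intro!: derivative_eq_intros)
    from DERIV_chain2[OF flat_has_derivative this] show ?thesis
      by (simp add: algebra_simps)
  qed
  moreover have "flat_combination ?D" by (intro flat_combination.intros)
  ultimately show ?case by blast
next
  case (add f g)
  then obtain f' g' where "flat_combination f'" "flat_combination g'"
    "\<forall>x. (f has_field_derivative f' x) (at x)" "\<forall>x. (g has_field_derivative g' x) (at x)" by blast
  then show ?case
    by (intro exI[of _ "\<lambda>x. f' x + g' x"]) (auto intro: flat_combination.intros DERIV_add)
next
  case (mult f g)
  then obtain f' g' where *: "flat_combination f'" "flat_combination g'"
    "\<forall>x. (f has_field_derivative f' x) (at x)" "\<forall>x. (g has_field_derivative g' x) (at x)" by blast
  have "((\<lambda>x. f x * g x) has_field_derivative f' x * g x + g' x * f x) (at x)" for x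
    using * by (auto intro: DERIV_mult)
  moreover have "flat_combination (\<lambda>x. f' x * g x + g' x * f x)"
    using * mult by (intro flat_combination.intros)
  ultimately show ?case by blast
qed

lemma flat_combination_smooth:
  assumes "flat_combination f"
  shows "(deriv ^^ i) f field_differentiable at x"
proof -
  have "flat_combination ((deriv ^^ i) f)"
  proof (induction i)
    case (Suc i)
    then obtain f' where f': "flat_combination f'" "\<And>x. ((deriv ^^ i) f has_field_derivative f' x) (at x)"
      using flat_combination_derivative by blast
    have "deriv ((deriv ^^ i) f) = f'" using DERIV_imp_deriv[OF f'(2)] by auto
    then show ?case using f' by simp
  qed (use assms in simp)
  then show ?thesis using flat_combination_derivative field_differentiable_def by blast
qed

text \<open>Dilating the flat functions by \<open>n\<close> makes the bumps converge to the indicator of the interval, while they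
stay between \<open>0\<close> and \<open>1\<close>.\<close>

definition bump :: "real \<Rightarrow> real \<Rightarrow> nat \<Rightarrow> real \<Rightarrow> real" where
  "bump a b n x = flat 0 (real n * (x - a)) * flat 0 (real n * (b - x))"

lemma bump_nonneg: "bump a b n x \<ge> 0" and bump_le_1: "bump a b n x \<le> 1"
  and bump_support: "x \<notin> {a<..<b} \<Longrightarrow> bump a b n x = 0"
  unfolding bump_def
  by (auto simp: flat_def mult_le_one zero_less_mult_iff)

lemma bump_tendsto: "(\<lambda>n. bump a b n x) \<longlonglongrightarrow> indicator {a<..<b} x"
proof (cases "x \<in> {a<..<b}")
  case True
  have *: "(\<lambda>n. flat 0 (real n * y)) \<longlonglongrightarrow> 1" if "y > 0" for y
  proof -
    have "(\<lambda>n. exp (- (1 / y) * inverse (real n))) \<longlonglongrightarrow> exp (- (1 / y) * 0)"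
      by (intro tendsto_intros lim_inverse_n)
    moreover have "\<forall>\<^sub>F n in sequentially. exp (- (1 / y) * inverse (real n)) = flat 0 (real n * y)"
      using eventually_gt_at_top[of 0]
      by eventually_elim (use that in \<open>auto simp: flat_def field_simps\<close>)
    ultimately have "(\<lambda>n. flat 0 (real n * y)) \<longlonglongrightarrow> exp (- (1 / y) * 0)"
      by (rule Lim_transform_eventually)
    then show ?thesis by simp
  qed
  have "(\<lambda>n. bump a b n x) \<longlonglongrightarrow> 1 * 1"
    unfolding bump_def by (intro tendsto_mult *) (use True in auto)
  then show ?thesis using True by simp
next
  case False
  then show ?thesis by (simp add: bump_support)
qed

lemma bump_combination: "flat_combination (bump a b n)"
proof -
  have "flat_combination (\<lambda>x. flat 0 (real n * x + - (real n * a)) * flat 0 (- real n * x + real n * b))"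
    by (intro flat_combination.intros)
  then show ?thesis by (simp add: bump_def[abs_def] algebra_simps)
qed

lemma flat_combination_continuous: "flat_combination f \<Longrightarrow> continuous_on A f"
  using flat_combination_derivative DERIV_continuous
  by (metis continuous_at_imp_continuous_on)

text \<open>A primitive of a bump function with vanishing integral has compact support again; such functions are therefore
derivatives of test functions.\<close>

lemma test_function_primitive:
  assumes psi: "flat_combination \<psi>" and supp: "\<And>x. x \<notin> {c..d} \<Longrightarrow> \<psi> x = 0"
    and c: "0 < c" "c \<le> d" and zero: "integral {c..d} \<psi> = 0"
  obtains \<phi> where "test_function \<phi>" "deriv \<phi> = \<psi>" "\<And>x. (\<phi> has_field_derivative \<psi> x) (at x)"
    "\<And>x. x \<notin> {c..d} \<Longrightarrow> \<phi> x = 0"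
proof -
  define \<phi> where "\<phi> = (\<lambda>x. integral {c..x} \<psi>)"
  have int: "\<psi> integrable_on {x..y}" for x y
    by (intro integrable_continuous_real flat_combination_continuous psi)
  have null: "integral {x..y} \<psi> = 0" if "{x..y} \<inter> {c<..<d} = {}" for x y
  proof -
    have "integral {x..y} \<psi> = integral {x..y} (\<lambda>_. 0)"
    proof (rule integral_spike[of "{c, d}"])
      fix t assume "t \<in> {x..y} - {c, d}"
      then have "t \<notin> {c<..<d}" "t \<noteq> c" "t \<noteq> d" using that by blast+
      then show "0 = \<psi> t" using supp[of t] by force
    qed simp
    then show ?thesis by simp
  qed
  have low: "\<phi> x = integral {c - 1..x} \<psi>" for x
  proof (cases "c \<le> x")
    case True
    have "integral {c-1..c} \<psi> = 0" by (rule null) auto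
    then show ?thesis using Henstock_Kurzweil_Integration.integral_combine[of "c-1" c x \<psi>] int True
      by (simp add: \<phi>_def)
  next
    case False
    have "integral {c-1..x} \<psi> = 0" by (rule null) (use False in auto)
    then show ?thesis using False by (simp add: \<phi>_def)
  qed
  have d: "(\<phi> has_field_derivative \<psi> x) (at x)" for x
  proof (cases "x < c")
    case True
    have "((\<lambda>x. 0) has_field_derivative 0) (at x)" by simp
    then have "(\<phi> has_field_derivative 0) (at x)"
      by (rule has_field_derivative_transform_within[where d="c - x"]) (use True in \<open>auto simp: \<phi>_def dist_real_def\<close>)
    then show ?thesis using True supp by simp
  next
    case False
    have "((\<lambda>u. integral {c-1..u} \<psi>) has_vector_derivative \<psi> x) (at x within {c-1..x+1})"
      by (rule integral_has_vector_derivative[OF flat_combination_continuous[OF psi]]) (use False in auto)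
    then have "(\<phi> has_vector_derivative \<psi> x) (at x within {c-1..x+1})" by (simp add: low[abs_def])
    moreover have "at x within {c-1..x+1} = at x"
      by (rule at_within_interior) (use False in auto)
    ultimately show ?thesis by (simp add: has_real_derivative_iff_has_vector_derivative)
  qed
  have dd: "deriv \<phi> = \<psi>" using DERIV_imp_deriv[OF d] by auto
  have out: "\<phi> x = 0" if "x \<notin> {c..d}" for x
  proof (cases "x < c")
    case False
    then have "d < x" using that by auto
    moreover have "integral {d..x} \<psi> = 0" by (rule null) auto
    ultimately show ?thesis
      using Henstock_Kurzweil_Integration.integral_combine[of c d x \<psi>] int c zero by (simp add: \<phi>_def)
  qed (simp add: \<phi>_def)
  have smooth: "(deriv ^^ i) \<phi> field_differentiable (at x)" for i x
  proof (cases i)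
    case 0
    then show ?thesis using d field_differentiable_def by auto
  next
    case (Suc j)
    have "(deriv ^^ Suc j) \<phi> = (deriv ^^ j) \<psi>" unfolding funpow_Suc_right comp_apply dd ..
    then show ?thesis using flat_combination_smooth[OF psi] Suc by metis
  qed
  have "closure {x. \<phi> x \<noteq> 0} \<subseteq> {c..d}" by (rule closure_minimal) (use out in \<open>blast, simp\<close>)
  moreover from this have "compact (closure {x. \<phi> x \<noteq> 0})"
    unfolding compact_eq_bounded_closed by (auto intro: bounded_subset[OF bounded_closed_interval])
  moreover have "{c..d} \<subseteq> {0<..}" using c by auto
  ultimately have "test_function \<phi>"
    unfolding test_function_def using smooth by blast
  then show ?thesis using that dd d out by blast
qed

lemma sigma_finite_lebesgue: "sigma_finite_measure (lebesgue :: real measure)"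
proof
  obtain A :: "real set set" where "countable A" "A \<subseteq> sets lborel" "\<Union>A = space lborel"
    "\<forall>a\<in>A. emeasure lborel a \<noteq> \<infinity>"
    using lborel.sigma_finite_countable by blast
  then show "\<exists>A::real set set. countable A \<and> A \<subseteq> sets lebesgue \<and> \<Union>A = space lebesgue
      \<and> (\<forall>a\<in>A. emeasure lebesgue a \<noteq> \<infinity>)"
    by (intro exI[of _ A]) auto
qed

text \<open>The open intervals generate the Borel sets and are stable under intersection, so Dynkin's argument
makes all integrals over Borel sets vanish; a Lebesgue set differs from a Borel set by a null set.\<close>

lemma AE_zero_of_interval_integrals:
  fixes f :: "real \<Rightarrow> real"
  assumes f: "integrable lebesgue f" and z: "\<And>a b. (LINT x:{a<..<b}|lebesgue. f x) = 0"
  shows "AE x in lebesgue. f x = 0"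
proof (rule sigma_finite_measure.density_zero[OF sigma_finite_lebesgue f])
  have fs: "set_integrable lebesgue A f" if "A \<in> sets lebesgue" for A
    using integrable_mult_indicator[OF that f] by (simp add: set_integrable_def)
  have borel: "(LINT x:A|lebesgue. f x) = 0" if "A \<in> sets borel" for A
  proof -
    define G where "G = range (\<lambda>(a::real, b). {a<..<b})"
    have G: "Int_stable G"
    proof (rule Int_stableI)
      fix A B assume "A \<in> G" "B \<in> G"
      then obtain a b a' b' where "A = {a<..<b}" "B = {a'<..<b'}" by (auto simp only: G_def image_iff split_paired_Ex UNIV_I case_prod_conv)
      then have "A \<inter> B = (\<lambda>(a, b). {a<..<b}) (max a a', min b b')" by auto
      then show "A \<inter> B \<in> G" unfolding G_def by (rule range_eqI)
    qed
    have s: "sets borel = sigma_sets UNIV G"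
      unfolding G_def borel_eq_box box_real by (subst sets_measure_of) auto
    have U: "(LINT x:UNIV|lebesgue. f x) = 0"
    proof -
      have "(\<lambda>n. LINT x:{- real n<..<real n}|lebesgue. f x) \<longlonglongrightarrow> (LINT x:(\<Union>n. {- real n<..<real n})|lebesgue. f x)"
        by (rule set_integral_cont_up) (auto simp: incseq_def intro!: fs)
      moreover have "(\<Union>n. {- real n<..<real n}) = UNIV"
      proof -
        have "\<exists>n. x \<in> {- real n<..<real n}" for x
        proof -
          obtain n where "\<bar>x\<bar> < real n" using reals_Archimedean2 by blast
          then show ?thesis by (intro exI[of _ n]) auto
        qed
        then show ?thesis by auto
      qed
      ultimately have "(\<lambda>n. 0) \<longlonglongrightarrow> (LINT x:UNIV|lebesgue. f x)" by (simp only: z)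
      then show ?thesis using LIMSEQ_unique tendsto_const by blast
    qed
    have leb: "B \<in> sets lebesgue" if "B \<in> sigma_sets UNIV G" for B
      using that unfolding s[symmetric] by auto
    have "G \<subseteq> Pow UNIV" by auto
    from G this that[unfolded s] show ?thesis
    proof (induction rule: sigma_sets_induct_disjoint)
      case (basic A)
      then show ?case by (auto simp: G_def z)
    next
      case (compl A)
      have "(LINT x:A \<union> (UNIV - A)|lebesgue. f x)
          = (LINT x:A|lebesgue. f x) + (LINT x:UNIV - A|lebesgue. f x)"
        by (rule set_integral_Un) (use leb[OF compl(1)] in \<open>auto intro!: fs\<close>)
      then show ?case using U compl by (simp add: Un_UNIV_right)
    next
      case (union A)
      then have Ai: "A i \<in> sets lebesgue" for i using leb by blast
      have "(LINT x:(\<Union>i. A i)|lebesgue. f x) = (\<Sum>i. (LINT x:(A i)|lebesgue. f x))"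
        by (rule lebesgue_integral_countable_add)
           (use union(1) Ai in \<open>auto simp: disjoint_family_on_def intro!: fs\<close>)
      then show ?case using union by simp
    qed (simp add: set_lebesgue_integral_def)
  qed
  fix A :: "real set" assume A: "A \<in> sets lebesgue"
  then obtain S N N' where SN: "A = S \<union> N" "N \<subseteq> N'" "N' \<in> null_sets lborel" "S \<in> sets lborel"
    by (rule sets_completionE)
  have "AE x in lebesgue. x \<notin> N'" using SN(3) by (intro AE_not_in null_sets_completionI)
  then have "(LINT x:A|lebesgue. f x) = (LINT x:S|lebesgue. f x)"
    unfolding set_lebesgue_integral_def
  proof (intro integral_cong_AE)
    show "AE x in lebesgue. indicator A x *\<^sub>R f x = indicator S x *\<^sub>R f x"
      using \<open>AE x in lebesgue. x \<notin> N'\<close> by eventually_elim (use SN in \<open>auto simp: indicator_def\<close>)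
    have "integrable lebesgue (\<lambda>x. indicator B x *\<^sub>R f x)" if "B \<in> sets lebesgue" for B
      by (rule integrable_mult_indicator[OF that f])
    then show "(\<lambda>x. indicator A x *\<^sub>R f x) \<in> borel_measurable lebesgue"
      "(\<lambda>x. indicator S x *\<^sub>R f x) \<in> borel_measurable lebesgue"
      using A SN(4) by (blast intro: borel_measurable_integrable lborelD)+
  qed
  then show "(LINT x:A|lebesgue. f x) = 0" using borel SN by simp
qed

lemma set_lebesgue_integral_eq_of_vanishing:
  fixes h :: "real \<Rightarrow> real"
  assumes "h absolutely_integrable_on {c..d}" "\<And>x. x \<notin> {c..d} \<Longrightarrow> h x = 0" "{c..d} \<subseteq> T"
  shows "(LINT x:T|lebesgue. h x) = integral {c..d} h"
proof -
  have "(LINT x:T|lebesgue. h x) = (LINT x:{c..d}|lebesgue. h x)"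
    unfolding set_lebesgue_integral_def
    by (rule Bochner_Integration.integral_cong) (use assms(2,3) in \<open>auto simp: indicator_def\<close>)
  then show ?thesis using set_lebesgue_integral_eq_integral(2)[OF assms(1)] by simp
qed

lemma absolutely_integrable_mult_continuous:
  fixes f g :: "real \<Rightarrow> 'a::{euclidean_space,real_normed_field}"
  assumes "continuous_on {c..d} f" "g absolutely_integrable_on {c..d}"
  shows "(\<lambda>x. g x * f x) absolutely_integrable_on {c..d}"
proof -
  have 1: "f \<in> borel_measurable (lebesgue_on {c..d})"
    by (rule continuous_imp_measurable_on_sets_lebesgue[OF assms(1)]) auto
  have 2: "bounded (f ` {c..d})" by (intro compact_imp_bounded compact_continuous_image assms) auto
  have 3: "bilinear (\<lambda>x y :: 'a. y * x)"
    unfolding bilinear_conv_bounded_bilinear by (rule bounded_bilinear.flip[OF bounded_bilinear_mult])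
  show ?thesis
    by (rule absolutely_integrable_bounded_measurable_product[OF 3 1 _ 2 assms(2)]) simp
qed

text \<open>The lemma of du Bois-Reymond. Subtracting the right multiple of one fixed bump gives any other bump
the integral \<open>0\<close>, hence makes it the derivative of a test function. So \<open>F\<close> integrates against every bump
as the constant does, and bumps approximate indicators of intervals. The fixed bump lives on \<open>{1..2}\<close> for all
\<open>c\<close> and \<open>d\<close>; the constants for different intervals are then equal by their formula.\<close>

lemma constant_AE_on_interval:
  fixes F :: "real \<Rightarrow> real"
  assumes F: "F absolutely_integrable_on {c..d}" and c: "0 < c" "c \<le> 1" "2 \<le> d"
    and zero: "\<And>\<phi>. test_function \<phi> \<Longrightarrow> (\<And>x. x \<notin> {c..d} \<Longrightarrow> \<phi> x = 0) \<Longrightarrow>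
                 continuous_on UNIV (deriv \<phi>) \<Longrightarrow> (LINT x:{0<..}|lebesgue. F x * deriv \<phi> x) = 0"
  shows "AE x in lebesgue. x \<in> {c..d} \<longrightarrow>
           F x = integral {1..2} (\<lambda>x. F x * bump 1 2 1 x) / integral {1..2} (bump 1 2 1)"
proof -
  define I where "I = integral {c..d} (bump 1 2 1)"
  define C where "C = integral {c..d} (\<lambda>x. F x * bump 1 2 1 x) / I"
  have contb: "continuous_on A (bump a b n)" for a b n A
    by (rule flat_combination_continuous[OF bump_combination])
  have sub: "integral {c..d} (\<lambda>x. u x * bump 1 2 1 x) = integral {1..2} (\<lambda>x. u x * bump 1 2 1 x)" for u :: "real \<Rightarrow> real"
    by (rule integral_spike_set) (use c in \<open>auto intro!: negligible_subset[OF negligible_empty] simp: bump_support\<close>)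
  have Ipos: "I > 0"
  proof -
    have "I \<noteq> 0"
    proof
      assume "I = 0"
      have bi: "(bump 1 2 1 has_integral 0) (cbox c d)"
        using \<open>I = 0\<close> integrable_integral[OF integrable_continuous_real[OF contb]] unfolding I_def
        by (metis cbox_interval)
      have "bump 1 2 1 (3/2) = 0"
        by (rule has_integral_0_cbox_imp_0[OF contb _ bi]) (use c in \<open>auto intro: bump_nonneg\<close>)
      then show False by (simp add: bump_def flat_def)
    qed
    moreover have "I \<ge> 0" unfolding I_def
      by (intro integral_nonneg integrable_continuous_real contb bump_nonneg)
    ultimately show ?thesis by simp
  qed
  \<comment> \<open>The constant \<open>r\<close> gives the combination of the two bumps the integral \<open>0\<close>.\<close>
  have main: "integral {c..d} (\<lambda>x. F x * bump a b n x) = C * integral {c..d} (bump a b n)"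
    if ab: "c \<le> a" "b \<le> d" for a b n
  proof -
    define r where "r = integral {c..d} (bump a b n) / I"
    define \<psi> where "\<psi> = (\<lambda>x. bump a b n x + (- r) * bump 1 2 1 x)"
    have psi: "flat_combination \<psi>"
      unfolding \<psi>_def by (intro flat_combination.intros bump_combination)
    have supp: "\<psi> x = 0" if "x \<notin> {c..d}" for x
      using that ab c by (auto simp: \<psi>_def bump_support)
    have ib: "bump a b n integrable_on {c..d}" for a b n
      by (intro integrable_continuous_real contb)
    have "integral {c..d} \<psi> = integral {c..d} (bump a b n) + (- r) * I"
      unfolding \<psi>_def I_def
      by (rule integral_unique, intro has_integral_add has_integral_mult_right integrable_integral ib)
    then have "integral {c..d} \<psi> = 0" using Ipos by (simp add: r_def)
    then obtain \<phi> where \<phi>: "test_function \<phi>" "deriv \<phi> = \<psi>" "\<And>x. x \<notin> {c..d} \<Longrightarrow> \<phi> x = 0"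
      using test_function_primitive[OF psi supp] c by (metis order_trans one_le_numeral)
    have Fpsi: "(\<lambda>x. F x * u x) absolutely_integrable_on {c..d}" if "flat_combination u" for u
      by (rule absolutely_integrable_mult_continuous[OF flat_combination_continuous[OF that] F])
    have "0 = (LINT x:{0<..}|lebesgue. F x * \<psi> x)"
      using zero[OF \<phi>(1,3)] \<phi>(2) flat_combination_continuous[OF psi] by simp
    also have "\<dots> = integral {c..d} (\<lambda>x. F x * \<psi> x)"
      by (rule set_lebesgue_integral_eq_of_vanishing) (use Fpsi[OF psi] supp c in auto)
    also have "\<dots> = integral {c..d} (\<lambda>x. F x * bump a b n x + (- r) * (F x * bump 1 2 1 x))"
      by (rule integral_cong) (simp add: \<psi>_def algebra_simps)
    also have "\<dots> = integral {c..d} (\<lambda>x. F x * bump a b n x) + (- r) * integral {c..d} (\<lambda>x. F x * bump 1 2 1 x)"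
      by (rule integral_unique, intro has_integral_add has_integral_mult_right integrable_integral)
         (intro absolutely_integrable_on_imp_integrable_on Fpsi bump_combination)+
    finally show ?thesis unfolding C_def r_def using Ipos by (simp add: field_simps)
  qed
  have absF: "(\<lambda>x. F x - C) absolutely_integrable_on {c..d}"
    by (intro set_integral_diff(1) F absolutely_integrable_continuous_real continuous_intros)
  have intzero: "integral {a..b} (\<lambda>x. F x - C) = 0" if ab: "c \<le> a" "a < b" "b \<le> d" for a b
  proof -
    have i2: "(\<lambda>x. (F x - C) * bump a b n x) integrable_on {c..d}" for n
      by (intro absolutely_integrable_on_imp_integrable_on absolutely_integrable_mult_continuous contb absF)
    have z: "integral {c..d} (\<lambda>x. (F x - C) * bump a b n x) = 0" for n
    proof -
      have "((\<lambda>x. F x * bump a b n x - C * bump a b n x) has_integral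
         integral {c..d} (\<lambda>x. F x * bump a b n x) - C * integral {c..d} (bump a b n)) {c..d}"
        by (intro has_integral_diff has_integral_mult_right integrable_integral
             absolutely_integrable_on_imp_integrable_on[OF absolutely_integrable_mult_continuous[OF contb F]]
             integrable_continuous_real contb)
      from integral_unique[OF this] show ?thesis
        unfolding left_diff_distrib main[OF ab(1,3)] by simp
    qed
    have "(\<lambda>n. integral {c..d} (\<lambda>x. (F x - C) * bump a b n x))
       \<longlonglongrightarrow> integral {c..d} (\<lambda>x. (F x - C) * indicator {a<..<b} x)"
    proof (rule dominated_convergence(2)[where h="\<lambda>x. norm (F x - C)", OF i2])
      show "(\<lambda>x. norm (F x - C)) integrable_on {c..d}"
        using absF unfolding absolutely_integrable_on_def by (rule conjunct2)
      show "norm ((F x - C) * bump a b n x) \<le> norm (F x - C)" for n x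
        using bump_nonneg[of a b n x] bump_le_1[of a b n x]
        by (simp add: abs_mult mult_left_le)
      show "(\<lambda>n. (F x - C) * bump a b n x) \<longlonglongrightarrow> (F x - C) * indicator {a<..<b} x" for x
        by (intro tendsto_intros bump_tendsto)
    qed
    then have "(\<lambda>n. 0) \<longlonglongrightarrow> integral {c..d} (\<lambda>x. (F x - C) * indicator {a<..<b} x)"
      by (simp only: z)
    then have "integral {c..d} (\<lambda>x. (F x - C) * indicator {a<..<b} x) = 0"
      using LIMSEQ_unique tendsto_const by blast
    also have "integral {c..d} (\<lambda>x. (F x - C) * indicator {a<..<b} x)
       = integral {c..d} (\<lambda>x. if x \<in> {a<..<b} then F x - C else 0)"
      by (rule integral_cong) (auto simp: indicator_def)
    also have "\<dots> = integral ({a<..<b} \<inter> {c..d}) (\<lambda>x. F x - C)"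
      using integral_restrict_Int[of "{c..d}" "{a<..<b}"] by simp
    also have "{a<..<b} \<inter> {c..d} = {a<..<b}" using ab by auto
    finally show ?thesis by (simp add: integral_open_interval_real)
  qed
  define f where "f = (\<lambda>x. indicator {c..d} x * (F x - C))"
  have fint: "integrable lebesgue f"
  proof -
    show ?thesis using absF by (simp add: f_def set_integrable_def)
  qed
  have "AE x in lebesgue. f x = 0"
  proof (rule AE_zero_of_interval_integrals[OF fint])
    fix a b :: real
    define a' b' where "a' = max a c" "b' = min b d"
    have ae: "AE x in lebesgue. x \<notin> {c, d}"
      by (rule AE_not_in) (simp add: finite_imp_null_set_lborel null_sets_completionI)
    have "(LINT x:{a<..<b}|lebesgue. f x) = (LINT x:{a'<..<b'}|lebesgue. F x - C)"
      unfolding set_lebesgue_integral_def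
    proof (rule integral_cong_AE)
      show "AE x in lebesgue. indicator {a<..<b} x *\<^sub>R f x = indicator {a'<..<b'} x *\<^sub>R (F x - C)"
        using ae by eventually_elim (auto simp: f_def a'_b'_def indicator_def)
      have "set_integrable lebesgue {a'<..<b'} (\<lambda>x. F x - C)"
        by (rule set_integrable_subset[of _ "{c..d}"])
           (use absF in \<open>auto simp: a'_b'_def\<close>)
      then show "(\<lambda>x. indicator {a'<..<b'} x *\<^sub>R (F x - C)) \<in> borel_measurable lebesgue"
        unfolding set_integrable_def by auto
      show "(\<lambda>x. indicator {a<..<b} x *\<^sub>R f x) \<in> borel_measurable lebesgue"
        by (rule borel_measurable_integrable[OF integrable_mult_indicator[OF _ fint]]) simp
    qed
    also have "\<dots> = integral {a'<..<b'} (\<lambda>x. F x - C)"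
      by (rule set_lebesgue_integral_eq_integral(2), rule set_integrable_subset[of _ "{c..d}"])
           (use absF in \<open>auto simp: a'_b'_def\<close>)
    also have "\<dots> = 0"
    proof (cases "a' < b'")
      case True
      then show ?thesis using intzero[of a' b'] by (auto simp: a'_b'_def integral_open_interval_real)
    qed simp
    finally show "(LINT x:{a<..<b}|lebesgue. f x) = 0" .
  qed
  then have "AE x in lebesgue. x \<in> {c..d} \<longrightarrow> F x = C"
    by eventually_elim (auto simp: f_def)
  moreover have "C = integral {1..2} (\<lambda>x. F x * bump 1 2 1 x) / integral {1..2} (bump 1 2 1)"
    unfolding C_def I_def sub using sub[of "\<lambda>_. 1"] by simp
  ultimately show ?thesis by simp
qed

lemma test_function_derivative: "test_function \<phi> \<Longrightarrow> (\<phi> has_field_derivative deriv \<phi> x) (at x)"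
  unfolding test_function_def
  by (metis DERIV_deriv_iff_field_differentiable funpow_0)

lemma test_function_deriv:
  assumes "test_function \<phi>" shows "test_function (deriv \<phi>)"
proof -
  have sub: "{x. deriv \<phi> x \<noteq> 0} \<subseteq> closure {x. \<phi> x \<noteq> 0}"
  proof (safe, rule ccontr)
    fix x assume x: "deriv \<phi> x \<noteq> 0" "x \<notin> closure {x. \<phi> x \<noteq> 0}"
    have "open (- closure {x. \<phi> x \<noteq> 0})" by auto
    then have "((\<lambda>_. 0) has_field_derivative deriv \<phi> x) (at x)"
      by (rule has_field_derivative_transform_within_open[OF test_function_derivative[OF assms]])
         (use x closure_subset[of "{x. \<phi> x \<noteq> 0}"] in auto)
    then show False using x DERIV_unique[OF _ DERIV_const] by blast
  qed
  then have sub2: "closure {x. deriv \<phi> x \<noteq> 0} \<subseteq> closure {x. \<phi> x \<noteq> 0}"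
    by (rule closure_minimal) auto
  have "(deriv ^^ i) (deriv \<phi>) field_differentiable (at x)" for i x
    using assms unfolding test_function_def by (metis comp_apply funpow_Suc_right)
  moreover have "compact (closure {x. deriv \<phi> x \<noteq> 0})"
    using sub2 assms unfolding test_function_def compact_eq_bounded_closed by (auto intro: bounded_subset)
  ultimately show ?thesis using sub2 assms unfolding test_function_def by blast
qed

lemma prim_of_derivative:
  assumes "\<And>x. x \<ge> 0 \<Longrightarrow> (f has_vector_derivative f' x) (at x within {0..})" "continuous_on {0..} f'"
  shows "prim f f'"
  unfolding prim_def
proof safe
  fix R :: real
  show "f' absolutely_integrable_on {0..R}"
    by (rule absolutely_integrable_continuous_real) (rule continuous_on_subset[OF assms(2)], auto)
next
  fix x :: real assume "x \<ge> 0"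
  then have "(f' has_integral (f x - f 0)) {0..x}"
    by (rule fundamental_theorem_of_calculus)
       (rule has_vector_derivative_within_subset[OF assms(1)], auto)
  then show "f x = f 0 + integral {0..x} f'" by (simp add: integral_unique)
qed

text \<open>The difference of \<open>f\<close> and the primitive of \<open>g\<close> has weak derivative \<open>0\<close>, by the product rule for
absolutely continuous functions, so it is constant on each compact interval in the open half-line.\<close>

theorem weak_derivative_primitive:
  fixes f g :: "real \<Rightarrow> real"
  assumes wd: "is_weak_deriv 1 f g" and g: "g absolutely_integrable_on {0..}"
  shows "\<exists>C. AE x in lebesgue. x > 0 \<longrightarrow> f x = C + integral {0..x} g"
proof -
  define G where "G = (\<lambda>x. integral {0..x} g)"
  have primG: "prim G g"
    unfolding prim_def G_def using set_integrable_subset[OF g] by auto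
  define F where "F = (\<lambda>x. f x - G x)"
  define C where "C = integral {1..2} (\<lambda>x. F x * bump 1 2 1 x) / integral {1..2} (bump 1 2 1)"
  have fint: "f absolutely_integrable_on {c..d}" if "0 < c" for c d
    using wd that unfolding is_weak_deriv_def by blast
  have Gc: "continuous_on {c..d} G" if "0 < c" for c d
    by (rule continuous_on_subset[OF prim_continuous[OF primG]]) (use that in auto)
  have Fint: "F absolutely_integrable_on {c..d}" if "0 < c" for c d
    unfolding F_def by (intro set_integral_diff(1) fint that absolutely_integrable_continuous_real Gc)
  have zero: "(LINT x:{0<..}|lebesgue. F x * deriv \<phi> x) = 0"
    if phi: "test_function \<phi>" and out: "\<And>x. x \<notin> {c..d} \<Longrightarrow> \<phi> x = 0" and c: "0 < c" "c \<le> d"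
    for \<phi> c d
  proof -
    define c' d' where "c' = c / 2" "d' = d + 1"
    have c': "0 < c'" "c' < c" "d < d'" using c by (auto simp: c'_d'_def)
    have phi': "test_function (deriv \<phi>)" by (rule test_function_deriv[OF phi])
    have dcont: "continuous_on A (deriv \<phi>)" for A
      using test_function_derivative[OF phi'] DERIV_continuous continuous_at_imp_continuous_on by blast
    have pcont: "continuous_on A \<phi>" for A
      using test_function_derivative[OF phi] DERIV_continuous continuous_at_imp_continuous_on by blast
    have dout: "deriv \<phi> x = 0" if "x \<notin> {c'..d'}" for x
    proof -
      have "open (- {c..d})" by auto
      then have "((\<lambda>_. 0) has_field_derivative deriv \<phi> x) (at x)"
        by (rule has_field_derivative_transform_within_open[OF test_function_derivative[OF phi]])
           (use that out c' in auto)
      then show ?thesis using DERIV_unique[OF _ DERIV_const] by blast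
    qed
    have out': "\<phi> x = 0" if "x \<notin> {c'..d'}" for x using out[of x] that c' by auto
    have L: "(LINT x:{0<..}|lebesgue. u x * v x) = integral {c'..d'} (\<lambda>x. u x * v x)"
      if "u absolutely_integrable_on {c'..d'}" "continuous_on UNIV v" "\<And>x. x \<notin> {c'..d'} \<Longrightarrow> v x = 0" for u v :: "real \<Rightarrow> real"
      by (rule set_lebesgue_integral_eq_of_vanishing)
         (use that c' in \<open>auto intro!: absolutely_integrable_mult_continuous intro: continuous_on_subset\<close>)
    have gi: "g absolutely_integrable_on {c'..d'}" using c' by (intro set_integrable_subset[OF g]) auto
    have Gi: "G absolutely_integrable_on {c'..d'}"
      by (intro absolutely_integrable_continuous_real Gc c')
    have ai: "(\<lambda>x. u x * v x) integrable_on {c'..d'}"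
      if "u absolutely_integrable_on {c'..d'}" "continuous_on UNIV v" for u v :: "real \<Rightarrow> real"
      by (intro absolutely_integrable_on_imp_integrable_on absolutely_integrable_mult_continuous)
         (use that in \<open>auto intro: continuous_on_subset\<close>)
    have "prim \<phi> (deriv \<phi>)"
      by (rule prim_of_derivative[OF _ dcont])
         (meson has_real_derivative_iff_has_vector_derivative has_vector_derivative_at_within test_function_derivative[OF phi])
    from prim_product[OF primG this] have "prim (\<lambda>x. G x * \<phi> x) (\<lambda>x. g x * \<phi> x + G x * deriv \<phi> x)" .
    from prim_increment[OF this, of c' d'] c' c
    have "integral {c'..d'} (\<lambda>x. g x * \<phi> x + G x * deriv \<phi> x) = 0"
      using out[of c'] out[of d'] by auto
    then have byparts: "integral {c'..d'} (\<lambda>x. g x * \<phi> x) + integral {c'..d'} (\<lambda>x. G x * deriv \<phi> x) = 0"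
      using integral_add[OF ai[OF gi pcont] ai[OF Gi dcont]] by simp
    have "(LINT x:{0<..}|lebesgue. f x * deriv \<phi> x) = - (LINT x:{0<..}|lebesgue. g x * \<phi> x)"
      using wd phi unfolding is_weak_deriv_def by (auto dest!: spec[of _ \<phi>])
    then have *: "integral {c'..d'} (\<lambda>x. f x * deriv \<phi> x) = - integral {c'..d'} (\<lambda>x. g x * \<phi> x)"
      using L[OF fint[OF c'(1)] dcont dout] L[OF gi pcont out'] by simp
    have "(LINT x:{0<..}|lebesgue. F x * deriv \<phi> x) = integral {c'..d'} (\<lambda>x. F x * deriv \<phi> x)"
      by (rule L[OF Fint[OF c'(1)] dcont dout])
    also have "\<dots> = integral {c'..d'} (\<lambda>x. f x * deriv \<phi> x) - integral {c'..d'} (\<lambda>x. G x * deriv \<phi> x)"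
      unfolding F_def left_diff_distrib
      by (rule integral_diff[OF ai[OF fint[OF c'(1)] dcont] ai[OF Gi dcont]])
    finally show ?thesis using * byparts by simp
  qed
  \<comment> \<open>These intervals contain \<open>{1..2}\<close> and exhaust the open half-line.\<close>
  have "AE x in lebesgue. x \<in> {1 / (real j + 1)..real j + 2} \<longrightarrow> F x = C" for j :: nat
    unfolding C_def
  proof (rule constant_AE_on_interval[OF Fint])
    have j: "0 < 1 / (real j + 1)" "1 / (real j + 1) \<le> 1" "1 \<le> real j + 2" by auto
    show "(LINT x:{0<..}|lebesgue. F x * deriv \<phi> x) = 0"
      if "test_function \<phi>" "\<And>x. x \<notin> {1 / (real j + 1)..real j + 2} \<Longrightarrow> \<phi> x = 0" for \<phi>
      by (rule zero[OF that j(1) order_trans[OF j(2,3)]])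
  qed auto
  then have "AE x in lebesgue. \<forall>j::nat. x \<in> {1 / (real j + 1)..real j + 2} \<longrightarrow> F x = C"
    unfolding AE_all_countable by blast
  then have "AE x in lebesgue. x > 0 \<longrightarrow> f x = C + integral {0..x} g"
  proof eventually_elim
    case (elim x)
    show ?case
    proof
      assume "x > 0"
      obtain j :: nat where j: "max x (1 / x) \<le> real j" using real_arch_simple by blast
      have "1 / (real j + 1) \<le> x"
      proof -
        have "1 \<le> x * real j" using j \<open>x > 0\<close> by (simp add: field_simps)
        then have "1 \<le> x * (real j + 1)" using \<open>x > 0\<close> by (simp add: algebra_simps)
        then show ?thesis by (simp add: field_simps)
      qed
      then have "x \<in> {1 / (real j + 1)..real j + 2}" using j by auto
      with elim have "F x = C" by blast
      then show "f x = C + integral {0..x} g" by (simp add: F_def G_def)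
    qed
  qed
  then show ?thesis by blast
qed

section \<open>Weighted Sobolev classes on the half-line\<close>

lemma prim_add:
  fixes f g :: "real \<Rightarrow> 'a::euclidean_space"
  assumes f: "prim f f'" and g: "prim g g'"
  shows "prim (\<lambda>x. f x + g x) (\<lambda>x. f' x + g' x)"
  unfolding prim_def
proof safe
  fix R show "(\<lambda>x. f' x + g' x) absolutely_integrable_on {0..R}"
    by (intro set_integral_add(1) prim_integrable[OF f] prim_integrable[OF g] order_refl)
next
  fix x :: real assume x: "x \<ge> 0"
  have "integral {0..x} (\<lambda>x. f' x + g' x) = integral {0..x} f' + integral {0..x} g'"
    by (intro integral_add absolutely_integrable_on_imp_integrable_on
       prim_integrable[OF f] prim_integrable[OF g] order_refl)
  then show "f x + g x = f 0 + g 0 + integral {0..x} (\<lambda>x. f' x + g' x)"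
    by (subst prim_eq[OF f x], subst prim_eq[OF g x]) simp
qed

lemma prim_const: "prim (\<lambda>x. c) (\<lambda>x. 0)"
  unfolding prim_def by simp

lemma prim_cmult:
  fixes f :: "real \<Rightarrow> 'a::{euclidean_space,real_normed_field}"
  assumes "prim f f'" shows "prim (\<lambda>x. c * f x) (\<lambda>x. c * f' x)"
  using prim_product[OF prim_const[of c] assms] by simp

lemma prim_cong:
  fixes f :: "real \<Rightarrow> 'a::euclidean_space"
  assumes "prim f f'" "\<And>x. x \<ge> 0 \<Longrightarrow> f x = g x" "\<And>x. x \<ge> 0 \<Longrightarrow> f' x = g' x"
  shows "prim g g'"
  unfolding prim_def
proof safe
  fix R
  have "set_integrable lebesgue {0..R} f' = set_integrable lebesgue {0..R} g'"
    by (rule set_integrable_cong) (use assms(3) in auto)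
  then show "g' absolutely_integrable_on {0..R}"
    using prim_integrable[OF assms(1) order_refl] by blast
next
  fix x :: real assume x: "x \<ge> 0"
  have "integral {0..x} f' = integral {0..x} g'" by (rule integral_cong) (use assms(3) in auto)
  then show "g x = g 0 + integral {0..x} g'"
    using prim_eq[OF assms(1) x] unfolding assms(2)[OF x] assms(2)[OF order_refl] by simp
qed

lemma prim_sum:
  fixes f :: "'i \<Rightarrow> real \<Rightarrow> 'a::euclidean_space"
  assumes "\<And>i. i \<in> I \<Longrightarrow> prim (f i) (f' i)"
  shows "prim (\<lambda>x. \<Sum>i\<in>I. f i x) (\<lambda>x. \<Sum>i\<in>I. f' i x)"
  using assms
proof (induction I rule: infinite_finite_induct)
  case (insert i I)
  then show ?case by (simp add: prim_add)
qed (simp_all add: prim_const)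

lemma prim_linear:
  fixes f :: "real \<Rightarrow> 'a::euclidean_space" and T :: "'a \<Rightarrow> 'b::euclidean_space"
  assumes f: "prim f f'" and T: "bounded_linear T"
  shows "prim (\<lambda>x. T (f x)) (\<lambda>x. T (f' x))"
  unfolding prim_def
proof safe
  fix R show "(\<lambda>x. T (f' x)) absolutely_integrable_on {0..R}"
    using absolutely_integrable_linear[OF prim_integrable[OF f order_refl] T] by (simp add: comp_def)
next
  fix x :: real assume x: "x \<ge> 0"
  interpret bounded_linear T by (rule T)
  have "integral {0..x} (T \<circ> f') = T (integral {0..x} f')"
    by (rule integral_linear[OF absolutely_integrable_on_imp_integrable_on[OF prim_integrable[OF f order_refl]] T])
  then show "T (f x) = T (f 0) + integral {0..x} (\<lambda>x. T (f' x))"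
    by (subst prim_eq[OF f x]) (simp add: add comp_def)
qed

definition weighted_L1 :: "nat \<Rightarrow> (real \<Rightarrow> complex) \<Rightarrow> bool" where
  "weighted_L1 n g \<longleftrightarrow> (\<lambda>x. (1 + x) ^ n *\<^sub>R g x) absolutely_integrable_on {0..}"

text \<open>Membership of a function and of its first \<open>r\<close> derivatives in the weighted \<open>L\<^sup>1\<close> class. The derivatives are taken
in the sense of \<open>prim\<close>, which selects the continuous representatives.\<close>

primrec sobolev :: "nat \<Rightarrow> nat \<Rightarrow> (real \<Rightarrow> complex) \<Rightarrow> bool" where
  "sobolev n 0 g = weighted_L1 n g"
| "sobolev n (Suc r) g = (weighted_L1 n g \<and> (\<exists>g'. prim g g' \<and> sobolev n r g'))"

text \<open>Bounded functions whose derivatives lie in the weighted class. They act on \<open>sobolev n r\<close> by multiplication without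
having to decay; constants and the coefficients of the second component are examples.\<close>

primrec multiplier :: "nat \<Rightarrow> nat \<Rightarrow> (real \<Rightarrow> complex) \<Rightarrow> bool" where
  "multiplier n 0 h = (h \<in> borel_measurable (lebesgue_on {0..}) \<and> bounded (h ` {0..}))"
| "multiplier n (Suc r) h = (\<exists>h'. prim h h' \<and> sobolev n r h')"

lemma weighted_L1_bounded_mult:
  assumes "weighted_L1 n g" "h \<in> borel_measurable (lebesgue_on {0..})" "bounded (h ` {0..})"
  shows "weighted_L1 n (\<lambda>x. h x * g x)"
proof -
  have 3: "bilinear (\<lambda>x y :: complex. x * y)"
    unfolding bilinear_conv_bounded_bilinear by (rule bounded_bilinear_mult)
  have "(\<lambda>x. h x * ((1 + x) ^ n *\<^sub>R g x)) absolutely_integrable_on {0..}"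
    by (rule absolutely_integrable_bounded_measurable_product[OF 3 assms(2) _ assms(3)])
       (use assms in \<open>auto simp: weighted_L1_def\<close>)
  then show ?thesis unfolding weighted_L1_def by (simp add: mult_scaleR_right)
qed

lemma weighted_L1_imp_L1:
  assumes "weighted_L1 n g" shows "g absolutely_integrable_on {0..}"
proof -
  define h where "h = (\<lambda>x::real. inverse ((1 + x) ^ n))"
  have 3: "bilinear (\<lambda>(x::real) (y :: complex). x *\<^sub>R y)"
    unfolding bilinear_conv_bounded_bilinear by (rule bounded_bilinear_scaleR)
  have hc: "continuous_on {0..} h"
    unfolding h_def by (intro continuous_intros) (auto simp: add_nonneg_eq_0_iff)
  have "\<bar>h x\<bar> \<le> 1" if "x \<ge> 0" for x
    using that one_le_power[of "1 + x" n] by (simp add: h_def inverse_le_1_iff)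
  then have hb: "bounded (h ` {0..})" by (auto simp: bounded_iff)
  have "(\<lambda>x. h x *\<^sub>R ((1 + x) ^ n *\<^sub>R g x)) absolutely_integrable_on {0..}"
    by (rule absolutely_integrable_bounded_measurable_product[OF 3 _ _ hb])
       (use assms hc in \<open>auto simp: weighted_L1_def intro: continuous_imp_measurable_on_sets_lebesgue\<close>)
  moreover have "h x *\<^sub>R ((1 + x) ^ n *\<^sub>R g x) = g x" if "x \<in> {0..}" for x
    using that by (simp add: h_def)
  ultimately show ?thesis by (metis (no_types, lifting) set_integrable_cong)
qed

lemma weighted_L1_norm: "weighted_L1 n g \<Longrightarrow> (\<lambda>x. (1 + x) ^ n * norm (g x)) absolutely_integrable_on {0..}"
proof -
  assume "weighted_L1 n g"
  from absolutely_integrable_norm[OF this[unfolded weighted_L1_def]]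
  have "(\<lambda>x. norm ((1 + x) ^ n *\<^sub>R g x)) absolutely_integrable_on {0..}" by (simp add: comp_def)
  moreover have "norm ((1 + x) ^ n *\<^sub>R g x) = (1 + x) ^ n * norm (g x)" if "x \<in> {0..}" for x
    using that by simp
  ultimately show ?thesis by (metis (no_types, lifting) set_integrable_cong)
qed

lemma weighted_L1_add: "weighted_L1 n f \<Longrightarrow> weighted_L1 n g \<Longrightarrow> weighted_L1 n (\<lambda>x. f x + g x)"
  unfolding weighted_L1_def scaleR_add_right by (rule set_integral_add(1))

lemma weighted_L1_cmult: "weighted_L1 n f \<Longrightarrow> weighted_L1 n (\<lambda>x. c * f x)"
  by (rule weighted_L1_bounded_mult) (auto simp: bounded_iff)

lemma sobolev_weighted_L1: "sobolev n r g \<Longrightarrow> weighted_L1 n g"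
  by (cases r) auto

lemma sobolev_SucD: "sobolev n (Suc r) g \<Longrightarrow> sobolev n r g"
proof (induction r arbitrary: g)
  case (Suc r)
  then obtain g' where "weighted_L1 n g" "prim g g'" "sobolev n (Suc r) g'" by auto
  then show ?case using Suc.IH by auto
qed simp

lemma sobolev_mono: "sobolev n r g \<Longrightarrow> s \<le> r \<Longrightarrow> sobolev n s g"
  by (induction r) (auto simp: le_Suc_eq simp del: sobolev.simps dest: sobolev_SucD)

lemma sobolev_add: "sobolev n r f \<Longrightarrow> sobolev n r g \<Longrightarrow> sobolev n r (\<lambda>x. f x + g x)"
proof (induction r arbitrary: f g)
  case (Suc r)
  then obtain f' g' where "weighted_L1 n f" "prim f f'" "sobolev n r f'"
    "weighted_L1 n g" "prim g g'" "sobolev n r g'" by auto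
  then show ?case using prim_add[of f f' g g'] Suc.IH[of f' g'] by (auto intro: weighted_L1_add)
qed (simp add: weighted_L1_add)

lemma sobolev_cmult: "sobolev n r f \<Longrightarrow> sobolev n r (\<lambda>x. c * f x)"
proof (induction r arbitrary: f)
  case (Suc r)
  then obtain f' where "weighted_L1 n f" "prim f f'" "sobolev n r f'" by auto
  then show ?case using prim_cmult[of f f' c] Suc.IH[of f'] by (auto intro: weighted_L1_cmult)
qed (simp add: weighted_L1_cmult)

lemma sobolev_zero: "sobolev n r (\<lambda>x. 0)"
proof (induction r)
  case (Suc r)
  then show ?case using prim_const[of "0::complex"] by (auto simp: weighted_L1_def)
qed (simp add: weighted_L1_def)

lemma prim_L1_tendsto:
  fixes f :: "real \<Rightarrow> 'a::euclidean_space"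
  assumes f: "prim f f'" and f': "f' absolutely_integrable_on {0..}"
  shows "(f \<longlongrightarrow> f 0 + integral {0..} f') at_top"
proof -
  have "((\<lambda>x. f 0 + integral {0..x} f') \<longlongrightarrow> f 0 + integral {0..} f') at_top"
    by (intro tendsto_intros tendsto_integral_at_top f')
  moreover have "\<forall>\<^sub>F x in at_top. f 0 + integral {0..x} f' = f x"
    using eventually_ge_at_top[of 0] by eventually_elim (rule prim_eq[OF f, symmetric])
  ultimately show ?thesis by (rule Lim_transform_eventually)
qed

lemma prim_L1_bounded:
  fixes f :: "real \<Rightarrow> 'a::euclidean_space"
  assumes f: "prim f f'" and f': "f' absolutely_integrable_on {0..}"
  shows "bounded (f ` {0..})"
proof -
  have "norm (f x) \<le> norm (f 0) + integral {0..} (\<lambda>t. norm (f' t))" if "x \<ge> 0" for x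
  proof -
    have n: "(\<lambda>t. norm (f' t)) integrable_on {0..}"
      using f' unfolding absolutely_integrable_on_def by (rule conjunct2)
    have n': "(\<lambda>t. norm (f' t)) integrable_on {0..x}" "f' integrable_on {0..x}"
      using prim_integrable[OF f order_refl, of x] unfolding absolutely_integrable_on_def by auto
    have "norm (integral {0..x} f') \<le> integral {0..x} (\<lambda>t. norm (f' t))"
      by (rule integral_norm_bound_integral) (use n' in auto)
    also have "\<dots> \<le> integral {0..} (\<lambda>t. norm (f' t))"
      by (rule integral_subset_le) (use n n' in auto)
    finally show ?thesis
      by (subst prim_eq[OF f that]) (use norm_triangle_ineq[of "f 0" "integral {0..x} f'"] in linarith)
  qed
  then show ?thesis by (auto simp: bounded_iff)
qed

text \<open>The integrals over \<open>{x..x + 1}\<close> tend both to \<open>L\<close> and to \<open>0\<close>.\<close>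

lemma L1_limit_zero:
  fixes f :: "real \<Rightarrow> complex"
  assumes f: "f absolutely_integrable_on {0..}" and lim: "(f \<longlongrightarrow> L) at_top"
  shows "L = 0"
proof -
  have shift: "filterlim (\<lambda>x::real. x + 1) at_top at_top"
    using filterlim_tendsto_add_at_top[OF tendsto_const[of "1::real"] filterlim_ident[of at_top]]
    by (simp add: add.commute)
  have "norm L \<le> 0 + e" if "e > 0" for e
  proof -
    have "((\<lambda>x. integral {x..} f - integral {x + 1..} f) \<longlongrightarrow> 0 - 0) at_top"
      by (intro tendsto_diff tail_integral_tendsto_0[OF f]
           filterlim_compose[OF tail_integral_tendsto_0[OF f] shift])
    then have "\<forall>\<^sub>F x in at_top. norm (integral {x..} f - integral {x + 1..} f) < e / 2"
      using tendstoD[of _ 0 at_top "e/2"] that by (fastforce simp: dist_norm)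
    moreover have "\<forall>\<^sub>F x in at_top. \<forall>t\<ge>x. norm (f t - L) < e / 2"
    proof -
      have "\<forall>\<^sub>F x in at_top. norm (f x - L) < e / 2"
        using tendstoD[OF lim, of "e/2"] that by (simp add: dist_norm)
      then show ?thesis unfolding eventually_at_top_linorder by (meson order_trans)
    qed
    ultimately have "\<forall>\<^sub>F x in at_top. norm (integral {x..} f - integral {x + 1..} f) < e / 2
        \<and> (\<forall>t\<ge>x. norm (f t - L) < e / 2) \<and> x \<ge> 0"
      using eventually_ge_at_top[of 0] by eventually_elim blast
    then obtain x where x: "norm (integral {x..} f - integral {x + 1..} f) < e / 2"
        "\<And>t. t \<ge> x \<Longrightarrow> norm (f t - L) < e / 2" "x \<ge> 0"
      unfolding eventually_at_top_linorder by blast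
    have fx: "f absolutely_integrable_on {x..}" "f absolutely_integrable_on {x..x+1}"
      using x by (auto intro!: set_integrable_subset[OF f])
    have "integral {x..} f = integral {x..x+1} f + integral {x+1..} f"
      by (rule integral_split_tail[OF fx(1)]) simp
    then have 1: "norm (integral {x..x+1} f) < e / 2" using x(1) by simp
    have fi: "f integrable_on {x..x+1}" by (rule absolutely_integrable_on_imp_integrable_on[OF fx(2)])
    have "norm (integral {x..x+1} (\<lambda>t. f t - L)) \<le> integral {x..x+1} (\<lambda>t. e / 2)"
      by (rule integral_norm_bound_integral) (use x(2) in \<open>auto intro!: integrable_diff fi less_imp_le\<close>)
    also have "integral {x..x+1} (\<lambda>t. f t - L) = integral {x..x+1} f - L"
      using integral_diff[OF fi integrable_const_ivl, of L] by simp
    finally have "norm (integral {x..x+1} f - L) \<le> e / 2" by simp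
    then have "norm L \<le> e" using 1 norm_triangle_sub[of L "integral {x..x+1} f"]
      by (simp add: norm_minus_commute)
    then show ?thesis by simp
  qed
  then have "norm L \<le> 0" by (rule field_le_epsilon)
  then show ?thesis by simp
qed

lemma sobolev_Suc_tendsto_0: "sobolev n (Suc r) g \<Longrightarrow> (g \<longlongrightarrow> 0) at_top"
proof -
  assume "sobolev n (Suc r) g"
  then obtain g' where g: "weighted_L1 n g" "prim g g'" "weighted_L1 n g'"
    using sobolev_weighted_L1 by auto
  from prim_L1_tendsto[OF g(2) weighted_L1_imp_L1[OF g(3)]]
  have l: "(g \<longlongrightarrow> g 0 + integral {0..} g') at_top" .
  from L1_limit_zero[OF weighted_L1_imp_L1[OF g(1)] this] l show ?thesis by simp
qed

lemma multiplier_Suc: "multiplier n (Suc r) h \<Longrightarrow> continuous_on {0..} h \<and> bounded (h ` {0..})"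
proof -
  assume "multiplier n (Suc r) h"
  then obtain h' where h: "prim h h'" "weighted_L1 n h'" using sobolev_weighted_L1 by auto
  show ?thesis using prim_continuous[OF h(1)] prim_L1_bounded[OF h(1) weighted_L1_imp_L1[OF h(2)]] by blast
qed

lemma multiplier_SucD: "multiplier n (Suc r) h \<Longrightarrow> multiplier n r h"
proof (cases r)
  case 0
  assume "multiplier n (Suc r) h"
  then have "continuous_on {0..} h" "bounded (h ` {0..})" using multiplier_Suc by blast+
  then show ?thesis using 0 by (auto intro: continuous_imp_measurable_on_sets_lebesgue)
next
  case (Suc s)
  assume "multiplier n (Suc r) h"
  then obtain h' where "prim h h'" "sobolev n (Suc s) h'" using Suc by auto
  then show ?thesis using Suc sobolev_SucD[of n s h'] by auto
qed

lemma sobolev_imp_multiplier: "sobolev n (Suc r) g \<Longrightarrow> multiplier n (Suc r) g"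
  by auto

lemma multiplier_const: "multiplier n r (\<lambda>x. c)"
  by (cases r) (use prim_const[of c] sobolev_zero in \<open>auto simp: bounded_iff\<close>)

lemma sobolev_mult:
  "sobolev n r g \<Longrightarrow> multiplier n r h \<Longrightarrow> sobolev n r (\<lambda>x. h x * g x)"
proof (induction r arbitrary: g h)
  case 0
  then show ?case by (auto intro: weighted_L1_bounded_mult)
next
  case (Suc r)
  then obtain g' h' where g: "weighted_L1 n g" "prim g g'" "sobolev n r g'"
    and h: "prim h h'" "sobolev n r h'" by auto
  have m: "multiplier n r g" "multiplier n r h"
    using multiplier_SucD[OF sobolev_imp_multiplier[OF Suc.prems(1)]] multiplier_SucD[OF Suc.prems(2)] .
  have "sobolev n r (\<lambda>x. g x * h' x + h x * g' x)"
    by (intro sobolev_add Suc.IH m g h)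
  moreover have "prim (\<lambda>x. h x * g x) (\<lambda>x. g x * h' x + h x * g' x)"
    using prim_product[OF h(1) g(2)] by (simp add: mult.commute)
  moreover have "weighted_L1 n (\<lambda>x. h x * g x)"
    by (rule weighted_L1_bounded_mult[OF g(1)])
       (use multiplier_Suc[OF Suc.prems(2)] in \<open>auto intro: continuous_imp_measurable_on_sets_lebesgue\<close>)
  ultimately show ?case by auto
qed

lemma prim_tail:
  fixes h :: "real \<Rightarrow> 'a::euclidean_space"
  assumes "h absolutely_integrable_on {0..}"
  shows "prim (\<lambda>x. - integral {x..} h) h"
  unfolding prim_def
proof safe
  fix R show "h absolutely_integrable_on {0..R}" by (rule set_integrable_subset[OF assms]) auto
next
  fix x :: real assume "x \<ge> 0"
  then show "- integral {x..} h = - integral {0..} h + integral {0..x} h"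
    using integral_split_tail[OF assms, of x] by simp
qed

text \<open>Integration from infinity gains a derivative but loses decay, which is why it leads from \<open>sobolev\<close> to \<open>multiplier\<close>.\<close>

lemma multiplier_tail: "sobolev n r h \<Longrightarrow> multiplier n (Suc r) (\<lambda>x. - integral {x..} h)"
  using prim_tail[OF weighted_L1_imp_L1[OF sobolev_weighted_L1]] by auto

lemma wderiv_weak_deriv:
  assumes "weakly_differentiable r f" "i \<le> r"
  shows "is_weak_deriv i f (wderiv i f)"
proof (cases "i = 0")
  case True
  obtain g where "is_weak_deriv 0 f g" using assms unfolding weakly_differentiable_def by blast
  then show ?thesis using True by (simp add: is_weak_deriv_def wderiv_def)
next
  case False
  then show ?thesis using assms someI_ex[of "is_weak_deriv i f"]
    by (simp add: weakly_differentiable_def wderiv_def)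
qed

text \<open>All weak derivatives are defined relative to \<open>f\<close> itself. Testing the one of order \<open>i\<close> with \<open>deriv \<phi>\<close> and the one of order
\<open>Suc i\<close> with \<open>\<phi>\<close> gives the same integral over \<open>f\<close>.\<close>

lemma wderiv_step:
  assumes "weakly_differentiable r f" "i < r"
  shows "is_weak_deriv 1 (wderiv i f) (wderiv (Suc i) f)"
proof -
  have 1: "is_weak_deriv i f (wderiv i f)" and 2: "is_weak_deriv (Suc i) f (wderiv (Suc i) f)"
    by (rule wderiv_weak_deriv[OF assms(1)], use assms in simp)+
  have "(LINT x:{0<..}|lebesgue. wderiv i f x * (deriv ^^ 1) \<phi> x)
          = (-1) ^ 1 * (LINT x:{0<..}|lebesgue. wderiv (Suc i) f x * \<phi> x)" if t: "test_function \<phi>" for \<phi>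
  proof -
    have "(LINT x:{0<..}|lebesgue. f x * (deriv ^^ i) (deriv \<phi>) x)
        = (-1) ^ i * (LINT x:{0<..}|lebesgue. wderiv i f x * deriv \<phi> x)"
      using 1 test_function_deriv[OF t] unfolding is_weak_deriv_def by blast
    moreover have "(LINT x:{0<..}|lebesgue. f x * (deriv ^^ Suc i) \<phi> x)
        = (-1) ^ Suc i * (LINT x:{0<..}|lebesgue. wderiv (Suc i) f x * \<phi> x)"
      using 2 t unfolding is_weak_deriv_def by blast
    ultimately have "(-1) ^ i * (LINT x:{0<..}|lebesgue. wderiv i f x * deriv \<phi> x)
      = (-1) ^ i * - (LINT x:{0<..}|lebesgue. wderiv (Suc i) f x * \<phi> x)"
      unfolding funpow_Suc_right comp_apply by simp
    then show ?thesis by (subst (asm) mult_left_cancel) simp_all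
  qed
  moreover have "wderiv i f absolutely_integrable_on {c..d} \<and> wderiv (Suc i) f absolutely_integrable_on {c..d}"
    if "0 < c" for c d
    using 1 2 that unfolding is_weak_deriv_def by blast
  ultimately show ?thesis unfolding is_weak_deriv_def by blast
qed

lemma AE_lebesgue_negligible: "(AE x in lebesgue. P x) \<Longrightarrow> negligible {x. \<not> P x}"
proof -
  assume "AE x in lebesgue. P x"
  then obtain N where N: "N \<in> null_sets lebesgue" "{x \<in> space lebesgue. \<not> P x} \<subseteq> N"
    unfolding eventually_ae_filter by blast
  have "negligible N" unfolding negligible_iff_null_sets by (rule N(1))
  then show "negligible {x. \<not> P x}" by (rule negligible_subset) (use N(2) in simp)
qed

lemma weighted_L1_AE_cong:
  assumes "weighted_L1 n g" "AE x in lebesgue. x > 0 \<longrightarrow> h x = g x"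
  shows "weighted_L1 n h"
  unfolding weighted_L1_def
proof (rule absolutely_integrable_spike[OF assms(1)[unfolded weighted_L1_def]])
  show "negligible (insert 0 {x. \<not> (x > 0 \<longrightarrow> h x = g x)})"
    using AE_lebesgue_negligible[OF assms(2)] by simp
  fix x :: real assume "x \<in> {0..} - insert 0 {x. \<not> (x > 0 \<longrightarrow> h x = g x)}"
  then have "h x = g x" by auto
  then show "(1 + x) ^ n *\<^sub>R h x = (1 + x) ^ n *\<^sub>R g x" by simp
qed

text \<open>Starting from the highest order, each weak derivative is replaced by the primitive of the representative found for the next
one.\<close>

lemma weak_derivatives_sobolev:
  assumes "\<And>i. i \<le> r \<Longrightarrow> (\<lambda>x. (1 + x) ^ n * g i x) absolutely_integrable_on {0..}"
    and "\<And>i. i < r \<Longrightarrow> is_weak_deriv 1 (g i) (g (Suc i))"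
  shows "\<exists>h. sobolev n r (\<lambda>x. of_real (h x)) \<and> (AE x in lebesgue. x > 0 \<longrightarrow> h x = g 0 x)"
  using assms
proof (induction r arbitrary: g)
  case 0
  from absolutely_integrable_linear[OF 0(1)[of 0] bounded_linear_of_real]
  have "weighted_L1 n (\<lambda>x. of_real (g 0 x))"
    unfolding weighted_L1_def by (simp add: comp_def scaleR_conv_of_real)
  then show ?case by (intro exI[of _ "g 0"]) auto
next
  case (Suc r)
  obtain h' where h': "sobolev n r (\<lambda>x. of_real (h' x))" "AE x in lebesgue. x > 0 \<longrightarrow> h' x = g 1 x"
    using Suc.IH[of "\<lambda>i. g (Suc i)"] Suc.prems by auto
  have w: "weighted_L1 n (\<lambda>x. of_real (g i x))" if "i \<le> Suc r" for i
  proof -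
    from absolutely_integrable_linear[OF Suc.prems(1)[OF that] bounded_linear_of_real]
    show ?thesis unfolding weighted_L1_def by (simp add: comp_def scaleR_conv_of_real)
  qed
  have L1: "(\<lambda>x. of_real (g i x) :: complex) absolutely_integrable_on {0..}" if "i \<le> Suc r" for i
    by (rule weighted_L1_imp_L1[OF w[OF that]])
  have "g 1 absolutely_integrable_on {0..}"
    using absolutely_integrable_linear[OF L1[of 1] bounded_linear_Re] by (simp add: comp_def)
  with Suc.prems(2)[of 0] obtain C where C: "AE x in lebesgue. x > 0 \<longrightarrow> g 0 x = C + integral {0..x} (g 1)"
    using weak_derivative_primitive[of "g 0" "g 1"] by auto
  define h where "h = (\<lambda>x. C + integral {0..x} h')"
  have "integral {0..x} h' = integral {0..x} (g 1)" for x
  proof (rule integral_spike)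
    show "negligible (insert 0 {x. \<not> (x > 0 \<longrightarrow> h' x = g 1 x)})"
      using AE_lebesgue_negligible[OF h'(2)] by simp
  qed auto
  then have ae: "AE x in lebesgue. x > 0 \<longrightarrow> h x = g 0 x"
    using C by (simp add: h_def eq_commute)
  have "h' absolutely_integrable_on {0..}"
    using absolutely_integrable_linear[OF weighted_L1_imp_L1[OF sobolev_weighted_L1[OF h'(1)]] bounded_linear_Re]
    by (simp add: comp_def)
  then have "h' absolutely_integrable_on {0..R}" for R
    by (rule set_integrable_subset) auto
  then have "prim h h'" unfolding prim_def h_def by simp
  from prim_linear[OF this bounded_linear_of_real]
  have p: "prim (\<lambda>x. of_real (h x) :: complex) (\<lambda>x. of_real (h' x))" .
  have "AE x in lebesgue. x > 0 \<longrightarrow> (of_real (h x) :: complex) = of_real (g 0 x)"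
    using ae by eventually_elim auto
  then have "weighted_L1 n (\<lambda>x. of_real (h x))" by (rule weighted_L1_AE_cong[OF w[OF le0]])
  then have "sobolev n (Suc r) (\<lambda>x. of_real (h x))" using p h'(1) by auto
  then show ?case using ae by blast
qed

section \<open>Volterra operators acting on jets in the spectral parameter\<close>

text \<open>The Volterra operator with kernel \<open>K 0\<close>, applied to jets: \<open>g i\<close> and \<open>K p\<close> stand for derivatives in the spectral
parameter of orders \<open>i\<close> and \<open>p\<close>, and Leibniz' rule tells how they combine.\<close>

definition jet_op ::
  "(nat \<Rightarrow> 'c::finite \<Rightarrow> 'c \<Rightarrow> real \<Rightarrow> real \<Rightarrow> complex \<Rightarrow> complex) \<Rightarrow>
   (nat \<Rightarrow> 'c \<Rightarrow> real \<Rightarrow> complex \<Rightarrow> complex) \<Rightarrow> (nat \<Rightarrow> 'c \<Rightarrow> real \<Rightarrow> complex \<Rightarrow> complex)" where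
  "jet_op K g i c x k = - integral {x..} (\<lambda>t. \<Sum>d\<in>UNIV. \<Sum>p\<le>i.
      of_nat (i choose p) * K p c d x t k * g (i - p) d t k)"

text \<open>The bound \<open>w t\<close> is uniform in \<open>x\<close>, in \<open>k\<close> and in the order of the derivative; it may depend on \<open>t\<close> only,
so that a Volterra operator is controlled by the tail integrals of \<open>w\<close>.\<close>

definition jet_kernel ::
  "nat \<Rightarrow> complex set \<Rightarrow> (real \<Rightarrow> real) \<Rightarrow>
   (nat \<Rightarrow> 'c::finite \<Rightarrow> 'c \<Rightarrow> real \<Rightarrow> real \<Rightarrow> complex \<Rightarrow> complex) \<Rightarrow> bool" where
  "jet_kernel n S w K \<longleftrightarrow>
     (\<forall>i\<le>n. \<forall>c d x t. \<forall>k\<in>S. 0 \<le> x \<and> x \<le> t \<longrightarrow> norm (K i c d x t k) \<le> w t) \<and>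
     (\<forall>i<n. \<forall>c d x t. \<forall>k\<in>S. 0 \<le> x \<and> x \<le> t \<longrightarrow>
        (K i c d x t has_field_derivative K (Suc i) c d x t k) (at k within S)) \<and>
     (\<forall>c d x t. 0 \<le> x \<and> x \<le> t \<longrightarrow> continuous_on S (K n c d x t)) \<and>
     (\<forall>i\<le>n. \<forall>c d x. \<forall>k\<in>S. 0 \<le> x \<longrightarrow> continuous_on {x..} (\<lambda>t. K i c d x t k)) \<and>
     (\<forall>i\<le>n. \<forall>c d t. \<forall>k\<in>S. 0 \<le> t \<longrightarrow> continuous_on {0..t} (\<lambda>x. K i c d x t k))"

text \<open>The first \<open>n\<close> derivatives in \<open>k\<close>, relative to \<open>S\<close>, of functions of \<open>x\<close> and \<open>k\<close>. Every order is bounded by the same \<open>\<beta>\<close>.\<close>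

definition jet_family ::
  "nat \<Rightarrow> complex set \<Rightarrow> (real \<Rightarrow> real) \<Rightarrow> (nat \<Rightarrow> 'c \<Rightarrow> real \<Rightarrow> complex \<Rightarrow> complex) \<Rightarrow> bool" where
  "jet_family n S \<beta> f \<longleftrightarrow>
     (\<forall>i\<le>n. \<forall>c x. \<forall>k\<in>S. 0 \<le> x \<longrightarrow> norm (f i c x k) \<le> \<beta> x) \<and>
     (\<forall>i<n. \<forall>c x. \<forall>k\<in>S. 0 \<le> x \<longrightarrow> (f i c x has_field_derivative f (Suc i) c x k) (at k within S)) \<and>
     (\<forall>c x. 0 \<le> x \<longrightarrow> continuous_on S (f n c x)) \<and>
     (\<forall>i\<le>n. \<forall>c. \<forall>k\<in>S. continuous_on {0..} (\<lambda>x. f i c x k))"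

text \<open>The step from order \<open>i\<close> to order \<open>Suc i\<close> in Leibniz' rule, as an identity between sums.\<close>

lemma leibniz_sum:
  fixes A B :: "nat \<Rightarrow> complex"
  shows "(\<Sum>p\<le>i. of_nat (i choose p) * (A (Suc p) * B (i - p) + A p * B (Suc i - p)))
       = (\<Sum>p\<le>Suc i. of_nat (Suc i choose p) * A p * B (Suc i - p))"
proof -
  have 1: "(\<Sum>p\<le>Suc i. of_nat (Suc i choose p) * A p * B (Suc i - p))
     = A 0 * B (Suc i) + (\<Sum>p\<le>i. of_nat (Suc i choose Suc p) * A (Suc p) * B (i - p))"
    unfolding sum.atMost_Suc_shift by simp
  have 2: "(\<Sum>p\<le>i. of_nat (i choose p) * A p * B (Suc i - p))
     = (\<Sum>p\<le>Suc i. of_nat (i choose p) * A p * B (Suc i - p))" by simp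
  have 3: "\<dots> = A 0 * B (Suc i) + (\<Sum>p\<le>i. of_nat (i choose Suc p) * A (Suc p) * B (i - p))"
    unfolding sum.atMost_Suc_shift by simp
  show ?thesis
    unfolding 1 using 2 3 by (simp add: sum.distrib algebra_simps del: sum.atMost_Suc)
qed

lemma jet_familyI:
  assumes "\<And>i c x k. i \<le> n \<Longrightarrow> 0 \<le> x \<Longrightarrow> k \<in> S \<Longrightarrow> norm (f i c x k) \<le> \<beta> x"
    "\<And>i c x k. i < n \<Longrightarrow> 0 \<le> x \<Longrightarrow> k \<in> S \<Longrightarrow> (f i c x has_field_derivative f (Suc i) c x k) (at k within S)"
    "\<And>c x. 0 \<le> x \<Longrightarrow> continuous_on S (f n c x)"
    "\<And>i c k. i \<le> n \<Longrightarrow> k \<in> S \<Longrightarrow> continuous_on {0..} (\<lambda>x. f i c x k)"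
  shows "jet_family n S \<beta> f"
  unfolding jet_family_def by (intro conjI allI ballI impI assms)

lemma jet_familyD:
  assumes "jet_family n S \<beta> f"
  shows "\<And>i c x k. i \<le> n \<Longrightarrow> 0 \<le> x \<Longrightarrow> k \<in> S \<Longrightarrow> norm (f i c x k) \<le> \<beta> x"
    "\<And>i c x k. i < n \<Longrightarrow> 0 \<le> x \<Longrightarrow> k \<in> S \<Longrightarrow> (f i c x has_field_derivative f (Suc i) c x k) (at k within S)"
    "\<And>c x. 0 \<le> x \<Longrightarrow> continuous_on S (f n c x)"
    "\<And>i c k. i \<le> n \<Longrightarrow> k \<in> S \<Longrightarrow> continuous_on {0..} (\<lambda>x. f i c x k)"
  using assms unfolding jet_family_def by simp_all

lemma jet_kernelI:
  assumes "\<And>i c d x t k. i \<le> n \<Longrightarrow> 0 \<le> x \<Longrightarrow> x \<le> t \<Longrightarrow> k \<in> S \<Longrightarrow> norm (K i c d x t k) \<le> w t"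
    "\<And>i c d x t k. i < n \<Longrightarrow> 0 \<le> x \<Longrightarrow> x \<le> t \<Longrightarrow> k \<in> S \<Longrightarrow>
        (K i c d x t has_field_derivative K (Suc i) c d x t k) (at k within S)"
    "\<And>c d x t. 0 \<le> x \<Longrightarrow> x \<le> t \<Longrightarrow> continuous_on S (K n c d x t)"
    "\<And>i c d x k. i \<le> n \<Longrightarrow> 0 \<le> x \<Longrightarrow> k \<in> S \<Longrightarrow> continuous_on {x..} (\<lambda>t. K i c d x t k)"
    "\<And>i c d t k. i \<le> n \<Longrightarrow> 0 \<le> t \<Longrightarrow> k \<in> S \<Longrightarrow> continuous_on {0..t} (\<lambda>x. K i c d x t k)"
  shows "jet_kernel n S w K"
  unfolding jet_kernel_def by (intro conjI allI ballI impI; (elim conjE)?) (rule assms; assumption)+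

lemma jet_kernelD:
  assumes "jet_kernel n S w K"
  shows "\<And>i c d x t k. i \<le> n \<Longrightarrow> 0 \<le> x \<Longrightarrow> x \<le> t \<Longrightarrow> k \<in> S \<Longrightarrow> norm (K i c d x t k) \<le> w t"
    "\<And>i c d x t k. i < n \<Longrightarrow> 0 \<le> x \<Longrightarrow> x \<le> t \<Longrightarrow> k \<in> S \<Longrightarrow>
        (K i c d x t has_field_derivative K (Suc i) c d x t k) (at k within S)"
    "\<And>c d x t. 0 \<le> x \<Longrightarrow> x \<le> t \<Longrightarrow> continuous_on S (K n c d x t)"
    "\<And>i c d x k. i \<le> n \<Longrightarrow> 0 \<le> x \<Longrightarrow> k \<in> S \<Longrightarrow> continuous_on {x..} (\<lambda>t. K i c d x t k)"
    "\<And>i c d t k. i \<le> n \<Longrightarrow> 0 \<le> t \<Longrightarrow> k \<in> S \<Longrightarrow> continuous_on {0..t} (\<lambda>x. K i c d x t k)"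
  using assms unfolding jet_kernel_def by simp_all

lemma differentiable_chain_continuous:
  assumes "\<And>i k. i < n \<Longrightarrow> k \<in> S \<Longrightarrow> (F i has_field_derivative F (Suc i) k) (at k within S)"
    and "continuous_on S (F n)" "i \<le> n" "T \<subseteq> S"
  shows "continuous_on T (F i)"
proof (cases "i = n")
  case True
  then show ?thesis using continuous_on_subset[OF assms(2,4)] by simp
next
  case False
  then have "i < n" using assms(3) by simp
  then have "continuous_on S (F i)"
    unfolding continuous_on_eq_continuous_within using DERIV_continuous[OF assms(1)] by blast
  then show ?thesis using assms(4) by (rule continuous_on_subset)
qed

lemma jet_family_subset:
  assumes "jet_family n S \<beta> f" "T \<subseteq> S" "m \<le> n"
    "\<And>i c x k. i \<le> m \<Longrightarrow> 0 \<le> x \<Longrightarrow> k \<in> T \<Longrightarrow> norm (f i c x k) \<le> \<gamma> x"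
  shows "jet_family m T \<gamma> f"
proof (rule jet_familyI[OF assms(4)])
  fix i c k and x :: real assume "i < m" "0 \<le> x" "k \<in> T"
  then show "(f i c x has_field_derivative f (Suc i) c x k) (at k within T)"
    using assms(2,3) by (intro has_field_derivative_subset[OF jet_familyD(2)[OF assms(1)] assms(2)]) auto
next
  fix c and x :: real assume "0 \<le> x"
  then show "continuous_on T (f m c x)"
    by (intro differentiable_chain_continuous[of n S "\<lambda>i. f i c x", OF jet_familyD(2,3)[OF assms(1)] assms(3,2)]) simp_all
next
  fix i c k assume "i \<le> m" "k \<in> T"
  then show "continuous_on {0..} (\<lambda>x. f i c x k)"
    using assms(2,3) by (intro jet_familyD(4)[OF assms(1)]) auto
qed

lemma jet_family_continuous:
  assumes "jet_family n S \<beta> f" "i \<le> n" "0 \<le> x"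
  shows "continuous_on S (f i c x)"
  by (rule differentiable_chain_continuous[of n S "\<lambda>i. f i c x",
        OF jet_familyD(2,3)[OF assms(1)] assms(2) order_refl]) (use assms in simp_all)

lemma jet_kernel_continuous:
  assumes "jet_kernel n S w K" "i \<le> n" "0 \<le> x" "x \<le> t"
  shows "continuous_on S (K i c d x t)"
  by (rule differentiable_chain_continuous[of n S "\<lambda>i. K i c d x t",
        OF jet_kernelD(2,3)[OF assms(1)] assms(2) order_refl]) (use assms in simp_all)

lemma jet_kernel_subset:
  assumes K: "jet_kernel n S w K" and T: "T \<subseteq> S" and m: "m \<le> n"
  shows "jet_kernel m T w K"
proof (rule jet_kernelI)
  show "norm (K i c d x t k) \<le> w t" if "i \<le> m" "0 \<le> x" "x \<le> t" "k \<in> T" for i c d x t k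
    by (rule jet_kernelD(1)[OF K]) (use that T m in auto)
  show "(K i c d x t has_field_derivative K (Suc i) c d x t k) (at k within T)"
    if "i < m" "0 \<le> x" "x \<le> t" "k \<in> T" for i c d x t k
    by (rule has_field_derivative_subset[OF jet_kernelD(2)[OF K] T]) (use that T m in auto)
  show "continuous_on T (K m c d x t)" if "0 \<le> x" "x \<le> t" for c d x t
    by (rule continuous_on_subset[OF jet_kernel_continuous[OF K m that] T])
  show "continuous_on {x..} (\<lambda>t. K i c d x t k)" if "i \<le> m" "0 \<le> x" "k \<in> T" for i c d x k
    by (rule jet_kernelD(4)[OF K]) (use that T m in auto)
  show "continuous_on {0..t} (\<lambda>x. K i c d x t k)" if "i \<le> m" "0 \<le> t" "k \<in> T" for i c d t k
    by (rule jet_kernelD(5)[OF K]) (use that T m in auto)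
qed

text \<open>Twice the number of components times the largest sum of a row of binomial coefficients up to \<open>n\<close>. With this rate the
exponential weight makes the Volterra operator on jets a contraction by \<open>1 / 2\<close>.\<close>

definition rate :: "'c::finite itself \<Rightarrow> nat \<Rightarrow> real" where
  "rate _ n = 2 * (real CARD('c) * 2 ^ n)"

lemma rate_pos: "rate TYPE('c::finite) n > 0"
  unfolding rate_def using zero_less_card_finite[where 'a='c] by simp

locale tail_weight =
  fixes w :: "real \<Rightarrow> real"
  assumes w_cont: "continuous_on {0..} w" and w_nonneg: "\<And>x. x \<ge> 0 \<Longrightarrow> w x \<ge> 0"
    and w_int: "w absolutely_integrable_on {0..}"
begin

definition \<mu> :: "real \<Rightarrow> real" where "\<mu> x = integral {x..} w"

lemma \<mu>_prim: "prim (\<lambda>x. - \<mu> x) w"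
  unfolding \<mu>_def by (rule prim_tail[OF w_int])

lemma w_tail: "x \<ge> 0 \<Longrightarrow> w integrable_on {x..}"
  by (rule absolutely_integrable_on_imp_integrable_on[OF set_integrable_subset[OF w_int]]) simp_all

lemma \<mu>_le: assumes "x \<ge> 0" shows "\<mu> x \<le> \<mu> 0"
proof -
  have "w integrable_on {0..x}"
    by (rule absolutely_integrable_on_imp_integrable_on[OF prim_integrable[OF \<mu>_prim order_refl]])
  then have "integral {0..x} w \<ge> 0"
    by (rule Henstock_Kurzweil_Integration.integral_nonneg) (use w_nonneg in simp)
  moreover have "\<mu> 0 - \<mu> x = integral {0..x} w" using prim_increment[OF \<mu>_prim order_refl assms] by simp
  ultimately show ?thesis by simp
qed

lemma \<mu>_cont: "continuous_on {0..} \<mu>"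
  using continuous_on_minus[OF prim_continuous[OF \<mu>_prim]] by simp

lemma \<mu>_deriv: assumes "x \<ge> 0" "x \<le> R" shows "(\<mu> has_real_derivative - w x) (at x within {0..R})"
proof -
  have "((\<lambda>u. integral {0..u} w) has_vector_derivative w x) (at x within {0..R})"
    by (rule integral_has_vector_derivative[OF continuous_on_subset[OF w_cont]]) (use assms in auto)
  then have "((\<lambda>u. \<mu> 0 - integral {0..u} w) has_vector_derivative 0 - w x) (at x within {0..R})"
    by (intro has_vector_derivative_diff has_vector_derivative_const)
  then have "(\<mu> has_vector_derivative 0 - w x) (at x within {0..R})"
  proof (rule has_vector_derivative_transform[rotated 2])
    fix u assume "u \<in> {0..R}"
    then show "\<mu> u = \<mu> 0 - integral {0..u} w" using prim_increment[OF \<mu>_prim, of 0 u] by auto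
  qed (use assms in auto)
  then show ?thesis by (simp add: has_real_derivative_iff_has_vector_derivative)
qed

text \<open>As \<open>\<mu>\<close> has derivative \<open>- w\<close>, the integrand is the derivative of \<open>- exp (l \<mu> t) / l\<close>. The factor \<open>1 / l\<close> is what makes the
operator contract, whatever the size of \<open>w\<close>.\<close>

lemma weight_integral:
  assumes l: "l > 0" and x: "x \<ge> 0"
  shows "(\<lambda>t. w t * exp (l * \<mu> t)) absolutely_integrable_on {x..}"
    and "integral {x..} (\<lambda>t. w t * exp (l * \<mu> t)) \<le> exp (l * \<mu> x) / l"
proof -
  have c: "continuous_on {0..} (\<lambda>t. w t * exp (l * \<mu> t))"
    by (intro continuous_intros w_cont \<mu>_cont)
  show ai: "(\<lambda>t. w t * exp (l * \<mu> t)) absolutely_integrable_on {x..}"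
  proof (rule continuous_dominated_absolutely_integrable[OF continuous_on_subset[OF c]])
    show "(\<lambda>t. exp (l * \<mu> 0) * w t) integrable_on {x..}"
      by (intro integrable_on_mult_right w_tail x)
    show "norm (w t * exp (l * \<mu> t)) \<le> exp (l * \<mu> 0) * w t" if "t \<in> {x..}" for t
    proof -
      have "exp (l * \<mu> t) \<le> exp (l * \<mu> 0)" using \<mu>_le[of t] l that x by simp
      then show ?thesis using w_nonneg[of t] that x
        by (simp add: abs_mult mult.commute mult_left_mono)
    qed
  qed (use x in auto)
  have "\<forall>\<^sub>F R in at_top. integral {x..R} (\<lambda>t. w t * exp (l * \<mu> t)) \<le> exp (l * \<mu> x) / l"
    using eventually_ge_at_top[of x]
  proof eventually_elim
    case (elim R)
    have "((\<lambda>t. w t * exp (l * \<mu> t)) has_integral (- exp (l * \<mu> R) / l - (- exp (l * \<mu> x) / l))) {x..R}"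
    proof (rule fundamental_theorem_of_calculus[OF elim])
      fix t assume t: "t \<in> {x..R}"
      have "((\<lambda>t. - exp (l * \<mu> t) / l) has_real_derivative w t * exp (l * \<mu> t)) (at t within {0..R})"
        using t x l by (auto intro!: derivative_eq_intros \<mu>_deriv)
      then show "((\<lambda>t. - exp (l * \<mu> t) / l) has_vector_derivative w t * exp (l * \<mu> t)) (at t within {x..R})"
        unfolding has_real_derivative_iff_has_vector_derivative
        by (rule has_vector_derivative_within_subset) (use x in auto)
    qed
    from integral_unique[OF this]
    have "integral {x..R} (\<lambda>t. w t * exp (l * \<mu> t)) = exp (l * \<mu> x) / l - exp (l * \<mu> R) / l"
      by simp
    also have "\<dots> \<le> exp (l * \<mu> x) / l" using l by simp
    finally show ?case .
  qed
  then show "integral {x..} (\<lambda>t. w t * exp (l * \<mu> t)) \<le> exp (l * \<mu> x) / l"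
    by (rule tendsto_upperbound[OF tendsto_integral_at_top[OF ai]]) simp
qed

text \<open>The sum over components and binomial coefficients contributes half the rate, and the weighted integral contributes the inverse
of the rate, so the bound is halved. The derivatives pass under the integral because \<open>w t exp (l \<mu> t)\<close> dominates
every order.\<close>

lemma jet_op_jet_family:
  fixes K :: "nat \<Rightarrow> 'c::finite \<Rightarrow> 'c \<Rightarrow> real \<Rightarrow> real \<Rightarrow> complex \<Rightarrow> complex" and n :: nat
  defines "l \<equiv> rate TYPE('c) n"
  assumes S: "convex S" and K: "jet_kernel n S w K"
    and g: "jet_family n S (\<lambda>x. B * exp (l * \<mu> x)) g" and B: "B \<ge> 0"
  shows "jet_family n S (\<lambda>x. B / 2 * exp (l * \<mu> x)) (jet_op K g)"
proof -
  define H where "H = (\<lambda>i c x k t. \<Sum>d\<in>UNIV. \<Sum>p\<le>i. of_nat (i choose p) * K p c d x t k * g (i - p) d t k)"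
  define A where "A = real CARD('c) * 2 ^ n * B"
  define W where "W = (\<lambda>t. A * (w t * exp (l * \<mu> t)))"
  have lpos: "l > 0" unfolding l_def by (rule rate_pos)
  have Apos: "A \<ge> 0" using B by (simp add: A_def)
  have Al: "A / l = B / 2" unfolding A_def l_def rate_def using zero_less_card_finite[where 'a='c] by simp
  have op: "jet_op K g i c x k = - integral {x..} (H i c x k)" for i c x k
    unfolding jet_op_def H_def ..
  have Wint: "W integrable_on {x..}" and Wle: "integral {x..} W \<le> B / 2 * exp (l * \<mu> x)" if "x \<ge> 0" for x
  proof -
    show "W integrable_on {x..}"
      unfolding W_def by (intro integrable_on_mult_right absolutely_integrable_on_imp_integrable_on weight_integral(1) lpos that)
    have "integral {x..} W = A * integral {x..} (\<lambda>t. w t * exp (l * \<mu> t))"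
      unfolding W_def by simp
    also have "\<dots> \<le> A * (exp (l * \<mu> x) / l)"
      by (intro mult_left_mono weight_integral(2) lpos that Apos)
    also have "\<dots> = A / l * exp (l * \<mu> x)" by simp
    finally show "integral {x..} W \<le> B / 2 * exp (l * \<mu> x)" unfolding Al .
  qed
  have Hbound: "norm (H i c x k t) \<le> W t" if "i \<le> n" "0 \<le> x" "x \<le> t" "k \<in> S" for i c x k t
  proof -
    have wt: "w t \<ge> 0" using w_nonneg that by simp
    have E0: "w t * (B * exp (l * \<mu> t)) \<ge> 0" using wt B by simp
    have "norm (H i c x k t) \<le> (\<Sum>d\<in>(UNIV::'c set). \<Sum>p\<le>i. of_nat (i choose p) * (w t * (B * exp (l * \<mu> t))))"
      unfolding H_def
    proof (intro sum_norm_le)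
      fix d p assume p: "p \<in> {..i}"
      have "norm (K p c d x t k) \<le> w t" by (rule jet_kernelD(1)[OF K]) (use p that in auto)
      moreover have "norm (g (i - p) d t k) \<le> B * exp (l * \<mu> t)"
        by (rule jet_familyD(1)[OF g]) (use p that in auto)
      ultimately have "norm (K p c d x t k) * norm (g (i - p) d t k) \<le> w t * (B * exp (l * \<mu> t))"
        by (intro mult_mono wt) auto
      then show "norm (of_nat (i choose p) * K p c d x t k * g (i - p) d t k)
          \<le> of_nat (i choose p) * (w t * (B * exp (l * \<mu> t)))"
        by (simp add: norm_mult mult.assoc mult_left_mono)
    qed
    also have "\<dots> = real CARD('c) * ((\<Sum>p\<le>i. of_nat (i choose p)) * (w t * (B * exp (l * \<mu> t))))"
      by (simp add: sum_distrib_right)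
    also have "(\<Sum>p\<le>i. of_nat (i choose p)) = (2::real) ^ i"
      using choose_row_sum[of i] by (metis of_nat_numeral of_nat_power of_nat_sum)
    also have "real CARD('c) * (2 ^ i * (w t * (B * exp (l * \<mu> t)))) \<le> real CARD('c) * (2 ^ n * (w t * (B * exp (l * \<mu> t))))"
      using that E0 by (intro mult_left_mono mult_right_mono power_increasing) auto
    also have "\<dots> = W t" by (simp add: W_def A_def)
    finally show ?thesis .
  qed
  have Hcont: "continuous_on {x..} (H i c x k)" if "i \<le> n" "0 \<le> x" "k \<in> S" for i c x k
    unfolding H_def
    by (intro continuous_on_sum continuous_on_mult continuous_on_const jet_kernelD(4)[OF K]
          continuous_on_subset[OF jet_familyD(4)[OF g]]) (use that in auto)
  have Hmeas: "H i c x k \<in> borel_measurable (lebesgue_on {x..})" if "i \<le> n" "0 \<le> x" "k \<in> S" for i c x k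
    by (rule continuous_imp_measurable_on_sets_lebesgue[OF Hcont[OF that]]) simp
  have Hx: "continuous_on {0..t} (\<lambda>x. H i c x k t)" if "i \<le> n" "0 \<le> t" "k \<in> S" for i c k t
    unfolding H_def
    by (intro continuous_on_sum continuous_on_mult continuous_on_const jet_kernelD(5)[OF K]) (use that in auto)
  have Hk: "continuous_on S (\<lambda>k. H i c x k t)" if "i \<le> n" "0 \<le> x" "x \<le> t" for i c x t
    unfolding H_def
    by (intro continuous_on_sum continuous_on_mult continuous_on_const jet_kernel_continuous[OF K]
        jet_family_continuous[OF g]) (use that in auto)
  have Hd: "((\<lambda>k. H i c x k t) has_field_derivative H (Suc i) c x k t) (at k within S)"
    if "i < n" "0 \<le> x" "x \<le> t" "k \<in> S" for i c x t k
  proof -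
    have "((\<lambda>k. \<Sum>d\<in>UNIV. \<Sum>p\<le>i. of_nat (i choose p) * (K p c d x t k * g (i - p) d t k)) has_field_derivative
        (\<Sum>d\<in>UNIV. \<Sum>p\<le>i. of_nat (i choose p) *
           (K (Suc p) c d x t k * g (i - p) d t k + g (Suc (i - p)) d t k * K p c d x t k))) (at k within S)"
      by (intro DERIV_sum DERIV_cmult DERIV_mult jet_kernelD(2)[OF K] jet_familyD(2)[OF g]) (use that in auto)
    moreover have "(\<Sum>p\<le>i. of_nat (i choose p) *
           (K (Suc p) c d x t k * g (i - p) d t k + g (Suc (i - p)) d t k * K p c d x t k))
       = (\<Sum>p\<le>Suc i. of_nat (Suc i choose p) * K p c d x t k * g (Suc i - p) d t k)" for d
    proof -
      have "(\<Sum>p\<le>i. of_nat (i choose p) *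
           (K (Suc p) c d x t k * g (i - p) d t k + g (Suc (i - p)) d t k * K p c d x t k))
       = (\<Sum>p\<le>i. of_nat (i choose p) *
           (K (Suc p) c d x t k * g (i - p) d t k + K p c d x t k * g (Suc i - p) d t k))"
        by (rule sum.cong) (auto simp: Suc_diff_le mult.commute)
      also have "\<dots> = (\<Sum>p\<le>Suc i. of_nat (Suc i choose p) * K p c d x t k * g (Suc i - p) d t k)"
        by (rule leibniz_sum[of i "\<lambda>p. K p c d x t k" "\<lambda>q. g q d t k"])
      finally show ?thesis .
    qed
    ultimately show ?thesis unfolding H_def by (simp add: mult.assoc del: sum.atMost_Suc)
  qed
  show ?thesis
  proof (rule jet_familyI)
    fix i c k and x :: real assume A: "i \<le> n" "0 \<le> x" "k \<in> S"
    have "norm (integral {x..} (H i c x k)) \<le> integral {x..} W"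
      by (rule integral_norm_bound_integral[OF measurable_bounded_by_integrable_imp_integrable[OF Hmeas[OF A] Wint[OF A(2)]] Wint[OF A(2)]])
         (use Hbound A in auto)
    then show "norm (jet_op K g i c x k) \<le> B / 2 * exp (l * \<mu> x)"
      unfolding op using Wle[OF A(2)] by simp
  next
    fix i c k and x :: real assume A: "i < n" "0 \<le> x" "k \<in> S"
    have "((\<lambda>k. integral {x..} (H i c x k)) has_field_derivative integral {x..} (H (Suc i) c x k)) (at k within S)"
      by (rule has_field_derivative_parametric_integral[OF S _ Wint[OF A(2)]])
         (use A Hmeas Hbound Hd in auto)
    then show "(jet_op K g i c x has_field_derivative jet_op K g (Suc i) c x k) (at k within S)"
      unfolding op[abs_def] by (rule DERIV_minus)
  next
    fix c and x :: real assume A: "0 \<le> x"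
    have "continuous_on S (\<lambda>k. integral {x..} (H n c x k))"
      by (rule continuous_on_parametric_integral[OF _ Wint[OF A]])
         (use A Hmeas Hbound Hk in auto)
    then show "continuous_on S (jet_op K g n c x)"
      unfolding op[abs_def] by (rule continuous_on_minus)
  next
    fix i c k assume A: "i \<le> n" "k \<in> S"
    have "continuous_on {0..} (\<lambda>x. integral {x..} (H i c x k))"
      by (rule continuous_on_tail_integral[OF _ Wint[OF order_refl]])
         (use A Hmeas Hbound Hx in auto)
    then show "continuous_on {0..} (\<lambda>x. jet_op K g i c x k)"
      unfolding op by (rule continuous_on_minus)
  qed
qed

lemma jet_op_iterate:
  fixes K :: "nat \<Rightarrow> 'c::finite \<Rightarrow> 'c \<Rightarrow> real \<Rightarrow> real \<Rightarrow> complex \<Rightarrow> complex"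
  assumes S: "convex S" and K: "jet_kernel n S w K"
    and f: "jet_family n S (\<lambda>x. B * exp (rate TYPE('c) n * \<mu> x)) f" and B: "B \<ge> 0"
  shows "jet_family n S (\<lambda>x. B / 2 ^ j * exp (rate TYPE('c) n * \<mu> x)) ((jet_op K ^^ j) f)"
proof (induction j)
  case (Suc j)
  from jet_op_jet_family[OF S K Suc] B show ?case by (simp add: mult.commute)
qed (use f in simp)

end

section \<open>Solutions of Volterra equations\<close>

text \<open>The Picard series, formed for all orders of derivatives simultaneously.\<close>

definition volterra_sol ::
  "(nat \<Rightarrow> 'c::finite \<Rightarrow> 'c \<Rightarrow> real \<Rightarrow> real \<Rightarrow> complex \<Rightarrow> complex) \<Rightarrow>
   (nat \<Rightarrow> 'c \<Rightarrow> real \<Rightarrow> complex \<Rightarrow> complex) \<Rightarrow> (nat \<Rightarrow> 'c \<Rightarrow> real \<Rightarrow> complex \<Rightarrow> complex)" where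
  "volterra_sol K f i c x k = (\<Sum>j. (jet_op K ^^ j) f i c x k)"

context tail_weight
begin

lemma \<mu>_nonneg: "x \<ge> 0 \<Longrightarrow> \<mu> x \<ge> 0"
  unfolding \<mu>_def by (rule Henstock_Kurzweil_Integration.integral_nonneg[OF w_tail]) (use w_nonneg in simp_all)

lemma jet_family_exp_bound:
  fixes f :: "nat \<Rightarrow> 'c::finite \<Rightarrow> real \<Rightarrow> complex \<Rightarrow> complex"
  assumes f: "jet_family n S (\<lambda>x. B) f" and B: "B \<ge> 0"
  shows "jet_family n S (\<lambda>x. B * exp (rate TYPE('c) n * \<mu> x)) f"
proof (rule jet_family_subset[OF f order_refl order_refl])
  fix i c k and x :: real assume A: "i \<le> n" "0 \<le> x" "k \<in> S"
  have "norm (f i c x k) \<le> B * 1" using jet_familyD(1)[OF f A] by simp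
  also have "\<dots> \<le> B * exp (rate TYPE('c) n * \<mu> x)"
    using rate_pos[where 'c='c and n=n] \<mu>_nonneg[OF A(2)] B by (intro mult_left_mono) auto
  finally show "norm (f i c x k) \<le> B * exp (rate TYPE('c) n * \<mu> x)" .
qed

text \<open>All orders are dominated by the same geometric series, so they converge uniformly in \<open>k\<close> and the series may be
differentiated term by term.\<close>

lemma volterra_sol_jet_family:
  fixes K :: "nat \<Rightarrow> 'c::finite \<Rightarrow> 'c \<Rightarrow> real \<Rightarrow> real \<Rightarrow> complex \<Rightarrow> complex"
  assumes S: "convex S" and K: "jet_kernel n S w K"
    and f: "jet_family n S (\<lambda>x. B) f" and B: "B \<ge> 0"
  shows "jet_family n S (\<lambda>x. 2 * B * exp (rate TYPE('c) n * \<mu> x)) (volterra_sol K f)"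
proof -
  define V where "V = (\<lambda>j. (jet_op K ^^ j) f)"
  define b where "b = (\<lambda>x. B * exp (rate TYPE('c) n * \<mu> x))"
  define M where "M = (\<lambda>x j. b x * (1/2::real) ^ j)"
  have M_eq: "M x j = B / 2 ^ j * exp (rate TYPE('c) n * \<mu> x)" for x j
    by (simp add: M_def b_def power_one_over)
  have V: "jet_family n S (\<lambda>x. M x j) (V j)" for j
    using jet_op_iterate[OF S K jet_family_exp_bound[OF f B] B, of j]
    unfolding V_def M_eq .
  have Msums: "M x sums (b x * 2)" for x
    unfolding M_def using sums_mult[OF geometric_sums[of "1/2::real"], of "b x"] by simp
  then have Msum: "summable (M x)" for x by (rule sums_summable)
  have sol: "volterra_sol K f i c x k = (\<Sum>j. V j i c x k)" for i c x k
    unfolding volterra_sol_def V_def ..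
  have Vle: "norm (V j i c x k) \<le> M x j" if "i \<le> n" "0 \<le> x" "k \<in> S" for i c x k j
    by (rule jet_familyD(1)[OF V that])
  have unif: "uniform_limit S (\<lambda>m k. \<Sum>j<m. V j i c x k) (\<lambda>k. \<Sum>j. V j i c x k) sequentially"
    if "i \<le> n" "0 \<le> x" for i c x
    by (rule Weierstrass_m_test[OF Vle Msum[of x]]) (use that in auto)
  show ?thesis
  proof (rule jet_familyI)
    fix i c k and x :: real assume A: "i \<le> n" "0 \<le> x" "k \<in> S"
    have "norm (\<Sum>j. V j i c x k) \<le> (\<Sum>j. M x j)"
      by (rule norm_suminf_le[OF Vle[OF A] Msum])
    also have "\<dots> = 2 * B * exp (rate TYPE('c) n * \<mu> x)"
      using sums_unique[OF Msums[of x]] by (simp add: b_def mult_ac)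
    finally show "norm (volterra_sol K f i c x k) \<le> 2 * B * exp (rate TYPE('c) n * \<mu> x)"
      unfolding sol .
  next
    fix i c k and x :: real assume A: "i < n" "0 \<le> x" "k \<in> S"
    have "summable (\<lambda>j. V j i c x k)"
      by (rule summable_comparison_test'[OF Msum[of x], of 0]) (use Vle A in auto)
    then have "\<exists>g. \<forall>z\<in>S. (\<lambda>j. V j i c x z) sums g z \<and>
        (g has_field_derivative (\<Sum>j. V j (Suc i) c x z)) (at z within S)"
      by (intro has_field_derivative_series[where ?x0.0=k and f'="\<lambda>j z. V j (Suc i) c x z"] S
            jet_familyD(2)[OF V] unif) (use A in auto)
    then obtain g where g: "\<And>k. k \<in> S \<Longrightarrow> (\<lambda>j. V j i c x k) sums g k"
      "\<And>k. k \<in> S \<Longrightarrow> (g has_field_derivative (\<Sum>j. V j (Suc i) c x k)) (at k within S)"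
      by blast
    show "(volterra_sol K f i c x has_field_derivative volterra_sol K f (Suc i) c x k) (at k within S)"
      unfolding sol
      by (rule has_field_derivative_transform_within[OF g(2)[OF A(3)] zero_less_one A(3)])
         (use g(1) sums_unique in \<open>auto simp: sol\<close>)
  next
    fix c and x :: real assume A: "0 \<le> x"
    have "continuous_on S (\<lambda>k. \<Sum>j. V j n c x k)"
      by (rule uniform_limit_theorem[OF _ unif[OF order_refl A]])
         (auto intro!: always_eventually continuous_on_sum jet_familyD(3)[OF V A])
    then show "continuous_on S (volterra_sol K f n c x)"
      by (rule continuous_on_eq) (simp add: sol)
  next
    fix i c k assume A: "i \<le> n" "k \<in> S"
    have "uniform_limit {0..} (\<lambda>m x. \<Sum>j<m. V j i c x k) (\<lambda>x. \<Sum>j. V j i c x k) sequentially"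
    proof (rule Weierstrass_m_test[OF _ Msum[of 0]])
      fix j and x :: real assume x: "x \<in> {0..}"
      have "norm (V j i c x k) \<le> M x j" using Vle A x by simp
      also have "\<dots> \<le> M 0 j"
        unfolding M_def b_def using \<mu>_le[of x] x B rate_pos[where 'c='c and n=n]
        by (intro mult_right_mono mult_left_mono) auto
      finally show "norm (V j i c x k) \<le> M 0 j" .
    qed
    then have "continuous_on {0..} (\<lambda>x. \<Sum>j. V j i c x k)"
      by (rule uniform_limit_theorem[rotated])
         (auto intro!: always_eventually continuous_on_sum jet_familyD(4)[OF V A])
    then show "continuous_on {0..} (\<lambda>x. volterra_sol K f i c x k)"
      by (simp add: sol)
  qed
qed

text \<open>Dominated convergence moves the operator past the Picard series. The equation is needed only at each single
\<open>k\<close> and for the function itself, that is, for the jet of order \<open>0\<close>.\<close>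

lemma volterra_sol_equation:
  fixes K :: "nat \<Rightarrow> 'c::finite \<Rightarrow> 'c \<Rightarrow> real \<Rightarrow> real \<Rightarrow> complex \<Rightarrow> complex"
  assumes K: "jet_kernel 0 {k} w K" and f: "jet_family 0 {k} (\<lambda>x. B) f" and B: "B \<ge> 0" and x: "0 \<le> x"
  shows "volterra_sol K f 0 c x k
     = f 0 c x k - integral {x..} (\<lambda>t. \<Sum>d\<in>UNIV. K 0 c d x t k * volterra_sol K f 0 d t k)"
proof -
  define l where "l = rate TYPE('c) 0"
  define V where "V = (\<lambda>j. (jet_op K ^^ j) f)"
  define b where "b = (\<lambda>x. B * exp (l * \<mu> x))"
  define M where "M = (\<lambda>x j. b x * (1/2::real) ^ j)"
  have lpos: "l > 0" unfolding l_def by (rule rate_pos)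
  have M_eq: "M x j = B / 2 ^ j * exp (l * \<mu> x)" for x j
    by (simp add: M_def b_def power_one_over)
  have V: "jet_family 0 {k} (\<lambda>x. M x j) (V j)" for j
    using jet_op_iterate[OF _ K jet_family_exp_bound[OF f B] B, of j]
    unfolding V_def M_eq l_def by simp
  have b0: "b x \<ge> 0" for x using B by (simp add: b_def)
  have Msums: "M x sums (b x * 2)" for x
    unfolding M_def using sums_mult[OF geometric_sums[of "1/2::real"], of "b x"] by simp
  have Msum: "summable (M x)" for x using Msums by (rule sums_summable)
  have sol: "volterra_sol K f i c x k = (\<Sum>j. V j i c x k)" for i c x k
    unfolding volterra_sol_def V_def ..
  have Vle: "norm (V j 0 c x k) \<le> M x j" if "0 \<le> x" for c x j
    by (rule jet_familyD(1)[OF V]) (use that in auto)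
  have Vsums: "(\<lambda>j. V j 0 c x k) sums volterra_sol K f 0 c x k" if "0 \<le> x" for c x
    unfolding sol by (rule summable_sums[OF summable_comparison_test'[OF Msum[of x], of 0]]) (use Vle that in auto)
  define h where "h = (\<lambda>j t. \<Sum>d\<in>UNIV. K 0 c d x t k * V j 0 d t k)"
  have VSuc: "V (Suc j) 0 c x k = - integral {x..} (h j)" for j
    unfolding V_def h_def by (simp add: jet_op_def)
  define W where "W = (\<lambda>t. real CARD('c) * (2 * B) * (w t * exp (l * \<mu> t)))"
  have Wint: "W integrable_on {x..}"
    unfolding W_def by (intro integrable_on_mult_right absolutely_integrable_on_imp_integrable_on weight_integral(1) lpos x)
  have hsum: "(\<Sum>j<m. h j t) = (\<Sum>d\<in>UNIV. K 0 c d x t k * (\<Sum>j<m. V j 0 d t k))" for m t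
    unfolding h_def sum_distrib_left by (rule sum.swap)
  have hcont: "continuous_on {x..} (\<lambda>t. \<Sum>j<m. h j t)" for m
    unfolding h_def
    by (intro continuous_on_sum continuous_on_mult jet_kernelD(4)[OF K] continuous_on_subset[OF jet_familyD(4)[OF V]])
       (use x in auto)
  have hbound: "norm (\<Sum>j<m. h j t) \<le> W t" if "t \<in> {x..}" for m t
  proof -
    have t: "0 \<le> t" "x \<le> t" using that x by auto
    have P: "norm (\<Sum>j<m. V j 0 d t k) \<le> 2 * b t" for d
    proof -
      have "norm (\<Sum>j<m. V j 0 d t k) \<le> (\<Sum>j<m. M t j)"
        by (rule sum_norm_le) (use Vle t in auto)
      also have "\<dots> \<le> (\<Sum>j. M t j)"
        by (rule sum_le_suminf[OF Msum]) (use b0 in \<open>auto simp: M_def\<close>)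
      also have "\<dots> = 2 * b t" using sums_unique[OF Msums[of t]] by simp
      finally show ?thesis .
    qed
    have "norm (\<Sum>j<m. h j t) \<le> (\<Sum>d\<in>(UNIV::'c set). w t * (2 * b t))"
      unfolding hsum
    proof (rule sum_norm_le)
      fix d
      have "norm (K 0 c d x t k) \<le> w t" by (rule jet_kernelD(1)[OF K]) (use x t in auto)
      then show "norm (K 0 c d x t k * (\<Sum>j<m. V j 0 d t k)) \<le> w t * (2 * b t)"
        unfolding norm_mult using P w_nonneg[OF t(1)] by (intro mult_mono) auto
    qed
    also have "\<dots> = W t" by (simp add: W_def b_def)
    finally show ?thesis .
  qed
  have "(\<lambda>m. integral {x..} (\<lambda>t. \<Sum>j<m. h j t)) \<longlonglongrightarrow>
        integral {x..} (\<lambda>t. \<Sum>d\<in>UNIV. K 0 c d x t k * volterra_sol K f 0 d t k)"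
  proof (rule dominated_convergence(2)[where h=W, OF _ Wint hbound])
    show "(\<lambda>t. \<Sum>j<m. h j t) integrable_on {x..}" for m
      by (rule absolutely_integrable_on_imp_integrable_on
            [OF continuous_dominated_absolutely_integrable[OF hcont Wint _ hbound]]) auto
    show "(\<lambda>m. \<Sum>j<m. h j t) \<longlonglongrightarrow> (\<Sum>d\<in>UNIV. K 0 c d x t k * volterra_sol K f 0 d t k)"
      if "t \<in> {x..}" for t
      unfolding hsum using Vsums[of t] that x
      by (intro tendsto_sum tendsto_mult tendsto_const) (auto simp: sums_def)
  qed
  moreover have "integral {x..} (\<lambda>t. \<Sum>j<m. h j t) = - (\<Sum>j<m. V (Suc j) 0 c x k)" for m
  proof -
    have "h j integrable_on {x..}" for j
    proof -
      have "h j = (\<lambda>t. (\<Sum>i<Suc j. h i t) - (\<Sum>i<j. h i t))" by auto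
      moreover have "(\<lambda>t. (\<Sum>i<Suc j. h i t) - (\<Sum>i<j. h i t)) integrable_on {x..}"
        by (intro integrable_diff absolutely_integrable_on_imp_integrable_on
             continuous_dominated_absolutely_integrable[OF hcont Wint _ hbound]) auto
      ultimately show ?thesis by metis
    qed
    then have "integral {x..} (\<lambda>t. \<Sum>j<m. h j t) = (\<Sum>j<m. integral {x..} (h j))"
      by (intro integral_sum) auto
    then show ?thesis unfolding VSuc by (simp add: sum_negf)
  qed
  ultimately have 1: "(\<lambda>m. - (\<Sum>j<m. V (Suc j) 0 c x k)) \<longlonglongrightarrow>
        integral {x..} (\<lambda>t. \<Sum>d\<in>UNIV. K 0 c d x t k * volterra_sol K f 0 d t k)" by simp
  have "(\<lambda>j. V (Suc j) 0 c x k) sums (volterra_sol K f 0 c x k - V 0 0 c x k)"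
    using Vsums[OF x, of c] by (subst sums_Suc_iff) simp
  then have 2: "(\<lambda>m. - (\<Sum>j<m. V (Suc j) 0 c x k)) \<longlonglongrightarrow> - (volterra_sol K f 0 c x k - V 0 0 c x k)"
    unfolding sums_def by (rule tendsto_minus)
  have "V 0 0 c x k = f 0 c x k" by (simp add: V_def)
  with LIMSEQ_unique[OF 1 2] show ?thesis by (simp add: algebra_simps)
qed

text \<open>A bounded solution of the homogeneous equation is a fixed point of the operator, and each application of the
contraction halves its bound.\<close>

lemma volterra_homogeneous_zero:
  fixes K :: "nat \<Rightarrow> 'c::finite \<Rightarrow> 'c \<Rightarrow> real \<Rightarrow> real \<Rightarrow> complex \<Rightarrow> complex"
  assumes K: "jet_kernel 0 {k} w K"
    and cont: "\<And>c. continuous_on {0..} (y c)" and bound: "\<And>c x. 0 \<le> x \<Longrightarrow> norm (y c x) \<le> M"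
    and eq: "\<And>c x. 0 \<le> x \<Longrightarrow> y c x = - integral {x..} (\<lambda>t. \<Sum>d\<in>UNIV. K 0 c d x t k * y d t)"
    and x: "0 \<le> x"
  shows "y c x = 0"
proof -
  define l where "l = rate TYPE('c) 0"
  define Y where "Y = (\<lambda>(i::nat) c x (k::complex). y c x)"
  have M: "M \<ge> 0" using bound[of 0] norm_ge_zero order_trans by blast
  have fam: "jet_family 0 {k} \<beta> Y" if "\<And>c x. 0 \<le> x \<Longrightarrow> norm (y c x) \<le> \<beta> x" for \<beta>
    by (rule jet_familyI) (use that cont in \<open>auto simp: Y_def\<close>)
  have op: "jet_op K Y 0 c x k = y c x" if "0 \<le> x" for c x
    using eq[OF that] by (simp add: jet_op_def Y_def)
  have dec: "norm (y c x) \<le> M / 2 ^ j * exp (l * \<mu> x)" if "0 \<le> x" for c x j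
    using that
  proof (induction j arbitrary: c x)
    case 0
    have "jet_family 0 {k} (\<lambda>x. M) Y" by (rule fam) (rule bound)
    from jet_familyD(1)[OF jet_family_exp_bound[OF this M], of 0 x k c] 0
    show ?case by (simp add: Y_def l_def)
  next
    case (Suc j)
    have 1: "jet_family 0 {k} (\<lambda>x. M / 2 ^ j * exp (rate TYPE('c) 0 * \<mu> x)) Y"
      by (rule fam) (use Suc.IH in \<open>simp add: l_def\<close>)
    have "norm (jet_op K Y 0 c x k) \<le> M / 2 ^ j / 2 * exp (rate TYPE('c) 0 * \<mu> x)"
      by (rule jet_familyD(1)[OF jet_op_jet_family[OF _ K 1]]) (use M Suc.prems in auto)
    then show ?case using op[OF Suc.prems] by (simp add: l_def mult.commute)
  qed
  have "(\<lambda>j. M * exp (l * \<mu> x) * (1/2) ^ j) \<longlonglongrightarrow> M * exp (l * \<mu> x) * 0"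
    by (intro tendsto_intros LIMSEQ_realpow_zero) auto
  moreover have "norm (y c x) \<le> M * exp (l * \<mu> x) * (1/2) ^ j" for j
    using dec[OF x, of c j] by (simp add: power_one_over)
  ultimately have "norm (y c x) \<le> M * exp (l * \<mu> x) * 0"
    by (intro tendsto_lowerbound) (auto intro: always_eventually)
  then show ?thesis by simp
qed

end

section \<open>Oscillating exponentials\<close>

text \<open>Conjugation by \<open>exp_pauli3 (\<i> theta1 k (t - x))\<close> multiplies the component \<open>c\<close> of the second column by
\<open>exp ((t - x) phase c k)\<close>; thus \<open>phase 1 k\<close> is \<open>2 \<i> theta1 k\<close>.\<close>

definition phase :: "2 \<Rightarrow> complex \<Rightarrow> complex" where
  "phase c k = (if c = 1 then \<i> * (k - 1 / k) / 2 else 0)"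

text \<open>The derivative of order \<open>i\<close> in \<open>k\<close> of the exponential, with the factor \<open>1 / k ^ p\<close> included. Both for \<open>p = 0\<close> and for \<open>p = 1\<close> this occurs
in the kernel; higher powers occur in the expansion at infinity.\<close>

definition osc :: "nat \<Rightarrow> 2 \<Rightarrow> nat \<Rightarrow> real \<Rightarrow> complex \<Rightarrow> complex" where
  "osc i c p t = (deriv ^^ i) (\<lambda>k. exp (of_real t * phase c k) / k ^ p)"

lemma osc_0: "osc 0 c p t k = exp (of_real t * phase c k) / k ^ p"
  by (simp add: osc_def)

text \<open>The shape of the derivatives of order \<open>i\<close>: a polynomial in \<open>t\<close> of degree at most \<open>i\<close> whose coefficients are polynomials in
\<open>1 / k\<close>, hence bounded away from \<open>k = 0\<close>.\<close>

definition osc_form :: "2 \<Rightarrow> nat \<Rightarrow> nat \<Rightarrow> (nat \<Rightarrow> complex poly) \<Rightarrow> real \<Rightarrow> complex \<Rightarrow> complex" where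
  "osc_form c p i P t k = exp (of_real t * phase c k) * inverse k ^ p *
     (\<Sum>a\<le>i. of_real t ^ a * poly (P a) (inverse k))"

text \<open>The derivative of the phase, as a polynomial in \<open>1 / k\<close>.\<close>

definition phase_poly :: "2 \<Rightarrow> complex poly" where
  "phase_poly c = (if c = 1 then [:\<i> / 2, 0, \<i> / 2:] else 0)"

lemma phase_deriv: "k \<noteq> 0 \<Longrightarrow> (phase c has_field_derivative poly (phase_poly c) (inverse k)) (at k)"
proof (cases "c = 1")
  case True
  assume k: "k \<noteq> 0"
  have "((\<lambda>k. \<i> * (k - 1 / k) / 2) has_field_derivative \<i> / 2 + \<i> * (inverse k * inverse k) / 2) (at k)"
    using k by (auto intro!: derivative_eq_intros simp: field_simps power2_eq_square)
  then show ?thesis using True by (simp add: phase_def[abs_def] phase_poly_def algebra_simps)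
next
  case False
  then show ?thesis by (simp add: phase_def[abs_def] phase_poly_def)
qed

lemma osc_form_deriv:
  fixes c :: 2 and i p :: nat
  assumes k: "k \<noteq> 0"
  defines "P' \<equiv> \<lambda>P a. (if a = 0 then 0 else phase_poly c * P (a - 1)) +
      (if a \<le> i then [:0, - of_nat p:] * P a - [:0, 0, 1:] * pderiv (P a) else 0)"
  shows "(osc_form c p i P t has_field_derivative osc_form c p (Suc i) (P' P) t k) (at k)"
proof -
  let ?z = "inverse k" and ?t = "of_real t :: complex"
  let ?E = "exp (?t * phase c k)" and ?D = "poly (phase_poly c) (inverse k)"
  let ?Q = "\<lambda>k. \<Sum>a\<le>i. ?t ^ a * poly (P a) (inverse k)"
  let ?Q' = "\<Sum>a\<le>i. ?t ^ a * (poly (pderiv (P a)) ?z * (- (?z * ?z)))"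
  have inv: "(inverse has_field_derivative - (?z * ?z)) (at k)"
    using DERIV_inverse[OF k] by (simp add: power2_eq_square)
  have E: "((\<lambda>k. exp (?t * phase c k)) has_field_derivative ?E * (?t * ?D)) (at k)"
    by (rule DERIV_fun_exp[OF DERIV_cmult[OF phase_deriv[OF k]]])
  have Ip: "((\<lambda>k. inverse k ^ p) has_field_derivative - (of_nat p * ?z) * ?z ^ p) (at k)"
  proof (cases p)
    case (Suc r)
    show ?thesis using DERIV_power_Suc[OF inv, of r] Suc by (simp add: mult_ac)
  qed simp
  have Q: "(?Q has_field_derivative ?Q') (at k)"
    by (intro DERIV_sum DERIV_cmult DERIV_chain2[OF poly_DERIV inv])
  have "(osc_form c p i P t has_field_derivative
     (?E * (?t * ?D) * ?z ^ p + (- (of_nat p * ?z) * ?z ^ p) * ?E) * ?Q k + ?Q' * (?E * ?z ^ p)) (at k)"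
    unfolding osc_form_def[abs_def] by (intro DERIV_mult E Ip Q)
  moreover have "(?E * (?t * ?D) * ?z ^ p + (- (of_nat p * ?z) * ?z ^ p) * ?E) * ?Q k + ?Q' * (?E * ?z ^ p)
      = ?E * ?z ^ p * (?t * ?D * ?Q k + (- (of_nat p * ?z)) * ?Q k + ?Q')"
    by (simp add: algebra_simps)
  moreover have "?t * ?D * ?Q k + (- (of_nat p * ?z)) * ?Q k + ?Q'
     = (\<Sum>a\<le>Suc i. ?t ^ a * poly (P' P a) ?z)"
  proof -
    define X where "X = (\<lambda>a. if a = 0 then 0 else ?t ^ a * (?D * poly (P (a - 1)) ?z))"
    define Y where "Y = (\<lambda>a. if a \<le> i then ?t ^ a * (- (of_nat p * ?z) * poly (P a) ?z - ?z * ?z * poly (pderiv (P a)) ?z) else 0)"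
    have "(\<Sum>a\<le>Suc i. ?t ^ a * poly (P' P a) ?z) = (\<Sum>a\<le>Suc i. X a + Y a)"
      by (rule sum.cong) (auto simp: P'_def X_def Y_def algebra_simps)
    also have "\<dots> = (\<Sum>a\<le>Suc i. X a) + (\<Sum>a\<le>i. Y a)"
      unfolding sum.distrib by (simp add: Y_def)
    also have "(\<Sum>a\<le>Suc i. X a) = (\<Sum>a\<le>i. ?t ^ Suc a * (?D * poly (P a) ?z))"
      unfolding sum.atMost_Suc_shift by (simp add: X_def)
    also have "\<dots> = ?t * ?D * ?Q k"
      by (simp add: sum_distrib_left mult_ac)
    also have "(\<Sum>a\<le>i. Y a) = (- (of_nat p * ?z)) * ?Q k + ?Q'"
      unfolding sum_distrib_left sum.distrib[symmetric]
      by (rule sum.cong) (auto simp: Y_def algebra_simps)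
    finally show ?thesis by (simp add: add.assoc)
  qed
  ultimately show ?thesis unfolding osc_form_def by simp
qed

lemma osc_eq_form: "\<exists>P. \<forall>t k. k \<noteq> 0 \<longrightarrow> osc i c p t k = osc_form c p i P t k"
proof (induction i)
  case 0
  show ?case by (intro exI[of _ "\<lambda>_. 1"]) (simp add: osc_def osc_form_def power_inverse divide_inverse)
next
  case (Suc i)
  then obtain P where P: "\<And>t k. k \<noteq> 0 \<Longrightarrow> osc i c p t k = osc_form c p i P t k" by blast
  from osc_form_deriv obtain P' where
    P': "\<And>t k. k \<noteq> 0 \<Longrightarrow> (osc_form c p i P t has_field_derivative osc_form c p (Suc i) P' t k) (at k)"
    by blast
  have "osc (Suc i) c p t k = osc_form c p (Suc i) P' t k" if k: "k \<noteq> 0" for t k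
  proof -
    have "(osc i c p t has_field_derivative osc_form c p (Suc i) P' t k) (at k)"
      by (rule has_field_derivative_transform_within_open[OF P'[OF k], of "- {0}"])
         (use k P in auto)
    then show ?thesis using DERIV_imp_deriv by (fastforce simp: osc_def)
  qed
  then show ?case by blast
qed

lemma osc_deriv:
  assumes k: "k \<noteq> 0"
  shows "(osc i c p t has_field_derivative osc (Suc i) c p t k) (at k)"
proof -
  obtain P where P: "\<And>t k. k \<noteq> 0 \<Longrightarrow> osc i c p t k = osc_form c p i P t k"
    using osc_eq_form by blast
  obtain D where "(osc_form c p i P t has_field_derivative D) (at k)"
    using osc_form_deriv[OF k] by blast
  then have "(osc i c p t has_field_derivative D) (at k)"
    by (rule has_field_derivative_transform_within_open[of _ _ _ "- {0}"]) (use P k in auto)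
  then have "(osc i c p t has_field_derivative deriv (osc i c p t) k) (at k)"
    using DERIV_imp_deriv by blast
  then show ?thesis by (simp add: osc_def)
qed

lemma osc_continuous_t:
  assumes "k \<noteq> 0" shows "continuous_on A (\<lambda>t. osc i c p t k)"
proof -
  obtain P where "\<And>t k. k \<noteq> 0 \<Longrightarrow> osc i c p t k = osc_form c p i P t k"
    using osc_eq_form by blast
  then show ?thesis using assms unfolding osc_form_def by (auto intro!: continuous_intros)
qed

text \<open>Both \<open>k\<close> and \<open>- 1 / k\<close> lie in the closed upper half-plane.\<close>

lemma phase_Re: "Im k \<ge> 0 \<Longrightarrow> Re (phase c k) \<le> 0"
proof -
  assume "Im k \<ge> 0"
  then have "Im k / ((Re k)\<^sup>2 + (Im k)\<^sup>2) \<ge> 0" by simp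
  then have "- Im k \<le> Im k / ((Re k)\<^sup>2 + (Im k)\<^sup>2)" using \<open>Im k \<ge> 0\<close> by linarith
  then show ?thesis by (simp add: phase_def Im_divide)
qed

text \<open>Each derivative costs one factor \<open>1 + t\<close>, and no factor of \<open>k\<close>: this is where the number of derivatives in \<open>k\<close> is tied to the
exponent of the weight.\<close>

lemma osc_bound:
  assumes \<delta>: "\<delta> > 0"
  shows "\<exists>C. \<forall>t k. 0 \<le> t \<longrightarrow> 0 \<le> Im k \<longrightarrow> \<delta> \<le> norm k \<longrightarrow>
            norm (osc i c p t k) \<le> C * (1 + t) ^ i / norm k ^ p"
proof -
  obtain P where P: "\<And>t k. k \<noteq> 0 \<Longrightarrow> osc i c p t k = osc_form c p i P t k"
    using osc_eq_form by blast
  have "\<exists>M. \<forall>z\<in>cball 0 (1 / \<delta>). norm (poly (P a) z) \<le> M" for a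
  proof -
    have "bounded (poly (P a) ` cball 0 (1 / \<delta>))"
      by (intro compact_imp_bounded compact_continuous_image continuous_intros) auto
    then show ?thesis by (auto simp: bounded_iff)
  qed
  then obtain M where M: "\<And>a z. z \<in> cball 0 (1 / \<delta>) \<Longrightarrow> norm (poly (P a) z) \<le> M a" by metis
  show ?thesis
  proof (intro exI[of _ "\<Sum>a\<le>i. M a"] allI impI)
    fix t :: real and k :: complex assume A: "0 \<le> t" "0 \<le> Im k" "\<delta> \<le> norm k"
    have k: "k \<noteq> 0" using A \<delta> by auto
    have z: "inverse k \<in> cball 0 (1 / \<delta>)"
      using A \<delta> by (simp add: norm_divide inverse_eq_divide frac_le)
    have E: "norm (exp (of_real t * phase c k)) \<le> 1"
      using phase_Re[OF A(2), of c] A(1) by (simp add: mult_nonneg_nonpos)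
    have "norm (\<Sum>a\<le>i. of_real t ^ a * poly (P a) (inverse k)) \<le> (\<Sum>a\<le>i. (1 + t) ^ i * M a)"
    proof (rule sum_norm_le)
      fix a assume a: "a \<in> {..i}"
      have "t ^ a \<le> (1 + t) ^ a" using A(1) by (intro power_mono) auto
      also have "\<dots> \<le> (1 + t) ^ i" using A(1) a by (intro power_increasing) auto
      finally show "norm (of_real t ^ a * poly (P a) (inverse k)) \<le> (1 + t) ^ i * M a"
        unfolding norm_mult using M[OF z, of a] A(1) by (intro mult_mono) (auto simp: norm_power)
    qed
    then have "norm (osc_form c p i P t k) \<le> 1 * (inverse (norm k) ^ p) * ((1 + t) ^ i * (\<Sum>a\<le>i. M a))"
      unfolding osc_form_def norm_mult norm_power norm_inverse sum_distrib_left[symmetric]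
      using E by (intro mult_mono) auto
    then show "norm (osc i c p t k) \<le> (\<Sum>a\<le>i. M a) * (1 + t) ^ i / norm k ^ p"
      unfolding P[OF k] by (simp add: divide_inverse power_inverse mult_ac)
  qed
qed

lemma osc_uniform_bound:
  assumes \<delta>: "\<delta> > 0"
  obtains C where "C \<ge> 0" "\<And>i c p t k. i \<le> n \<Longrightarrow> p \<le> q \<Longrightarrow> 0 \<le> t \<Longrightarrow> 0 \<le> Im k \<Longrightarrow> \<delta> \<le> norm k \<Longrightarrow>
            norm (osc i c p t k) \<le> C * (1 + t) ^ n / norm k ^ p"
proof -
  obtain D where D: "\<And>i c p t k. 0 \<le> t \<Longrightarrow> 0 \<le> Im k \<Longrightarrow> \<delta> \<le> norm k \<Longrightarrow>
            norm (osc i c p t k) \<le> D i c p * (1 + t) ^ i / norm k ^ p"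
    using osc_bound[OF \<delta>] by metis
  define C where "C = (\<Sum>(i, c, p)\<in>{..n} \<times> UNIV \<times> {..q}. \<bar>D i c p\<bar>)"
  show ?thesis
  proof (rule that[of C])
    show "C \<ge> 0" unfolding C_def by (intro sum_nonneg) auto
    fix i c p t k assume A: "i \<le> n" "p \<le> q" "0 \<le> (t::real)" "0 \<le> Im k" "\<delta> \<le> norm k"
    have "\<bar>D i c p\<bar> \<le> C"
      unfolding C_def using A
      by (intro member_le_sum[of "(i, c, p)" _ "\<lambda>(i, c, p). \<bar>D i c p\<bar>", simplified]) auto
    then have "D i c p * (1 + t) ^ i \<le> C * (1 + t) ^ n"
      using A by (intro mult_mono power_increasing) auto
    then have "D i c p * (1 + t) ^ i / norm k ^ p \<le> C * (1 + t) ^ n / norm k ^ p"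
      by (intro divide_right_mono) auto
    then show "norm (osc i c p t k) \<le> C * (1 + t) ^ n / norm k ^ p"
      using D[OF A(3-5), of i c p] by linarith
  qed
qed

section \<open>The scattering problem\<close>

text \<open>With \<open>q = u\<^sub>0\<^sub>x + u\<^sub>1\<close>, \<open>s = sin u\<^sub>0\<close> and \<open>\<kappa> = cos u\<^sub>0 - 1\<close>, the matrix \<open>U\<close> is \<open>coefA q + coefB s \<kappa> / k\<close>.\<close>

definition coefA :: "(real \<Rightarrow> complex) \<Rightarrow> 2 \<Rightarrow> 2 \<Rightarrow> real \<Rightarrow> complex" where
  "coefA q c d t = (if c = d then 0 else if c = 1 then - q t / 4 else q t / 4)"

definition coefB :: "(real \<Rightarrow> complex) \<Rightarrow> (real \<Rightarrow> complex) \<Rightarrow> 2 \<Rightarrow> 2 \<Rightarrow> real \<Rightarrow> complex" where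
  "coefB s \<kappa> c d t = \<i> / 4 * (if c \<noteq> d then s t else if c = 1 then \<kappa> t else - \<kappa> t)"

definition region :: "real \<Rightarrow> complex set" where
  "region \<delta> = {k. Im k \<ge> 0 \<and> \<delta> \<le> norm k}"

text \<open>Inhomogeneous terms whose jets are bounded uniformly on each set \<open>region \<delta>\<close>.\<close>

definition forcing :: "nat \<Rightarrow> (nat \<Rightarrow> 2 \<Rightarrow> real \<Rightarrow> complex \<Rightarrow> complex) \<Rightarrow> bool" where
  "forcing n f \<longleftrightarrow> (\<forall>\<delta>>0. \<exists>B\<ge>0. jet_family n (region \<delta>) (\<lambda>x. B) f)"

lemma region_punctured: "k \<in> punctured_upper \<Longrightarrow> k \<in> region (norm k)"
  and punctured_region: "\<delta> > 0 \<Longrightarrow> k \<in> region \<delta> \<Longrightarrow> k \<in> punctured_upper"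
  by (auto simp: region_def)

text \<open>The closed half-plane without \<open>0\<close> is not convex, as differentiation under the integral requires, but it is so locally.\<close>

lemma punctured_upper_local:
  assumes k: "k \<in> punctured_upper"
  defines "S \<equiv> closed_upper \<inter> ball k (norm k / 2)"
  shows "convex S" "S \<subseteq> region (norm k / 2)" "k \<in> S" "at k within S = at k within punctured_upper"
proof -
  have kp: "norm k > 0" using k by simp
  have "convex closed_upper" by (rule convex_halfspace_Im_ge)
  then show "convex S" unfolding S_def by (intro convex_Int convex_ball)
  show sub: "S \<subseteq> region (norm k / 2)"
  proof
    fix z assume "z \<in> S"
    then have "Im z \<ge> 0" "norm (k - z) < norm k / 2" by (auto simp: S_def dist_norm)
    then show "z \<in> region (norm k / 2)"
      using norm_triangle_ineq2[of k z] by (auto simp: region_def)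
  qed
  show kS: "k \<in> S" using k kp by (simp add: S_def)
  show "at k within S = at k within punctured_upper"
  proof (rule at_within_nhd[of k "ball k (norm k / 2)"])
    show "S \<inter> ball k (norm k / 2) - {k} = punctured_upper \<inter> ball k (norm k / 2) - {k}"
      using sub kp by (auto simp: S_def region_def)
  qed (use kp in auto)
qed

text \<open>The coefficients are allowed to be arbitrary functions, so that the same theory serves for the data \<open>(u\<^sub>0, u\<^sub>1)\<close> and \<open>(- u\<^sub>0, u\<^sub>1)\<close>.\<close>

locale scattering =
  fixes n :: nat and q s \<kappa> :: "real \<Rightarrow> complex"
  assumes q1: "sobolev n 1 q" and s1: "sobolev n 1 s" and \<kappa>1: "sobolev n 1 \<kappa>"
begin

definition kern :: "nat \<Rightarrow> 2 \<Rightarrow> 2 \<Rightarrow> real \<Rightarrow> real \<Rightarrow> complex \<Rightarrow> complex" where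
  "kern i c d x t k = osc i c 0 (t - x) k * coefA q c d t + osc i c 1 (t - x) k * coefB s \<kappa> c d t"

definition pot :: "complex \<Rightarrow> 2 \<Rightarrow> 2 \<Rightarrow> real \<Rightarrow> complex" where
  "pot k c d t = coefA q c d t + coefB s \<kappa> c d t / k"

definition rhs :: "complex \<Rightarrow> (2 \<Rightarrow> real \<Rightarrow> complex) \<Rightarrow> 2 \<Rightarrow> real \<Rightarrow> complex" where
  "rhs k y c t = (\<Sum>d\<in>UNIV. pot k c d t * y d t)"

text \<open>The Volterra equation for the second column at a single \<open>k\<close>, among bounded continuous functions and with a general
inhomogeneous term \<open>f\<close>.\<close>

definition solves :: "(2 \<Rightarrow> real \<Rightarrow> complex) \<Rightarrow> complex \<Rightarrow> (2 \<Rightarrow> real \<Rightarrow> complex) \<Rightarrow> bool" where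
  "solves f k y \<longleftrightarrow> (\<forall>c. continuous_on {0..} (y c)) \<and> (\<forall>c. bounded (y c ` {0..})) \<and>
     (\<forall>c. \<forall>x\<ge>0. y c x = f c x - integral {x..} (\<lambda>t. exp (of_real (t - x) * phase c k) * rhs k y c t))"

lemma coef_continuous: "continuous_on {0..} q" "continuous_on {0..} s" "continuous_on {0..} \<kappa>"
  using multiplier_Suc[OF sobolev_imp_multiplier[of n 0]] q1 s1 \<kappa>1 by (simp_all only: One_nat_def)

lemma coefA_cont: "continuous_on {0..} (coefA q c d)"
  using coef_continuous unfolding coefA_def[abs_def] by (cases "c = d"; cases "c = 1"; simp; intro continuous_intros; simp)

lemma coefB_cont: "continuous_on {0..} (coefB s \<kappa> c d)"
  using coef_continuous unfolding coefB_def[abs_def] by (cases "c = d"; cases "c = 1"; simp; intro continuous_intros; simp)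

lemma kern_0: "kern 0 c d x t k = exp (of_real (t - x) * phase c k) * pot k c d t"
  by (simp add: kern_def pot_def osc_0 algebra_simps)

lemma kern_rhs: "(\<Sum>d\<in>UNIV. kern 0 c d x t k * y d t) = exp (of_real (t - x) * phase c k) * rhs k y c t"
  unfolding kern_0 rhs_def sum_distrib_left by (simp add: mult.assoc)

definition coef_size :: "real \<Rightarrow> real" where
  "coef_size t = norm (q t) + norm (s t) + norm (\<kappa> t)"

lemma coefA_le: "norm (coefA q c d t) \<le> coef_size t"
  unfolding coefA_def coef_size_def using norm_ge_zero[of "q t"] norm_ge_zero[of "s t"] norm_ge_zero[of "\<kappa> t"]
  by (auto simp: norm_divide intro: order_trans[of _ "norm (q t)"])

lemma coefB_le: "norm (coefB s \<kappa> c d t) \<le> coef_size t"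
  unfolding coefB_def coef_size_def using norm_ge_zero[of "q t"] norm_ge_zero[of "s t"] norm_ge_zero[of "\<kappa> t"]
  by (auto simp: norm_mult norm_divide)

lemma coef_size_cont: "continuous_on {0..} coef_size"
  unfolding coef_size_def[abs_def] by (intro continuous_intros coef_continuous)

lemma coef_size_int: "(\<lambda>t. (1 + t) ^ n * coef_size t) absolutely_integrable_on {0..}"
proof -
  have "(\<lambda>t. (1 + t) ^ n * norm (q t) + (1 + t) ^ n * norm (s t) + (1 + t) ^ n * norm (\<kappa> t)) absolutely_integrable_on {0..}"
    by (intro set_integral_add(1) weighted_L1_norm sobolev_weighted_L1[OF q1]
          sobolev_weighted_L1[OF s1] sobolev_weighted_L1[OF \<kappa>1])
  then show ?thesis by (simp add: coef_size_def[abs_def] algebra_simps)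
qed

lemma coef_size_int': "coef_size absolutely_integrable_on {0..}"
proof (rule continuous_dominated_absolutely_integrable[OF coef_size_cont absolutely_integrable_on_imp_integrable_on[OF coef_size_int]])
  fix t :: real assume "t \<in> {0..}"
  moreover have "coef_size t \<ge> 0" by (simp add: coef_size_def)
  ultimately show "norm (coef_size t) \<le> (1 + t) ^ n * coef_size t"
    using mult_right_mono[of 1 "(1 + t) ^ n" "coef_size t"] one_le_power[of "1 + t" n] by simp
qed simp

text \<open>The bounds of \<open>osc\<close> grow like \<open>(1 + t) ^ n\<close>, which the weighted class of the coefficients absorbs.\<close>

lemma kern_jet_kernel:
  assumes \<delta>: "\<delta> > 0"
  shows "\<exists>w. tail_weight w \<and> jet_kernel n (region \<delta>) w kern"
proof -
  obtain C where C: "C \<ge> 0" "\<And>i c p t k. i \<le> n \<Longrightarrow> p \<le> 1 \<Longrightarrow> 0 \<le> t \<Longrightarrow> 0 \<le> Im k \<Longrightarrow> \<delta> \<le> norm k \<Longrightarrow>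
            norm (osc i c p t k) \<le> C * (1 + t) ^ n / norm k ^ p"
    using osc_uniform_bound[OF \<delta>, of n 1] by blast
  define w where "w = (\<lambda>t. C * (1 + 1 / \<delta>) * ((1 + t) ^ n * coef_size t))"
  have cs: "coef_size t \<ge> 0" for t by (simp add: coef_size_def)
  have "tail_weight w"
  proof
    show "continuous_on {0..} w" unfolding w_def by (intro continuous_intros coef_size_cont)
    show "w x \<ge> 0" if "x \<ge> 0" for x unfolding w_def using that C \<delta> cs by simp
    show "w absolutely_integrable_on {0..}" unfolding w_def by (intro set_integrable_mult_right coef_size_int)
  qed
  moreover have "jet_kernel n (region \<delta>) w kern"
  proof (rule jet_kernelI)
    fix i c d k and x t :: real assume A: "i \<le> n" "0 \<le> x" "x \<le> t" "k \<in> region \<delta>"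
    have k: "0 \<le> Im k" "\<delta> \<le> norm k" "norm k > 0" using A \<delta> by (auto simp: region_def)
    have tt: "(1 + (t - x)) ^ n \<le> (1 + t) ^ n" using A by (intro power_mono) auto
    have o0: "norm (osc i c 0 (t - x) k) \<le> C * (1 + t) ^ n"
      using C(2)[OF A(1) zero_le_one _ k(1,2), of "t - x" c] A tt mult_left_mono[OF tt C(1)] by simp
    have "norm (osc i c 1 (t - x) k) \<le> C * (1 + (t - x)) ^ n / norm k"
      using C(2)[OF A(1) order_refl _ k(1,2), of "t - x" c] A by simp
    also have "\<dots> \<le> C * (1 + t) ^ n / \<delta>"
      using A C \<delta> k tt by (intro frac_le mult_left_mono) auto
    finally have o1: "norm (osc i c 1 (t - x) k) \<le> C * (1 + t) ^ n / \<delta>" .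
    have "norm (kern i c d x t k) \<le> C * (1 + t) ^ n * coef_size t + C * (1 + t) ^ n / \<delta> * coef_size t"
      unfolding kern_def
      by (intro norm_triangle_le add_mono; unfold norm_mult; intro mult_mono o0 o1 coefA_le coefB_le)
         (use C A \<delta> in auto)
    also have "\<dots> = w t" by (simp add: w_def algebra_simps)
    finally show "norm (kern i c d x t k) \<le> w t" .
  next
    fix i c d k and x t :: real assume A: "i < n" "0 \<le> x" "x \<le> t" "k \<in> region \<delta>"
    have k: "k \<noteq> 0" using A \<delta> by (auto simp: region_def)
    show "(kern i c d x t has_field_derivative kern (Suc i) c d x t k) (at k within region \<delta>)"
      unfolding kern_def[abs_def]
      by (intro DERIV_add DERIV_cmult_right has_field_derivative_at_within[OF osc_deriv[OF k]])
  next
    fix c d and x t :: real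
    have "isCont (kern n c d x t) k" if "k \<noteq> 0" for k
      unfolding kern_def[abs_def] by (intro continuous_intros DERIV_isCont[OF osc_deriv[OF that]])
    moreover have "k \<noteq> 0" if "k \<in> region \<delta>" for k using that \<delta> by (auto simp: region_def)
    ultimately show "continuous_on (region \<delta>) (kern n c d x t)"
      by (intro continuous_at_imp_continuous_on ballI) blast
  next
    fix i c d k and x :: real assume A: "0 \<le> x" "k \<in> region \<delta>"
    have k: "k \<noteq> 0" using A \<delta> by (auto simp: region_def)
    show "continuous_on {x..} (\<lambda>t. kern i c d x t k)"
      unfolding kern_def
      by (intro continuous_intros continuous_on_subset[OF coefA_cont] continuous_on_subset[OF coefB_cont]
            continuous_on_compose2[OF osc_continuous_t[OF k, of UNIV]]) (use A in auto)
  next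
    fix i c d k and t :: real assume A: "0 \<le> t" "k \<in> region \<delta>"
    have k: "k \<noteq> 0" using A \<delta> by (auto simp: region_def)
    show "continuous_on {0..t} (\<lambda>x. kern i c d x t k)"
      unfolding kern_def
      by (intro continuous_intros continuous_on_compose2[OF osc_continuous_t[OF k, of UNIV]]) auto
  qed
  ultimately show ?thesis by blast
qed

text \<open>The constant depends on the region only and not on the forcing. A forcing that is small at some \<open>k\<close>
therefore gives a solution that is small at this \<open>k\<close>, in all derivatives up to order \<open>n\<close>.\<close>

lemma solution_jet_bound:
  assumes \<delta>: "\<delta> > 0"
  shows "\<exists>C\<ge>0. \<forall>f B k. forcing n f \<longrightarrow> k \<in> region \<delta> \<longrightarrow> B \<ge> 0 \<longrightarrow>
      (\<forall>i c x. i \<le> n \<longrightarrow> 0 \<le> x \<longrightarrow> norm (f i c x k) \<le> B) \<longrightarrow>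
      (\<forall>i c x. i \<le> n \<longrightarrow> 0 \<le> x \<longrightarrow> norm (volterra_sol kern f i c x k) \<le> C * B)"
proof -
  obtain w where w: "tail_weight w" "jet_kernel n (region \<delta>) w kern" using kern_jet_kernel[OF \<delta>] by blast
  interpret tail_weight w by (rule w(1))
  let ?l = "rate TYPE(2) n"
  show ?thesis
  proof (intro exI[of _ "2 * exp (?l * \<mu> 0)"] conjI allI impI)
    fix f B k i c and x :: real
    assume A: "forcing n f" "k \<in> region \<delta>" "(B::real) \<ge> 0"
      "\<forall>i c x. i \<le> n \<longrightarrow> 0 \<le> x \<longrightarrow> norm (f i c x k) \<le> B" "i \<le> n" "0 \<le> x"
    obtain B' where "jet_family n (region \<delta>) (\<lambda>x. B') f" using A(1) \<delta> unfolding forcing_def by blast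
    then have "jet_family n {k} (\<lambda>x. B) f"
      by (rule jet_family_subset) (use A in auto)
    from volterra_sol_jet_family[OF _ jet_kernel_subset[OF w(2) _ order_refl] this A(3)]
    have "jet_family n {k} (\<lambda>x. 2 * B * exp (?l * \<mu> x)) (volterra_sol kern f)" using A(2) by simp
    from jet_familyD(1)[OF this A(5,6)]
    have "norm (volterra_sol kern f i c x k) \<le> 2 * B * exp (?l * \<mu> x)" by simp
    also have "\<dots> \<le> 2 * B * exp (?l * \<mu> 0)"
      using \<mu>_le[OF A(6)] A(3) rate_pos[where 'c=2 and n=n] by (intro mult_left_mono) auto
    finally show "norm (volterra_sol kern f i c x k) \<le> 2 * exp (?l * \<mu> 0) * B" by (simp add: mult_ac)
  qed simp
qed

lemma solution_jets:
  assumes f: "forcing n f" and x: "0 \<le> x"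
  shows "\<And>i k. i < n \<Longrightarrow> k \<in> punctured_upper \<Longrightarrow>
      (volterra_sol kern f i c x has_field_derivative volterra_sol kern f (Suc i) c x k) (at k within punctured_upper)"
    and "continuous_on punctured_upper (volterra_sol kern f n c x)"
proof -
  have fam: "\<exists>\<beta>. jet_family n (closed_upper \<inter> ball k (norm k / 2)) \<beta> (volterra_sol kern f)"
    if k: "k \<in> punctured_upper" for k
  proof -
    have \<delta>: "norm k / 2 > 0" using k by simp
    obtain w where w: "tail_weight w" "jet_kernel n (region (norm k / 2)) w kern" using kern_jet_kernel[OF \<delta>] by blast
    interpret tail_weight w by (rule w(1))
    obtain B where B: "B \<ge> 0" "jet_family n (region (norm k / 2)) (\<lambda>x. B) f" using f \<delta> unfolding forcing_def by blast
    show ?thesis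
      using volterra_sol_jet_family[OF punctured_upper_local(1)[OF k]
        jet_kernel_subset[OF w(2) punctured_upper_local(2)[OF k] order_refl]
        jet_family_subset[OF B(2) punctured_upper_local(2)[OF k] order_refl] B(1)]
        jet_familyD(1)[OF B(2)] punctured_upper_local(2)[OF k] by blast
  qed
  show "(volterra_sol kern f i c x has_field_derivative volterra_sol kern f (Suc i) c x k) (at k within punctured_upper)"
    if A: "i < n" "k \<in> punctured_upper" for i k
  proof -
    obtain \<beta> where "jet_family n (closed_upper \<inter> ball k (norm k / 2)) \<beta> (volterra_sol kern f)"
      using fam[OF A(2)] by blast
    from jet_familyD(2)[OF this A(1) x punctured_upper_local(3)[OF A(2)]]
    show ?thesis unfolding punctured_upper_local(4)[OF A(2)] .
  qed
  show "continuous_on punctured_upper (volterra_sol kern f n c x)"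
    unfolding continuous_on_eq_continuous_within
  proof
    fix k assume k: "k \<in> punctured_upper"
    obtain \<beta> where "jet_family n (closed_upper \<inter> ball k (norm k / 2)) \<beta> (volterra_sol kern f)"
      using fam[OF k] by blast
    from jet_familyD(3)[OF this x, of c]
    have "continuous (at k within (closed_upper \<inter> ball k (norm k / 2))) (volterra_sol kern f n c x)"
      unfolding continuous_on_eq_continuous_within using punctured_upper_local(3)[OF k] by blast
    then show "continuous (at k within punctured_upper) (volterra_sol kern f n c x)"
      unfolding continuous_within punctured_upper_local(4)[OF k] .
  qed
qed

lemma solution_solves:
  assumes f: "forcing n f" and k: "k \<in> punctured_upper"
  shows "solves (\<lambda>c x. f 0 c x k) k (\<lambda>c x. volterra_sol kern f 0 c x k)"
proof -
  have \<delta>: "norm k > 0" using k by simp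
  have kr: "{k} \<subseteq> region (norm k)" using region_punctured[OF k] by simp
  obtain w where w: "tail_weight w" "jet_kernel n (region (norm k)) w kern" using kern_jet_kernel[OF \<delta>] by blast
  interpret tail_weight w by (rule w(1))
  obtain B where B: "B \<ge> 0" "jet_family n (region (norm k)) (\<lambda>x. B) f" using f \<delta> unfolding forcing_def by blast
  have K: "jet_kernel 0 {k} w kern" by (rule jet_kernel_subset[OF w(2) kr]) simp
  have F: "jet_family 0 {k} (\<lambda>x. B) f"
    by (rule jet_family_subset[OF B(2) kr]) (use jet_familyD(1)[OF B(2)] kr in auto)
  have fam: "jet_family 0 {k} (\<lambda>x. 2 * B * exp (rate TYPE(2) 0 * \<mu> x)) (volterra_sol kern f)"
    by (rule volterra_sol_jet_family[OF _ K F B(1)]) simp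
  have "norm (volterra_sol kern f 0 c x k) \<le> 2 * B * exp (rate TYPE(2) 0 * \<mu> 0)" if "0 \<le> x" for c x
  proof -
    have "norm (volterra_sol kern f 0 c x k) \<le> 2 * B * exp (rate TYPE(2) 0 * \<mu> x)"
      by (rule jet_familyD(1)[OF fam]) (use that in auto)
    also have "\<dots> \<le> 2 * B * exp (rate TYPE(2) 0 * \<mu> 0)"
      using \<mu>_le[OF that] B(1) rate_pos[where 'c=2 and n=0] by (intro mult_left_mono) auto
    finally show ?thesis .
  qed
  then have "bounded ((\<lambda>x. volterra_sol kern f 0 c x k) ` {0..})" for c
    unfolding bounded_iff by auto
  moreover have "continuous_on {0..} (\<lambda>x. volterra_sol kern f 0 c x k)" for c
    by (rule jet_familyD(4)[OF fam]) auto
  moreover have "volterra_sol kern f 0 c x k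
     = f 0 c x k - integral {x..} (\<lambda>t. exp (of_real (t - x) * phase c k) * rhs k (\<lambda>c x. volterra_sol kern f 0 c x k) c t)"
    if "0 \<le> x" for c x
    unfolding kern_rhs[symmetric, where y="\<lambda>c x. volterra_sol kern f 0 c x k"]
    by (rule volterra_sol_equation[OF K F B(1) that])
  ultimately show ?thesis unfolding solves_def by blast
qed

lemma rhs_integrable:
  assumes "k \<noteq> 0" "\<And>c. continuous_on {0..} (y c)" "\<And>c. bounded (y c ` {0..})"
  shows "rhs k y c absolutely_integrable_on {0..}" and "continuous_on {0..} (rhs k y c)"
proof -
  show cont: "continuous_on {0..} (rhs k y c)"
    unfolding rhs_def[abs_def] pot_def
    by (intro continuous_on_sum continuous_on_mult continuous_on_add continuous_on_divide
          continuous_on_const coefA_cont coefB_cont assms(2)) (use assms(1) in auto)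
  have "\<exists>M. \<forall>x\<ge>0. norm (y c x) \<le> M" for c using assms(3)[of c] by (auto simp: bounded_iff)
  then obtain M where M: "\<And>c x. x \<ge> 0 \<Longrightarrow> norm (y c x) \<le> M c" by metis
  show "rhs k y c absolutely_integrable_on {0..}"
  proof (rule continuous_dominated_absolutely_integrable[OF cont])
    show "(\<lambda>t. (\<Sum>d\<in>UNIV. (1 + 1 / norm k) * M d) * coef_size t) integrable_on {0..}"
      by (intro integrable_on_mult_right absolutely_integrable_on_imp_integrable_on coef_size_int')
    fix t :: real assume t: "t \<in> {0..}"
    have cs: "coef_size t \<ge> 0" by (simp add: coef_size_def)
    have "norm (rhs k y c t) \<le> (\<Sum>d\<in>UNIV. ((1 + 1 / norm k) * coef_size t) * M d)"
      unfolding rhs_def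
    proof (rule sum_norm_le)
      fix d
      have "norm (pot k c d t) \<le> coef_size t + coef_size t / norm k"
        unfolding pot_def
        by (intro norm_triangle_le add_mono coefA_le; unfold norm_divide; intro divide_right_mono coefB_le) simp
      also have "\<dots> = (1 + 1 / norm k) * coef_size t" by (simp add: algebra_simps)
      finally show "norm (pot k c d t * y d t) \<le> ((1 + 1 / norm k) * coef_size t) * M d"
        unfolding norm_mult using M[of t d] t cs by (intro mult_mono) auto
    qed
    also have "\<dots> = (\<Sum>d\<in>UNIV. (1 + 1 / norm k) * M d) * coef_size t"
      unfolding sum_distrib_right by (rule sum.cong) (auto simp: mult_ac)
    finally show "norm (rhs k y c t) \<le> (\<Sum>d\<in>UNIV. (1 + 1 / norm k) * M d) * coef_size t" .
  qed simp
qed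

end

lemma exp_phase_le_1: "Re \<phi> \<le> 0 \<Longrightarrow> 0 \<le> t \<Longrightarrow> norm (exp (of_real t * \<phi>)) \<le> 1"
  by (simp add: mult_nonneg_nonpos)

lemma exp_mult_integrable:
  assumes h: "h absolutely_integrable_on {0..}" and \<phi>: "Re \<phi> \<le> 0" and x: "0 \<le> x"
  shows "(\<lambda>t. exp (of_real (t - x) * \<phi>) * h t) absolutely_integrable_on {x..}"
proof -
  have 3: "bilinear (\<lambda>x y :: complex. x * y)"
    unfolding bilinear_conv_bounded_bilinear by (rule bounded_bilinear_mult)
  have "continuous_on {x..} (\<lambda>t. exp (of_real (t - x) * \<phi>))" by (intro continuous_intros)
  moreover have "bounded ((\<lambda>t. exp (of_real (t - x) * \<phi>)) ` {x..})"
    unfolding bounded_iff by (intro exI[of _ 1]) (auto simp: mult_nonneg_nonpos \<phi> simp del: of_real_diff)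
  moreover have "h absolutely_integrable_on {x..}" by (rule set_integrable_subset[OF h]) (use x in auto)
  ultimately show ?thesis
    by (intro absolutely_integrable_bounded_measurable_product[OF 3])
       (auto intro: continuous_imp_measurable_on_sets_lebesgue)
qed

context scattering
begin

lemma solves_unique:
  assumes y: "solves f k y" and z: "solves f k z" and k: "k \<in> punctured_upper" and x: "0 \<le> x"
  shows "y c x = z c x"
proof -
  have \<delta>: "norm k > 0" and k0: "k \<noteq> 0" using k by auto
  have kr: "{k} \<subseteq> region (norm k)" using region_punctured[OF k] by simp
  obtain w where w: "tail_weight w" "jet_kernel n (region (norm k)) w kern" using kern_jet_kernel[OF \<delta>] by blast
  interpret tail_weight w by (rule w(1))
  have K: "jet_kernel 0 {k} w kern" by (rule jet_kernel_subset[OF w(2) kr]) simp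
  define u where "u = (\<lambda>c x. y c x - z c x)"
  have cont: "continuous_on {0..} (y c)" "continuous_on {0..} (z c)" for c using y z by (auto simp: solves_def)
  have bd: "bounded (y c ` {0..})" "bounded (z c ` {0..})" for c using y z by (auto simp: solves_def)
  have "\<exists>M. \<forall>x\<ge>0. norm (u c x) \<le> M" for c
  proof -
    obtain M1 M2 where "\<And>x. x \<ge> 0 \<Longrightarrow> norm (y c x) \<le> M1" "\<And>x. x \<ge> 0 \<Longrightarrow> norm (z c x) \<le> M2"
      using bd[of c] unfolding bounded_iff by auto
    then show ?thesis unfolding u_def by (intro exI[of _ "M1 + M2"]) (auto intro: norm_triangle_le_diff add_mono)
  qed
  then obtain M where M: "\<And>c x. x \<ge> 0 \<Longrightarrow> norm (u c x) \<le> M c" by metis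
  have M': "norm (u c x) \<le> \<bar>M 1\<bar> + \<bar>M 2\<bar>" if "x \<ge> 0" for c x
    using M[OF that, of c] exhaust_2[of c] by auto
  have "u c x = 0"
  proof (rule volterra_homogeneous_zero[OF K _ M' _ x])
    show "continuous_on {0..} (u c)" for c unfolding u_def by (intro continuous_intros cont)
    fix c and x :: real assume x: "0 \<le> x"
    have Re: "Re (phase c k) \<le> 0" using k by (intro phase_Re) auto
    have i: "(\<lambda>t. exp (of_real (t - x) * phase c k) * rhs k y c t) integrable_on {x..}"
      "(\<lambda>t. exp (of_real (t - x) * phase c k) * rhs k z c t) integrable_on {x..}"
      by (intro absolutely_integrable_on_imp_integrable_on exp_mult_integrable rhs_integrable(1) Re x k0 cont bd)+
    have "u c x = - (integral {x..} (\<lambda>t. exp (of_real (t - x) * phase c k) * rhs k y c t)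
         - integral {x..} (\<lambda>t. exp (of_real (t - x) * phase c k) * rhs k z c t))"
      using y z x by (simp add: solves_def u_def)
    also have "\<dots> = - integral {x..} (\<lambda>t. exp (of_real (t - x) * phase c k) * rhs k y c t - exp (of_real (t - x) * phase c k) * rhs k z c t)"
      by (simp only: integral_diff[OF i])
    also have "(\<lambda>t. exp (of_real (t - x) * phase c k) * rhs k y c t - exp (of_real (t - x) * phase c k) * rhs k z c t)
       = (\<lambda>t. \<Sum>d\<in>UNIV. kern 0 c d x t k * u d t)"
      unfolding kern_rhs by (simp add: rhs_def u_def algebra_simps sum_subtractf)
    finally show "u c x = - integral {x..} (\<lambda>t. \<Sum>d\<in>UNIV. kern 0 c d x t k * u d t)" .
  qed
  then show ?thesis by (simp add: u_def)
qed

end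

lemma prim_exp: "prim (\<lambda>x. exp (of_real x * \<phi>)) (\<lambda>x. \<phi> * exp (of_real x * (\<phi>::complex)))"
proof (rule prim_of_derivative)
  fix x :: real
  have "((\<lambda>x. of_real x * \<phi>) has_vector_derivative \<phi>) (at x within {0..})"
    using has_vector_derivative_mult_left[OF has_vector_derivative_of_real[OF DERIV_ident], of \<phi>] by simp
  then have "((\<lambda>x. exp (of_real x * \<phi>)) has_vector_derivative \<phi> * exp (of_real x * \<phi>)) (at x within {0..})"
    using field_vector_diff_chain_within[of "\<lambda>x. of_real x * \<phi>" \<phi> x "{0..}" exp "exp (of_real x * \<phi>)"]
    by (auto simp: comp_def intro: DERIV_exp has_field_derivative_at_within)
  then show "((\<lambda>x. exp (of_real x * \<phi>)) has_vector_derivative \<phi> * exp (of_real x * \<phi>)) (at x within {0..})" .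
qed (intro continuous_intros)

text \<open>Variation of constants from infinity. There the boundary term \<open>exp ((R - x) \<phi>) y R\<close> converges either since the
exponential is \<open>1\<close> or since \<open>y\<close> vanishes at infinity; for purely imaginary \<open>\<phi>\<close> decay of the exponential is not available.\<close>

lemma prim_imp_volterra:
  assumes y: "prim y (\<lambda>t. - \<phi> * y t + h t)" and h: "h absolutely_integrable_on {0..}"
    and \<phi>: "Re \<phi> \<le> 0" and L: "(y \<longlongrightarrow> L) at_top" "\<phi> = 0 \<or> L = 0" and x: "0 \<le> x"
  shows "y x = L - integral {x..} (\<lambda>t. exp (of_real (t - x) * \<phi>) * h t)"
proof -
  have E: "exp (of_real x * \<phi>) * exp (- of_real x * \<phi>) = 1" for x :: real
    by (simp add: mult_exp_exp)
  have P: "prim (\<lambda>x. exp (of_real x * \<phi>) * y x) (\<lambda>x. exp (of_real x * \<phi>) * h x)"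
    by (rule prim_cong[OF prim_product[OF prim_exp y]]) (auto simp: algebra_simps)
  have inc: "exp (of_real (R - x) * \<phi>) * y R - y x = integral {x..R} (\<lambda>t. exp (of_real (t - x) * \<phi>) * h t)"
    if "x \<le> R" for R
  proof -
    have s: "exp (of_real (t - x) * \<phi>) = exp (- of_real x * \<phi>) * exp (of_real t * \<phi>)" for t
      by (simp add: mult_exp_exp algebra_simps)
    have "integral {x..R} (\<lambda>t. exp (of_real (t - x) * \<phi>) * h t)
       = exp (- of_real x * \<phi>) * integral {x..R} (\<lambda>t. exp (of_real t * \<phi>) * h t)"
      unfolding s mult.assoc by simp
    also have "\<dots> = exp (- of_real x * \<phi>) * (exp (of_real R * \<phi>) * y R - exp (of_real x * \<phi>) * y x)"
      using prim_increment[OF P x that] by simp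
    also have "\<dots> = exp (of_real (R - x) * \<phi>) * y R - (exp (of_real x * \<phi>) * exp (- of_real x * \<phi>)) * y x"
      unfolding s by (simp add: algebra_simps)
    finally show ?thesis unfolding E by simp
  qed
  have "((\<lambda>R. exp (of_real (R - x) * \<phi>) * y R) \<longlongrightarrow> L) at_top"
  proof (cases "\<phi> = 0")
    case True
    then show ?thesis using L(1) by simp
  next
    case False
    then have "L = 0" using L(2) by simp
    have "((\<lambda>R. exp (of_real (R - x) * \<phi>) * y R) \<longlongrightarrow> 0) at_top"
    proof (rule Lim_null_comparison)
      show "((\<lambda>R. norm (y R)) \<longlongrightarrow> 0) at_top" using tendsto_norm[OF L(1)] \<open>L = 0\<close> by simp
      show "\<forall>\<^sub>F R in at_top. norm (exp (of_real (R - x) * \<phi>) * y R) \<le> norm (y R)"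
        using eventually_ge_at_top[of x]
      proof eventually_elim
        case (elim R)
        then have "norm (exp (of_real (R - x) * \<phi>)) \<le> 1" by (intro exp_phase_le_1 \<phi>) simp
        then show ?case unfolding norm_mult by (intro mult_left_le_one_le) auto
      qed
    qed
    then show ?thesis using \<open>L = 0\<close> by simp
  qed
  then have "((\<lambda>R. exp (of_real (R - x) * \<phi>) * y R - y x) \<longlongrightarrow> L - y x) at_top"
    by (intro tendsto_intros)
  moreover have "\<forall>\<^sub>F R in at_top. exp (of_real (R - x) * \<phi>) * y R - y x
      = integral {x..R} (\<lambda>t. exp (of_real (t - x) * \<phi>) * h t)"
    using eventually_ge_at_top[of x] by eventually_elim (rule inc)
  ultimately have "((\<lambda>R. integral {x..R} (\<lambda>t. exp (of_real (t - x) * \<phi>) * h t)) \<longlongrightarrow> L - y x) at_top"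
    by (rule Lim_transform_eventually)
  with tendsto_integral_at_top[OF exp_mult_integrable[OF h \<phi> x]]
  have "L - y x = integral {x..} (\<lambda>t. exp (of_real (t - x) * \<phi>) * h t)"
    using tendsto_unique trivial_limit_at_top_linorder by blast
  then show ?thesis by (simp add: algebra_simps)
qed

lemma volterra_imp_prim:
  assumes y: "\<And>x. 0 \<le> x \<Longrightarrow> y x = L - integral {x..} (\<lambda>t. exp (of_real (t - x) * \<phi>) * h t)"
    and h: "h absolutely_integrable_on {0..}"
    and \<phi>: "Re \<phi> \<le> 0" and L: "\<phi> = 0 \<or> L = 0"
  shows "prim y (\<lambda>t. - \<phi> * y t + h t)" and "(y \<longlongrightarrow> L) at_top"
proof -
  let ?g = "\<lambda>t. exp (of_real t * \<phi>) * h t"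
  have s: "exp (of_real (t - x) * \<phi>) = exp (of_real x * (- \<phi>)) * exp (of_real t * \<phi>)" for t x :: real
    by (simp add: mult_exp_exp algebra_simps)
  have g: "?g absolutely_integrable_on {0..}" using exp_mult_integrable[OF h \<phi> order_refl] by simp
  have y': "y x = L + exp (of_real x * (- \<phi>)) * (- integral {x..} ?g)" if "0 \<le> x" for x
    unfolding y[OF that] s mult.assoc by simp
  have P: "prim (\<lambda>x. L + exp (of_real x * (- \<phi>)) * (- integral {x..} ?g))
     (\<lambda>x. 0 + ((- \<phi>) * exp (of_real x * (- \<phi>)) * (- integral {x..} ?g) + exp (of_real x * (- \<phi>)) * ?g x))"
    by (intro prim_add prim_const prim_product prim_exp prim_tail g)
  show "prim y (\<lambda>t. - \<phi> * y t + h t)"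
  proof (rule prim_cong[OF P])
    fix x :: real assume x: "0 \<le> x"
    define e G where "e = exp (of_real x * (- \<phi>))" and "G = integral {x..} ?g"
    have e: "e * ?g x = h x"
      unfolding e_def mult.assoc[symmetric] mult_exp_exp by simp
    have "- \<phi> * (L + e * (- G)) = - (\<phi> * L) + (- \<phi>) * e * (- G)" by (simp add: algebra_simps)
    then have "- \<phi> * (L + e * (- G)) = (- \<phi>) * e * (- G)" using L by auto
    then show "0 + ((- \<phi>) * exp (of_real x * (- \<phi>)) * (- integral {x..} ?g) + exp (of_real x * (- \<phi>)) * ?g x)
        = - \<phi> * y x + h x"
      unfolding y'[OF x] e_def[symmetric] G_def[symmetric] e by simp
  qed (use y' in simp)
  show "(y \<longlongrightarrow> L) at_top"
  proof -
    have hn: "(\<lambda>t. norm (h t)) absolutely_integrable_on {0..}"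
      using absolutely_integrable_norm[OF h] by (simp add: comp_def)
    have "((\<lambda>x. y x - L) \<longlongrightarrow> 0) at_top"
    proof (rule Lim_null_comparison[OF _ tail_integral_tendsto_0[OF hn]])
      show "\<forall>\<^sub>F x in at_top. norm (y x - L) \<le> integral {x..} (\<lambda>t. norm (h t))"
        using eventually_ge_at_top[of 0]
      proof eventually_elim
        case (elim x)
        have hx: "(\<lambda>t. norm (h t)) integrable_on {x..}"
          by (rule absolutely_integrable_on_imp_integrable_on[OF set_integrable_subset[OF hn]]) (use elim in auto)
        have "norm (integral {x..} (\<lambda>t. exp (of_real (t - x) * \<phi>) * h t)) \<le> integral {x..} (\<lambda>t. norm (h t))"
        proof (rule integral_norm_bound_integral[OF absolutely_integrable_on_imp_integrable_on[OF exp_mult_integrable[OF h \<phi> elim]] hx])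
          fix t assume "t \<in> {x..}"
          then have "norm (exp (of_real (t - x) * \<phi>)) \<le> 1" by (intro exp_phase_le_1 \<phi>) simp
          then show "norm (exp (of_real (t - x) * \<phi>) * h t) \<le> norm (h t)"
            unfolding norm_mult by (intro mult_left_le_one_le) auto
        qed
        then show ?case unfolding y[OF elim] by simp
      qed
    qed
    then show ?thesis by (simp add: LIM_zero_iff)
  qed
qed

section \<open>The formal series at infinity\<close>

lemma forcing_add:
  assumes "forcing n f" "forcing n g"
  shows "forcing n (\<lambda>i c x k. f i c x k + g i c x k)"
  unfolding forcing_def
proof (intro allI impI)
  fix \<delta> :: real assume "\<delta> > 0"
  then obtain A B where A: "A \<ge> 0" "jet_family n (region \<delta>) (\<lambda>x. A) f"
    and B: "B \<ge> 0" "jet_family n (region \<delta>) (\<lambda>x. B) g"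
    using assms unfolding forcing_def by blast
  have "jet_family n (region \<delta>) (\<lambda>x. A + B) (\<lambda>i c x k. f i c x k + g i c x k)"
    by (rule jet_familyI)
       (intro norm_triangle_le add_mono DERIV_add continuous_on_add jet_familyD[OF A(2)] jet_familyD[OF B(2)]; assumption)+
  then show "\<exists>B\<ge>0. jet_family n (region \<delta>) (\<lambda>x. B) (\<lambda>i c x k. f i c x k + g i c x k)"
    using A B by (intro exI[of _ "A + B"]) auto
qed

lemma const_forcing: "forcing n (\<lambda>i c x k. if i = 0 then e c else 0)"
  unfolding forcing_def
proof (intro allI impI exI conjI)
  fix \<delta> :: real
  show "0 \<le> norm (e 1) + norm (e 2)" by simp
  show "jet_family n (region \<delta>) (\<lambda>x. norm (e 1) + norm (e 2)) (\<lambda>i c x k. if i = 0 then e c else 0)"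
  proof (rule jet_familyI)
    fix i :: nat and c k and x :: real
    show "norm (if i = 0 then e c else 0) \<le> norm (e 1) + norm (e 2)"
      using exhaust_2[of c] by auto
    show "((\<lambda>k. if i = 0 then e c else 0) has_field_derivative (if Suc i = 0 then e c else 0)) (at k within region \<delta>)"
      by (cases "i = 0") auto
  qed auto
qed

text \<open>The forcing produced by an error term \<open>g / k ^ p\<close> in the differential equation, together with its derivatives in \<open>k\<close>.\<close>

definition osc_tail :: "nat \<Rightarrow> (2 \<Rightarrow> real \<Rightarrow> complex) \<Rightarrow> nat \<Rightarrow> 2 \<Rightarrow> real \<Rightarrow> complex \<Rightarrow> complex" where
  "osc_tail p g i c x k = integral {x..} (\<lambda>t. osc i c p (t - x) k * g c t)"

lemma osc_tail_facts:
  assumes g: "\<And>c. weighted_L1 n (g c)"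
  shows "\<delta> > 0 \<Longrightarrow> \<exists>C\<ge>0. \<forall>i c x k. i \<le> n \<longrightarrow> 0 \<le> x \<longrightarrow> k \<in> region \<delta> \<longrightarrow>
            norm (osc_tail p g i c x k) \<le> C / norm k ^ p"
    and "forcing n (osc_tail p g)"
proof -
  have gi: "(\<lambda>t. (1 + t) ^ n * norm (g c t)) absolutely_integrable_on {x..}" if "0 \<le> x" for c x
    by (rule set_integrable_subset[OF weighted_L1_norm[OF g]]) (use that in auto)
  have gm: "g c \<in> borel_measurable (lebesgue_on {x..})" if "0 \<le> x" for c x
    by (rule absolutely_integrable_imp_borel_measurable[OF set_integrable_subset[OF weighted_L1_imp_L1[OF g]]])
       (use that in auto)
  have om: "(\<lambda>t. osc i c p (t - x) k) \<in> borel_measurable (lebesgue_on {x..})" if "k \<noteq> 0" for i c x k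
    by (rule continuous_imp_measurable_on_sets_lebesgue)
       (auto intro!: continuous_intros continuous_on_compose2[OF osc_continuous_t[OF that, of UNIV]])
  have m: "(\<lambda>t. osc i c p (t - x) k * g c t) \<in> borel_measurable (lebesgue_on {x..})"
    if "0 \<le> x" "k \<noteq> 0" for i c x k
    by (intro borel_measurable_times om gm that)
  have main: "\<exists>C\<ge>0. (\<forall>i c x t k. i \<le> n \<longrightarrow> 0 \<le> x \<longrightarrow> x \<le> t \<longrightarrow> k \<in> region \<delta> \<longrightarrow>
            norm (osc i c p (t - x) k * g c t) \<le> C / norm k ^ p * ((1 + t) ^ n * norm (g c t)))"
    if \<delta>: "\<delta> > 0" for \<delta>
  proof -
    obtain C where C: "C \<ge> 0" "\<And>i c p' t k. i \<le> n \<Longrightarrow> p' \<le> p \<Longrightarrow> 0 \<le> t \<Longrightarrow> 0 \<le> Im k \<Longrightarrow> \<delta> \<le> norm k \<Longrightarrow>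
            norm (osc i c p' t k) \<le> C * (1 + t) ^ n / norm k ^ p'"
      using osc_uniform_bound[OF \<delta>, of n p] by blast
    show ?thesis
    proof (intro exI[of _ C] conjI allI impI)
      fix i c k and x t :: real assume A: "i \<le> n" "0 \<le> x" "x \<le> t" "k \<in> region \<delta>"
      have k: "0 \<le> Im k" "\<delta> \<le> norm k" using A by (auto simp: region_def)
      have "norm (osc i c p (t - x) k) \<le> C * (1 + (t - x)) ^ n / norm k ^ p"
        using C(2)[OF A(1) order_refl _ k, of "t - x" c] A by simp
      also have "\<dots> \<le> C * (1 + t) ^ n / norm k ^ p"
        using A C by (intro divide_right_mono mult_left_mono power_mono) auto
      finally have "norm (osc i c p (t - x) k) * norm (g c t) \<le> C * (1 + t) ^ n / norm k ^ p * norm (g c t)"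
        by (intro mult_right_mono) auto
      then show "norm (osc i c p (t - x) k * g c t) \<le> C / norm k ^ p * ((1 + t) ^ n * norm (g c t))"
        by (simp add: norm_mult mult_ac)
    qed (rule C(1))
  qed
  show bd: "\<exists>C\<ge>0. \<forall>i c x k. i \<le> n \<longrightarrow> 0 \<le> x \<longrightarrow> k \<in> region \<delta> \<longrightarrow>
            norm (osc_tail p g i c x k) \<le> C / norm k ^ p" if \<delta>: "\<delta> > 0" for \<delta>
  proof -
    obtain C where C: "C \<ge> 0" "\<And>i c x t k. i \<le> n \<Longrightarrow> 0 \<le> x \<Longrightarrow> x \<le> t \<Longrightarrow> k \<in> region \<delta> \<Longrightarrow>
            norm (osc i c p (t - x) k * g c t) \<le> C / norm k ^ p * ((1 + t) ^ n * norm (g c t))"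
      using main[OF \<delta>] by blast
    define G where "G = (\<lambda>c. integral {0..} (\<lambda>t. (1 + t) ^ n * norm (g c t)))"
    have G0: "G c \<ge> 0" for c
      unfolding G_def
      by (rule Henstock_Kurzweil_Integration.integral_nonneg[OF absolutely_integrable_on_imp_integrable_on[OF gi[OF order_refl]]]) simp
    show ?thesis
    proof (intro exI[of _ "C * (G 1 + G 2)"] conjI allI impI)
      show "0 \<le> C * (G 1 + G 2)" using C G0 by simp
      fix i c k and x :: real assume A: "i \<le> n" "0 \<le> x" "k \<in> region \<delta>"
      have k: "k \<noteq> 0" using A \<delta> by (auto simp: region_def)
      have I: "(\<lambda>t. C / norm k ^ p * ((1 + t) ^ n * norm (g c t))) integrable_on {x..}"
        by (intro integrable_on_mult_right absolutely_integrable_on_imp_integrable_on gi A)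
      have "norm (osc_tail p g i c x k) \<le> integral {x..} (\<lambda>t. C / norm k ^ p * ((1 + t) ^ n * norm (g c t)))"
        unfolding osc_tail_def
        by (rule integral_norm_bound_integral[OF measurable_bounded_by_integrable_imp_integrable[OF m[OF A(2) k] I] I])
           (use C(2) A in auto)
      also have "\<dots> = C / norm k ^ p * integral {x..} (\<lambda>t. (1 + t) ^ n * norm (g c t))" by simp
      also have "\<dots> \<le> C / norm k ^ p * G c"
        unfolding G_def using C(1) A(2)
        by (intro mult_left_mono integral_subset_le absolutely_integrable_on_imp_integrable_on gi) auto
      also have "\<dots> \<le> C / norm k ^ p * (G 1 + G 2)"
        using exhaust_2[of c] G0[of 1] G0[of 2] C(1) by (intro mult_left_mono) auto
      finally show "norm (osc_tail p g i c x k) \<le> C * (G 1 + G 2) / norm k ^ p" by simp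
    qed
  qed
  show "forcing n (osc_tail p g)"
    unfolding forcing_def
  proof (intro allI impI)
    fix \<delta> :: real assume \<delta>: "\<delta> > 0"
    obtain C where C: "C \<ge> 0" "\<And>i c x k. i \<le> n \<Longrightarrow> 0 \<le> x \<Longrightarrow> k \<in> region \<delta> \<Longrightarrow>
            norm (osc_tail p g i c x k) \<le> C / norm k ^ p" using bd[OF \<delta>] by blast
    have der: "(osc_tail p g i c x has_field_derivative osc_tail p g (Suc i) c x k) (at k within punctured_upper)"
      if A: "i < n" "0 \<le> x" and k: "k \<in> punctured_upper" for i c x k
    proof -
      define S where "S = closed_upper \<inter> ball k (norm k / 2)"
      note S = punctured_upper_local[OF k, folded S_def]
      have k2: "norm k / 2 > 0" using k by simp
      obtain D where D: "D \<ge> 0" "\<And>i c x t k'. i \<le> n \<Longrightarrow> 0 \<le> x \<Longrightarrow> x \<le> t \<Longrightarrow> k' \<in> region (norm k / 2) \<Longrightarrow>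
            norm (osc i c p (t - x) k' * g c t) \<le> D / norm k' ^ p * ((1 + t) ^ n * norm (g c t))"
        using main[OF k2] by blast
      define w where "w = (\<lambda>t. D / (norm k / 2) ^ p * ((1 + t) ^ n * norm (g c t)))"
      have b: "norm (osc i c p (t - x) k' * g c t) \<le> w t" if "i \<le> n" "k' \<in> S" "t \<in> {x..}" for i k' t
      proof -
        have kr: "k' \<in> region (norm k / 2)" using S(2) that by blast
        have "norm (osc i c p (t - x) k' * g c t) \<le> D / norm k' ^ p * ((1 + t) ^ n * norm (g c t))"
          using D(2)[OF that(1) A(2) _ kr] that(3) by simp
        also have "\<dots> \<le> w t"
          unfolding w_def using D(1) kr k2 that(3) A(2)
          by (intro mult_right_mono frac_le power_mono) (auto simp: region_def)
        finally show ?thesis .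
      qed
      have nz: "k' \<noteq> 0" if "k' \<in> S" for k' using S(2) k2 that by (auto simp: region_def)
      have "(osc_tail p g i c x has_field_derivative osc_tail p g (Suc i) c x k) (at k within S)"
        unfolding osc_tail_def[abs_def]
      proof (rule has_field_derivative_parametric_integral[OF S(1) _ _ _ _ _ _ _ S(3), where w=w])
        show "w integrable_on {x..}" unfolding w_def
          by (intro integrable_on_mult_right absolutely_integrable_on_imp_integrable_on gi A)
        show "((\<lambda>k. osc i c p (t - x) k * g c t) has_field_derivative osc (Suc i) c p (t - x) k' * g c t) (at k' within S)"
          if "k' \<in> S" for k' t
          by (intro DERIV_cmult_right has_field_derivative_at_within[OF osc_deriv[OF nz[OF that]]])
      qed (use A nz m b in auto)
      then show ?thesis unfolding S(4) .
    qed
    have contn: "continuous_on (region \<delta>) (osc_tail p g n c x)" if x: "0 \<le> x" for c x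
    proof -
      obtain D where D: "D \<ge> 0" "\<And>i c x t k'. i \<le> n \<Longrightarrow> 0 \<le> x \<Longrightarrow> x \<le> t \<Longrightarrow> k' \<in> region \<delta> \<Longrightarrow>
            norm (osc i c p (t - x) k' * g c t) \<le> D / norm k' ^ p * ((1 + t) ^ n * norm (g c t))"
        using main[OF \<delta>] by blast
      have nz: "k' \<noteq> 0" if "k' \<in> region \<delta>" for k' using \<delta> that by (auto simp: region_def)
      show ?thesis
        unfolding osc_tail_def[abs_def]
      proof (rule continuous_on_parametric_integral)
        show "(\<lambda>t. D / \<delta> ^ p * ((1 + t) ^ n * norm (g c t))) integrable_on {x..}"
          by (intro integrable_on_mult_right absolutely_integrable_on_imp_integrable_on gi x)
        show "norm (osc n c p (t - x) k * g c t) \<le> D / \<delta> ^ p * ((1 + t) ^ n * norm (g c t))"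
          if "k \<in> region \<delta>" "t \<in> {x..}" for k t
        proof -
          have "norm (osc n c p (t - x) k * g c t) \<le> D / norm k ^ p * ((1 + t) ^ n * norm (g c t))"
            using D(2)[OF order_refl x _ that(1)] that(2) by simp
          also have "\<dots> \<le> D / \<delta> ^ p * ((1 + t) ^ n * norm (g c t))"
            using D(1) \<delta> that x by (intro mult_right_mono frac_le power_mono) (auto simp: region_def)
          finally show ?thesis .
        qed
        fix t
        have "isCont (\<lambda>k. osc n c p (t - x) k * g c t) k" if "k \<in> region \<delta>" for k
          by (intro continuous_intros DERIV_isCont[OF osc_deriv[OF nz[OF that]]])
        then show "continuous_on (region \<delta>) (\<lambda>k. osc n c p (t - x) k * g c t)"
          by (intro continuous_at_imp_continuous_on ballI)
      qed (use x nz m in auto)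
    qed
    have contx: "continuous_on {0..} (\<lambda>x. osc_tail p g i c x k)" if A: "i \<le> n" "k \<in> region \<delta>" for i c k
    proof -
      obtain D where D: "D \<ge> 0" "\<And>i c x t k'. i \<le> n \<Longrightarrow> 0 \<le> x \<Longrightarrow> x \<le> t \<Longrightarrow> k' \<in> region \<delta> \<Longrightarrow>
            norm (osc i c p (t - x) k' * g c t) \<le> D / norm k' ^ p * ((1 + t) ^ n * norm (g c t))"
        using main[OF \<delta>] by blast
      have nz: "k \<noteq> 0" using \<delta> A by (auto simp: region_def)
      show ?thesis
        unfolding osc_tail_def
      proof (rule continuous_on_tail_integral)
        show "(\<lambda>t. D / norm k ^ p * ((1 + t) ^ n * norm (g c t))) integrable_on {0..}"
          by (intro integrable_on_mult_right absolutely_integrable_on_imp_integrable_on gi order_refl)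
        fix t :: real
        show "continuous_on {0..t} (\<lambda>x. osc i c p (t - x) k * g c t)"
          by (auto intro!: continuous_intros continuous_on_compose2[OF osc_continuous_t[OF nz, of UNIV]])
      qed (use nz m D A in auto)
    qed
    have "jet_family n (region \<delta>) (\<lambda>x. C / \<delta> ^ p) (osc_tail p g)"
    proof (rule jet_familyI)
      fix i c k and x :: real assume A: "i \<le> n" "0 \<le> x" "k \<in> region \<delta>"
      have "norm (osc_tail p g i c x k) \<le> C / norm k ^ p" by (rule C(2)[OF A])
      also have "\<dots> \<le> C / \<delta> ^ p"
        using A \<delta> C(1) by (intro frac_le power_mono) (auto simp: region_def)
      finally show "norm (osc_tail p g i c x k) \<le> C / \<delta> ^ p" .
    next
      fix i c k and x :: real assume A: "i < n" "0 \<le> x" "k \<in> region \<delta>"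
      show "(osc_tail p g i c x has_field_derivative osc_tail p g (Suc i) c x k) (at k within region \<delta>)"
        by (rule has_field_derivative_subset[OF der[OF A(1,2) punctured_region[OF \<delta> A(3)]]])
           (use punctured_region[OF \<delta>] in blast)
    qed (use contn contx in auto)
    then show "\<exists>B\<ge>0. jet_family n (region \<delta>) (\<lambda>x. B) (osc_tail p g)"
      using C(1) \<delta> by (intro exI[of _ "C / \<delta> ^ p"]) auto
  qed
qed

context scattering
begin

text \<open>The ansatz is \<open>\<Sum>l. p (Suc l) x / k ^ l\<close> for the first component and \<open>\<Sum>l. r (Suc l) x / k ^ l\<close> for the second one; the indices are shifted so
that the zero functions \<open>p 0\<close> and \<open>r 0\<close> can stand for the missing terms in the recursion. In the first equation the
phase contributes \<open>\<i> k / 2\<close>, so comparing coefficients determines \<open>p (Suc (Suc l))\<close> algebraically, through the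
derivative \<open>p' l\<close> of \<open>p (Suc l)\<close>. In the second equation the phase is \<open>0\<close>, so \<open>r (Suc (Suc l))\<close> is an integral from infinity.
Each step of the recursion consumes one derivative, and \<open>Suc m\<close> derivatives of the coefficients allow \<open>Suc m\<close> steps.\<close>

lemma formal_series:
  assumes q: "sobolev n (Suc m) q" and s: "sobolev n (Suc m) s" and \<kappa>: "sobolev n (Suc m) \<kappa>"
  obtains p r p' :: "nat \<Rightarrow> real \<Rightarrow> complex" where
    "p 0 = (\<lambda>x. 0)" "r 0 = (\<lambda>x. 0)" "p 1 = (\<lambda>x. 0)" "r 1 = (\<lambda>x. 1)"
    "\<And>l. l \<le> Suc m \<Longrightarrow> sobolev n (Suc (Suc m - l)) (p (Suc l))"
    "\<And>l. l \<le> Suc m \<Longrightarrow> multiplier n (Suc (Suc m - l)) (r (Suc l))"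
    "\<And>l. l \<le> Suc m \<Longrightarrow> sobolev n (Suc (Suc m - l)) (p l)"
    "\<And>l. l \<le> Suc m \<Longrightarrow> multiplier n (Suc (Suc m - l)) (r l)"
    "\<And>l. l \<le> Suc m \<Longrightarrow> prim (p (Suc l)) (p' l) \<and> weighted_L1 n (p' l)"
    "\<And>l x. l \<le> m \<Longrightarrow> p (Suc (Suc l)) x = p l x + 2 * \<i> * (p' l x + q x / 4 * r (Suc l) x
         - \<i> / 4 * (s x * r l x + \<kappa> x * p l x))"
    "\<And>l. l \<le> m \<Longrightarrow> weighted_L1 n (\<lambda>t. q t / 4 * p (Suc (Suc l)) t + \<i> / 4 * (s t * p (Suc l) t - \<kappa> t * r (Suc l) t)) \<and>
        r (Suc (Suc l)) = (\<lambda>x. - integral {x..} (\<lambda>t. q t / 4 * p (Suc (Suc l)) t + \<i> / 4 * (s t * p (Suc l) t - \<kappa> t * r (Suc l) t)))"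
proof -
  define good where "good = (\<lambda>l (P, Q, Pp, Qp). l \<le> Suc m \<longrightarrow>
      sobolev n (Suc (Suc m - l)) P \<and> multiplier n (Suc (Suc m - l)) Q \<and>
      sobolev n (Suc (Suc m - l)) Pp \<and> multiplier n (Suc (Suc m - l)) Qp)"
  define init :: "(real \<Rightarrow> complex) \<times> (real \<Rightarrow> complex) \<times> (real \<Rightarrow> complex) \<times> (real \<Rightarrow> complex)"
    where "init = (\<lambda>x. 0, \<lambda>x. 1, \<lambda>x. 0, \<lambda>x. 0)"
  \<comment> \<open>The recursion has two terms of memory: the state is \<open>(p (Suc l), r (Suc l), p l, r l)\<close>. The derivative of \<open>p (Suc l)\<close> is known
    to exist only by the invariant, so the sequence is built by dependent choice.\<close>
  define step where "step = (\<lambda>l (P, Q, Pp, Qp) (P2, Q2, Pp2, Qp2). Pp2 = P \<and> Qp2 = Q \<and>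
     (l \<le> m \<longrightarrow> (\<exists>P'. prim P P' \<and> weighted_L1 n P' \<and>
        (\<forall>x. P2 x = Pp x + 2 * \<i> * (P' x + q x / 4 * Q x - \<i> / 4 * (s x * Qp x + \<kappa> x * Pp x)))) \<and>
        weighted_L1 n (\<lambda>t. q t / 4 * P2 t + \<i> / 4 * (s t * P t - \<kappa> t * Q t)) \<and>
        Q2 = (\<lambda>x. - integral {x..} (\<lambda>t. q t / 4 * P2 t + \<i> / 4 * (s t * P t - \<kappa> t * Q t)))))"
  have "\<exists>st. \<forall>l. ((l = 0 \<longrightarrow> st l = init) \<and> good l (st l)) \<and> step l (st l) (st (Suc l))"
  proof (rule dependent_nat_choice)
    show "\<exists>z. (0 = 0 \<longrightarrow> z = init) \<and> good 0 z"
      unfolding good_def init_def by (auto simp del: sobolev.simps multiplier.simps intro: sobolev_zero multiplier_const)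
    fix z :: "(real \<Rightarrow> complex) \<times> (real \<Rightarrow> complex) \<times> (real \<Rightarrow> complex) \<times> (real \<Rightarrow> complex)"
      and l :: nat
    assume "(l = 0 \<longrightarrow> z = init) \<and> good l z"
    then have good: "good l z" by blast
    obtain P Q Pp Qp where z: "z = (P, Q, Pp, Qp)" by (cases z) auto
    show "\<exists>y. ((Suc l = 0 \<longrightarrow> y = init) \<and> good (Suc l) y) \<and> step l z y"
    proof (cases "l \<le> m")
      case False
      then show ?thesis
        unfolding z by (intro exI[of _ "(P, Q, P, Q)"]) (auto simp: good_def step_def)
    next
      case True
      define d where "d = m - l"
      have d: "Suc m - l = Suc d" "Suc m - Suc l = d" "d \<le> m" using True by (auto simp: d_def)
      have G: "sobolev n (Suc (Suc d)) P" "multiplier n (Suc (Suc d)) Q"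
         "sobolev n (Suc (Suc d)) Pp" "multiplier n (Suc (Suc d)) Qp"
        using good True unfolding good_def z d(1) by auto
      obtain P' where P': "prim P P'" "sobolev n (Suc d) P'" using G(1) by auto
      note lower = sobolev_SucD[OF G(1)] multiplier_SucD[OF G(2)] sobolev_SucD[OF G(3)] multiplier_SucD[OF G(4)]
      have qsk: "sobolev n (Suc d) q" "sobolev n (Suc d) s" "sobolev n (Suc d) \<kappa>"
        by (rule sobolev_mono[OF q] sobolev_mono[OF s] sobolev_mono[OF \<kappa>], use d(3) in simp)+
      define P2 where "P2 = (\<lambda>x. Pp x + 2 * \<i> * (P' x + (1/4 * (Q x * q x) + - \<i> / 4 * (Qp x * s x + \<kappa> x * Pp x))))"
      have P2: "sobolev n (Suc d) P2"
        unfolding P2_def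
        by (intro sobolev_add sobolev_cmult sobolev_mult sobolev_imp_multiplier lower qsk P')
      define h where "h = (\<lambda>t. 1/4 * (q t * P2 t) + \<i> / 4 * (P t * s t + -1 * (Q t * \<kappa> t)))"
      have h: "sobolev n (Suc d) h"
        unfolding h_def
        by (intro sobolev_add sobolev_cmult sobolev_mult sobolev_imp_multiplier lower qsk P2)
      have h': "h = (\<lambda>t. q t / 4 * P2 t + \<i> / 4 * (s t * P t - \<kappa> t * Q t))"
        unfolding h_def by (auto simp: algebra_simps)
      define Q2 where "Q2 = (\<lambda>x. - integral {x..} h)"
      have Q2: "multiplier n (Suc d) Q2"
        unfolding Q2_def by (rule multiplier_SucD[OF multiplier_tail[OF h]])
      have "good (Suc l) (P2, Q2, P, Q)"
        unfolding good_def d(2) using P2 Q2 lower by (simp del: sobolev.simps multiplier.simps)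
      moreover have "step l z (P2, Q2, P, Q)"
      proof -
        have e1: "P2 x = Pp x + 2 * \<i> * (P' x + q x / 4 * Q x - \<i> / 4 * (s x * Qp x + \<kappa> x * Pp x))" for x
          unfolding P2_def by (simp add: algebra_simps)
        have e2: "Q2 = (\<lambda>x. - integral {x..} (\<lambda>t. q t / 4 * P2 t + \<i> / 4 * (s t * P t - \<kappa> t * Q t)))"
          unfolding Q2_def h' ..
        have e3: "weighted_L1 n (\<lambda>t. q t / 4 * P2 t + \<i> / 4 * (s t * P t - \<kappa> t * Q t))"
          using sobolev_weighted_L1[OF h] unfolding h' .
        show ?thesis
          unfolding step_def z prod.case using P'(1) sobolev_weighted_L1[OF P'(2)] e1 e2 e3 by blast
      qed
      ultimately show ?thesis by blast
    qed
  qed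
  then obtain st where st: "st 0 = init" "\<And>l. good l (st l)" "\<And>l. step l (st l) (st (Suc l))" by blast
  define p where "p = (\<lambda>l. fst (snd (snd (st l))))"
  define r where "r = (\<lambda>l. snd (snd (snd (st l))))"
  have stl: "st l = (p (Suc l), r (Suc l), p l, r l)" for l
    using st(3)[of l] by (cases "st l"; cases "st (Suc l)") (auto simp: p_def r_def step_def)
  have good: "sobolev n (Suc (Suc m - l)) (p (Suc l)) \<and> multiplier n (Suc (Suc m - l)) (r (Suc l)) \<and>
      sobolev n (Suc (Suc m - l)) (p l) \<and> multiplier n (Suc (Suc m - l)) (r l)" if "l \<le> Suc m" for l
    using st(2)[of l] that unfolding stl good_def by simp
  have init: "p 1 = (\<lambda>x. 0)" "r 1 = (\<lambda>x. 1)" "p 0 = (\<lambda>x. 0)" "r 0 = (\<lambda>x. 0)"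
    using st(1) unfolding stl init_def by auto
  have step: "(\<exists>P'. prim (p (Suc l)) P' \<and> weighted_L1 n P' \<and>
        (\<forall>x. p (Suc (Suc l)) x = p l x + 2 * \<i> * (P' x + q x / 4 * r (Suc l) x - \<i> / 4 * (s x * r l x + \<kappa> x * p l x)))) \<and>
        weighted_L1 n (\<lambda>t. q t / 4 * p (Suc (Suc l)) t + \<i> / 4 * (s t * p (Suc l) t - \<kappa> t * r (Suc l) t)) \<and>
        r (Suc (Suc l)) = (\<lambda>x. - integral {x..} (\<lambda>t. q t / 4 * p (Suc (Suc l)) t + \<i> / 4 * (s t * p (Suc l) t - \<kappa> t * r (Suc l) t)))"
    if "l \<le> m" for l
    using st(3)[of l] that unfolding stl step_def by simp
  have "\<exists>P'. l \<le> Suc m \<longrightarrow> prim (p (Suc l)) P' \<and> weighted_L1 n P' \<and>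
        (l \<le> m \<longrightarrow> (\<forall>x. p (Suc (Suc l)) x = p l x + 2 * \<i> * (P' x + q x / 4 * r (Suc l) x - \<i> / 4 * (s x * r l x + \<kappa> x * p l x))))" for l
  proof (cases "l \<le> m")
    case True then show ?thesis using step[OF True] by blast
  next
    case False
    then show ?thesis
    proof (cases "l = Suc m")
      case True
      then obtain P' where "prim (p (Suc l)) P'" "sobolev n 0 P'" using good[of l] by auto
      then show ?thesis using False by auto
    qed auto
  qed
  then obtain p' where p': "\<And>l. l \<le> Suc m \<longrightarrow> prim (p (Suc l)) (p' l) \<and> weighted_L1 n (p' l) \<and>
        (l \<le> m \<longrightarrow> (\<forall>x. p (Suc (Suc l)) x = p l x + 2 * \<i> * (p' l x + q x / 4 * r (Suc l) x - \<i> / 4 * (s x * r l x + \<kappa> x * p l x))))"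
    by metis
  show ?thesis
  proof (rule that[OF init(3,4,1,2)])
    fix l assume l: "l \<le> Suc m"
    show "sobolev n (Suc (Suc m - l)) (p (Suc l))" "multiplier n (Suc (Suc m - l)) (r (Suc l))"
      "sobolev n (Suc (Suc m - l)) (p l)" "multiplier n (Suc (Suc m - l)) (r l)"
      using good[OF l] by blast+
    show "prim (p (Suc l)) (p' l) \<and> weighted_L1 n (p' l)" using p'[of l] l by blast
  next
    fix l x assume l: "l \<le> m"
    then show "p (Suc (Suc l)) x = p l x + 2 * \<i> * (p' l x + q x / 4 * r (Suc l) x
         - \<i> / 4 * (s x * r l x + \<kappa> x * p l x))"
      using p'[of l] le_SucI by blast
  next
    fix l assume l: "l \<le> m"
    show "weighted_L1 n (\<lambda>t. q t / 4 * p (Suc (Suc l)) t + \<i> / 4 * (s t * p (Suc l) t - \<kappa> t * r (Suc l) t)) \<and>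
        r (Suc (Suc l)) = (\<lambda>x. - integral {x..} (\<lambda>t. q t / 4 * p (Suc (Suc l)) t + \<i> / 4 * (s t * p (Suc l) t - \<kappa> t * r (Suc l) t)))"
      using step[OF l] by (elim conjE) (intro conjI)
  qed
qed

end

text \<open>The left side is the error of the truncated series in the first equation, with \<open>z = 1 / k\<close>. All orders below
\<open>M\<close> cancel by the recursion; what remains are the terms of order \<open>M\<close>, whose partner would be the
next coefficient, and the terms pushed beyond \<open>M\<close> by the factor \<open>z\<close>.\<close>

lemma residual_first:
  fixes p r :: "nat \<Rightarrow> complex" and z :: complex
  assumes z: "z \<noteq> 0" and init: "p 0 = 0" "r 0 = 0" "p 1 = 0"
    and rec: "\<And>l. l < M \<Longrightarrow> p (Suc (Suc l)) = p l + 2 * \<i> * (p' l + q / 4 * r (Suc l) - \<i> / 4 * (s * r l + \<kappa> * p l))"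
  shows "(\<Sum>l\<le>M. z ^ l * p' l) + (\<i> * (1 / z - z) / 2) * (\<Sum>l\<le>M. z ^ l * p (Suc l))
      + q / 4 * (\<Sum>l\<le>M. z ^ l * r (Suc l))
      - \<i> / 4 * z * (s * (\<Sum>l\<le>M. z ^ l * r (Suc l)) + \<kappa> * (\<Sum>l\<le>M. z ^ l * p (Suc l)))
    = z ^ M * (p' M + q / 4 * r (Suc M) - \<i> / 4 * (s * r M + \<kappa> * p M) - \<i> / 2 * p M)
      + z ^ Suc M * (- \<i> / 4 * (s * r (Suc M) + \<kappa> * p (Suc M)) - \<i> / 2 * p (Suc M))"
  using rec
proof (induction M)
  case 0
  show ?case using init by (simp add: algebra_simps)
next
  case (Suc M)
  let ?X = "p' M + q / 4 * r (Suc M) - \<i> / 4 * (s * r M + \<kappa> * p M)"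
  have r: "p (Suc (Suc M)) = p M + 2 * \<i> * ?X" using Suc.prems[of M] by simp
  have *: "?X - \<i> / 2 * p M + \<i> / 2 * p (Suc (Suc M)) = 0"
    unfolding r by (simp add: algebra_simps)
  define \<phi> where "\<phi> = \<i> * (1 / z - z) / 2"
  have **: "\<phi> * (z ^ Suc M * p (Suc (Suc M)))
     = z ^ M * (\<i> / 2 * p (Suc (Suc M))) - z ^ Suc (Suc M) * (\<i> / 2 * p (Suc (Suc M)))"
    using z unfolding \<phi>_def by (simp add: field_simps)
  define A B C where "A = (\<Sum>l\<le>M. z ^ l * p' l)" and "B = (\<Sum>l\<le>M. z ^ l * p (Suc l))"
    and "C = (\<Sum>l\<le>M. z ^ l * r (Suc l))"
  have IH: "A + \<phi> * B + q / 4 * C - \<i> / 4 * z * (s * C + \<kappa> * B)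
    = z ^ M * (?X - \<i> / 2 * p M)
      + z ^ Suc M * (- \<i> / 4 * (s * r (Suc M) + \<kappa> * p (Suc M)) - \<i> / 2 * p (Suc M))"
    using Suc.IH[OF Suc.prems] unfolding A_def B_def C_def \<phi>_def by simp
  have "(A + z ^ Suc M * p' (Suc M)) + \<phi> * (B + z ^ Suc M * p (Suc (Suc M)))
      + q / 4 * (C + z ^ Suc M * r (Suc (Suc M)))
      - \<i> / 4 * z * (s * (C + z ^ Suc M * r (Suc (Suc M))) + \<kappa> * (B + z ^ Suc M * p (Suc (Suc M))))
    = (A + \<phi> * B + q / 4 * C - \<i> / 4 * z * (s * C + \<kappa> * B)) + \<phi> * (z ^ Suc M * p (Suc (Suc M)))
      + z ^ Suc M * (p' (Suc M) + q / 4 * r (Suc (Suc M)))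
      - z ^ Suc (Suc M) * (\<i> / 4 * (s * r (Suc (Suc M)) + \<kappa> * p (Suc (Suc M))))"
    by (simp add: algebra_simps)
  also have "\<dots> = z ^ M * (?X - \<i> / 2 * p M + \<i> / 2 * p (Suc (Suc M)))
     + z ^ Suc M * (p' (Suc M) + q / 4 * r (Suc (Suc M)) - \<i> / 4 * (s * r (Suc M) + \<kappa> * p (Suc M)) - \<i> / 2 * p (Suc M))
     + z ^ Suc (Suc M) * (- \<i> / 4 * (s * r (Suc (Suc M)) + \<kappa> * p (Suc (Suc M))) - \<i> / 2 * p (Suc (Suc M)))"
    unfolding IH ** by (simp add: algebra_simps)
  finally show ?case unfolding * A_def B_def C_def \<phi>_def by simp
qed

text \<open>The same for the second equation. As the phase is \<open>0\<close> there, only the order \<open>Suc M\<close> remains.\<close>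

lemma residual_second:
  fixes p r r' :: "nat \<Rightarrow> complex" and z :: complex
  assumes init: "p 1 = 0" "r' 0 = 0"
    and rec: "\<And>l. l < M \<Longrightarrow> r' (Suc l) = q / 4 * p (Suc (Suc l)) + \<i> / 4 * (s * p (Suc l) - \<kappa> * r (Suc l))"
  shows "(\<Sum>l\<le>M. z ^ l * r' l) - q / 4 * (\<Sum>l\<le>M. z ^ l * p (Suc l))
      - \<i> / 4 * z * (s * (\<Sum>l\<le>M. z ^ l * p (Suc l)) - \<kappa> * (\<Sum>l\<le>M. z ^ l * r (Suc l)))
    = z ^ Suc M * (- \<i> / 4 * (s * p (Suc M) - \<kappa> * r (Suc M)))"
  using rec
proof (induction M)
  case 0
  show ?case using init by (simp add: algebra_simps)
next
  case (Suc M)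
  have r: "r' (Suc M) = q / 4 * p (Suc (Suc M)) + \<i> / 4 * (s * p (Suc M) - \<kappa> * r (Suc M))"
    using Suc.prems[of M] by simp
  define A B C where "A = (\<Sum>l\<le>M. z ^ l * r' l)" and "B = (\<Sum>l\<le>M. z ^ l * p (Suc l))"
    and "C = (\<Sum>l\<le>M. z ^ l * r (Suc l))"
  have IH: "A - q / 4 * B - \<i> / 4 * z * (s * B - \<kappa> * C) = z ^ Suc M * (- \<i> / 4 * (s * p (Suc M) - \<kappa> * r (Suc M)))"
    using Suc.IH[OF Suc.prems] unfolding A_def B_def C_def by simp
  define h where "h = \<i> / 4"
  have "(A + z ^ Suc M * r' (Suc M)) - q / 4 * (B + z ^ Suc M * p (Suc (Suc M)))
      - h * z * (s * (B + z ^ Suc M * p (Suc (Suc M))) - \<kappa> * (C + z ^ Suc M * r (Suc (Suc M))))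
    = (A - q / 4 * B - h * z * (s * B - \<kappa> * C)) + z ^ Suc M * (r' (Suc M) - q / 4 * p (Suc (Suc M)))
      + z ^ Suc (Suc M) * (- h * (s * p (Suc (Suc M)) - \<kappa> * r (Suc (Suc M))))"
    by (simp add: algebra_simps)
  also have "\<dots> = z ^ Suc (Suc M) * (- h * (s * p (Suc (Suc M)) - \<kappa> * r (Suc (Suc M))))"
    unfolding IH[folded h_def] r[folded h_def] h_def[symmetric] by (simp add: h_def algebra_simps)
  finally show ?case unfolding A_def B_def C_def h_def by simp
qed

section \<open>Expansion at infinity\<close>

text \<open>The value of the second column at infinity.\<close>

definition unit2 :: "2 \<Rightarrow> complex" where "unit2 c = (if c = 2 then 1 else 0)"

lemma unit2_simps [simp]: "unit2 1 = 0" "unit2 2 = 1"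
  by (simp_all add: unit2_def)

lemma osc_power: "osc 0 c p 0 k = 1 / k ^ p"
  by (simp add: osc_0)

context scattering
begin

text \<open>The second column of \<open>X\<close> and its derivatives in \<open>k\<close>; it corresponds to a Jost solution in scattering theory.\<close>

definition jost :: "nat \<Rightarrow> 2 \<Rightarrow> real \<Rightarrow> complex \<Rightarrow> complex" where
  "jost = volterra_sol kern (\<lambda>i c x k. if i = 0 then unit2 c else 0)"

lemma jost_solves: "k \<in> punctured_upper \<Longrightarrow> solves (\<lambda>c x. unit2 c) k (\<lambda>c x. jost 0 c x k)"
  using solution_solves[OF const_forcing[of n unit2]] unfolding jost_def by simp

lemma solves_cong:
  assumes y: "solves f k y" and fg: "\<And>c x. 0 \<le> x \<Longrightarrow> f c x = g c x"
  shows "solves g k y"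
  unfolding solves_def
proof (intro conjI allI impI)
  show "continuous_on {0..} (y c)" "bounded (y c ` {0..})" for c using y unfolding solves_def by blast+
  fix c and x :: real assume x: "0 \<le> x"
  have "y c x = f c x - integral {x..} (\<lambda>t. exp (of_real (t - x) * phase c k) * rhs k y c t)"
    using y x unfolding solves_def by blast
  then show "y c x = g c x - integral {x..} (\<lambda>t. exp (of_real (t - x) * phase c k) * rhs k y c t)"
    unfolding fg[OF x] .
qed

lemma rhs_components:
  "rhs k y 1 t = - q t / 4 * y 2 t + \<i> / 4 * (\<kappa> t * y 1 t + s t * y 2 t) / k"
  "rhs k y 2 t = q t / 4 * y 1 t + \<i> / 4 * (s t * y 1 t - \<kappa> t * y 2 t) / k"
  unfolding rhs_def pot_def coefA_def coefB_def sum_2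
  by (simp_all add: algebra_simps add_divide_distrib diff_divide_distrib)

text \<open>An approximate solution \<open>F\<close> with the right behaviour at infinity satisfies the Volterra equation up to the
integrated error, so the difference to the true solution satisfies the same equation with that error as forcing.\<close>

lemma solves_of_residual:
  assumes k: "k \<in> punctured_upper"
    and F: "\<And>c. prim (F c) (\<lambda>t. - phase c k * F c t + (rhs k F c t + \<rho> c t))"
    and Fb: "\<And>c. bounded (F c ` {0..})" and lim: "\<And>c. (F c \<longlongrightarrow> unit2 c) at_top"
    and \<rho>: "\<And>c. \<rho> c absolutely_integrable_on {0..}"
  shows "solves (\<lambda>c x. integral {x..} (\<lambda>t. exp (of_real (t - x) * phase c k) * \<rho> c t)) k (\<lambda>c x. jost 0 c x k - F c x)"
proof -
  have k0: "k \<noteq> 0" using k by auto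
  have Re: "Re (phase c k) \<le> 0" for c using k by (intro phase_Re) auto
  have V: "continuous_on {0..} (\<lambda>x. jost 0 c x k)" "bounded ((\<lambda>x. jost 0 c x k) ` {0..})" for c
    using jost_solves[OF k] unfolding solves_def by blast+
  have Fc: "continuous_on {0..} (F c)" for c by (rule prim_continuous[OF F])
  have RF: "rhs k F c absolutely_integrable_on {0..}" for c by (rule rhs_integrable(1)[OF k0 Fc Fb])
  have RV: "rhs k (\<lambda>c x. jost 0 c x k) c absolutely_integrable_on {0..}" for c
    by (rule rhs_integrable(1)[OF k0 V])
  have eqF: "F c x = unit2 c - integral {x..} (\<lambda>t. exp (of_real (t - x) * phase c k) * (rhs k F c t + \<rho> c t))"
    if "0 \<le> x" for c x
  proof (rule prim_imp_volterra[OF F _ Re lim _ that])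
    show "(\<lambda>t. rhs k F c t + \<rho> c t) absolutely_integrable_on {0..}" by (intro set_integral_add(1) RF \<rho>)
    show "phase c k = 0 \<or> unit2 c = 0" by (simp add: phase_def unit2_def)
  qed
  have eqV: "jost 0 c x k = unit2 c - integral {x..} (\<lambda>t. exp (of_real (t - x) * phase c k) * rhs k (\<lambda>c x. jost 0 c x k) c t)"
    if "0 \<le> x" for c x
    using jost_solves[OF k] that unfolding solves_def by blast
  have lin: "rhs k (\<lambda>c x. jost 0 c x k - F c x) c t = rhs k (\<lambda>c x. jost 0 c x k) c t - rhs k F c t" for c t
    unfolding rhs_def by (simp add: algebra_simps sum_subtractf)
  show ?thesis
    unfolding solves_def
  proof (intro conjI allI impI)
    show "continuous_on {0..} (\<lambda>x. jost 0 c x k - F c x)" for c by (intro continuous_intros V Fc)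
    show "bounded ((\<lambda>x. jost 0 c x k - F c x) ` {0..})" for c
      by (rule bounded_minus_comp[OF V(2) Fb])
    fix c and x :: real assume x: "0 \<le> x"
    define E where "E = (\<lambda>t. exp (of_real (t - x) * phase c k))"
    have Et: "exp (of_real (t - x) * phase c k) = E t" for t by (simp add: E_def)
    have I: "(\<lambda>t. E t * rhs k F c t) integrable_on {x..}" "(\<lambda>t. E t * \<rho> c t) integrable_on {x..}"
      "(\<lambda>t. E t * rhs k (\<lambda>c x. jost 0 c x k) c t) integrable_on {x..}"
      unfolding E_def by (intro absolutely_integrable_on_imp_integrable_on exp_mult_integrable RF RV \<rho> Re x)+
    have 1: "integral {x..} (\<lambda>t. E t * (rhs k F c t + \<rho> c t))
       = integral {x..} (\<lambda>t. E t * rhs k F c t) + integral {x..} (\<lambda>t. E t * \<rho> c t)"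
      unfolding distrib_left by (rule integral_add[OF I(1,2)])
    have 2: "integral {x..} (\<lambda>t. E t * rhs k (\<lambda>c x. jost 0 c x k - F c x) c t)
       = integral {x..} (\<lambda>t. E t * rhs k (\<lambda>c x. jost 0 c x k) c t) - integral {x..} (\<lambda>t. E t * rhs k F c t)"
      unfolding lin right_diff_distrib by (rule integral_diff[OF I(3,1)])
    show "jost 0 c x k - F c x = integral {x..} (\<lambda>t. exp (of_real (t - x) * phase c k) * \<rho> c t) -
       integral {x..} (\<lambda>t. exp (of_real (t - x) * phase c k) * rhs k (\<lambda>c x. jost 0 c x k - F c x) c t)"
      unfolding Et 2 eqV[OF x, unfolded Et] eqF[OF x, unfolded Et] 1 by simp
  qed
qed

text \<open>The formal series is truncated after the order \<open>m + 1\<close>, one more than is asked for, so that the error in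
the differential equation is of order \<open>m + 1\<close> as well. The last term of the series then belongs to the remainder.\<close>

theorem expansion_at_infinity:
  assumes q: "sobolev n (Suc m) q" and s: "sobolev n (Suc m) s" and \<kappa>: "sobolev n (Suc m) \<kappa>"
  obtains A :: "nat \<Rightarrow> 2 \<Rightarrow> complex" and R :: "nat \<Rightarrow> 2 \<Rightarrow> complex \<Rightarrow> complex" and C :: real where
    "\<And>c k. k \<in> punctured_upper \<Longrightarrow> jost 0 c 0 k = unit2 c + (\<Sum>l=1..m. A l c / k ^ l) + R 0 c k"
    "\<And>i c k. i < n \<Longrightarrow> k \<in> punctured_upper \<Longrightarrow> (R i c has_field_derivative R (Suc i) c k) (at k within punctured_upper)"
    "\<And>i c k. i \<le> n \<Longrightarrow> k \<in> region 1 \<Longrightarrow> norm (R i c k) \<le> C / norm k ^ Suc m"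
proof -
  obtain p r p' where pr: "p 0 = (\<lambda>x. 0)" "r 0 = (\<lambda>x. 0)" "p 1 = (\<lambda>x. 0)" "r 1 = (\<lambda>x. 1)"
    and p_sob: "\<And>l. l \<le> Suc m \<Longrightarrow> sobolev n (Suc (Suc m - l)) (p (Suc l))"
    and r_mul: "\<And>l. l \<le> Suc m \<Longrightarrow> multiplier n (Suc (Suc m - l)) (r (Suc l))"
    and p_sob': "\<And>l. l \<le> Suc m \<Longrightarrow> sobolev n (Suc (Suc m - l)) (p l)"
    and r_mul': "\<And>l. l \<le> Suc m \<Longrightarrow> multiplier n (Suc (Suc m - l)) (r l)"
    and p': "\<And>l. l \<le> Suc m \<Longrightarrow> prim (p (Suc l)) (p' l) \<and> weighted_L1 n (p' l)"
    and p_rec: "\<And>l x. l \<le> m \<Longrightarrow> p (Suc (Suc l)) x = p l x + 2 * \<i> * (p' l x + q x / 4 * r (Suc l) x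
         - \<i> / 4 * (s x * r l x + \<kappa> x * p l x))"
    and r_rec: "\<And>l. l \<le> m \<Longrightarrow> weighted_L1 n (\<lambda>t. q t / 4 * p (Suc (Suc l)) t + \<i> / 4 * (s t * p (Suc l) t - \<kappa> t * r (Suc l) t)) \<and>
        r (Suc (Suc l)) = (\<lambda>x. - integral {x..} (\<lambda>t. q t / 4 * p (Suc (Suc l)) t + \<i> / 4 * (s t * p (Suc l) t - \<kappa> t * r (Suc l) t)))"
    by (rule formal_series[OF q s \<kappa>]) (rule that; assumption)
  define M where "M = Suc m"
  \<comment> \<open>The derivative of \<open>r (Suc l)\<close>, which is constant for \<open>l = 0\<close>.\<close>
  define r' where "r' = (\<lambda>l. case l of 0 \<Rightarrow> (\<lambda>t. 0) | Suc l \<Rightarrow>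
      (\<lambda>t. q t / 4 * p (Suc (Suc l)) t + \<i> / 4 * (s t * p (Suc l) t - \<kappa> t * r (Suc l) t)))"
  have r': "prim (r (Suc l)) (r' l)" "(r (Suc l) \<longlongrightarrow> (if l = 0 then 1 else 0)) at_top" if "l \<le> M" for l
  proof -
    have "prim (r (Suc l)) (r' l) \<and> (r (Suc l) \<longlongrightarrow> (if l = 0 then 1 else 0)) at_top"
    proof (cases l)
      case 0
      then show ?thesis using pr(4) prim_const[of "1::complex"] by (simp add: r'_def)
    next
      case (Suc j)
      then have "j \<le> m" using that by (simp add: M_def)
      note rr = r_rec[OF this, THEN conjunct1, THEN weighted_L1_imp_L1] r_rec[OF this, THEN conjunct2]
      show ?thesis unfolding Suc r'_def nat.case rr(2)
        using prim_tail[OF rr(1)] tendsto_minus[OF tail_integral_tendsto_0[OF rr(1)]] by simp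
    qed
    then show "prim (r (Suc l)) (r' l)" "(r (Suc l) \<longlongrightarrow> (if l = 0 then 1 else 0)) at_top" by blast+
  qed
  define S where "S = (\<lambda>c::2. if c = 1 then p else r)"
  define S' where "S' = (\<lambda>c::2. if c = 1 then p' else r')"
  have Sprim: "prim (S c (Suc l)) (S' c l)" if "l \<le> M" for c l
    using p' r' that by (auto simp: S_def S'_def M_def)
  have Sbdd: "bounded (S c (Suc l) ` {0..})" if "l \<le> M" for c l
  proof -
    have "multiplier n (Suc (Suc m - l)) (S c (Suc l))"
      using sobolev_imp_multiplier[OF p_sob] r_mul that unfolding S_def M_def by metis
    then show ?thesis using multiplier_Suc by blast
  qed
  have Slim: "(S c (Suc l) \<longlongrightarrow> (if l = 0 then unit2 c else 0)) at_top" if "l \<le> M" for c l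
  proof (cases "c = 1")
    case True
    then show ?thesis using sobolev_Suc_tendsto_0[OF p_sob] that by (simp add: S_def M_def)
  next
    case False
    then have "c = 2" using exhaust_2[of c] by simp
    then show ?thesis using r'(2)[OF that] by (cases "l = 0") (simp_all add: S_def)
  qed
  \<comment> \<open>The error of the truncated series is \<open>g0 / k ^ M + g1 / k ^ Suc M\<close>.\<close>
  define g0 where "g0 = (\<lambda>(c::2) t. if c = 1 then p' M t + q t / 4 * r (Suc M) t
      - \<i> / 4 * (s t * r M t + \<kappa> t * p M t) - \<i> / 2 * p M t else 0)"
  define g1 where "g1 = (\<lambda>(c::2) t. if c = 1 then - \<i> / 4 * (s t * r (Suc M) t + \<kappa> t * p (Suc M) t)
      - \<i> / 2 * p (Suc M) t else - \<i> / 4 * (s t * p (Suc M) t - \<kappa> t * r (Suc M) t))"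
  have MS: "Suc m - M = 0" "M \<le> Suc m" by (simp_all add: M_def)
  have P0: "sobolev n (Suc 0) (p M)" "sobolev n (Suc 0) (p (Suc M))" "multiplier n (Suc 0) (r M)" "multiplier n (Suc 0) (r (Suc M))"
    using p_sob[OF MS(2)] p_sob'[OF MS(2)] r_mul[OF MS(2)] r_mul'[OF MS(2)] unfolding MS(1) by blast+
  have p'M: "sobolev n 0 (p' M)" using p'[OF MS(2)] by simp
  note lev0 = sobolev_SucD[OF P0(1)] sobolev_SucD[OF P0(2)] multiplier_SucD[OF P0(3)] multiplier_SucD[OF P0(4)]
    multiplier_SucD[OF sobolev_imp_multiplier[OF P0(1)]] multiplier_SucD[OF sobolev_imp_multiplier[OF P0(2)]]
  have qsk0: "sobolev n 0 q" "sobolev n 0 s" "sobolev n 0 \<kappa>"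
    using sobolev_mono[OF q le0] sobolev_mono[OF s le0] sobolev_mono[OF \<kappa> le0] .
  have g0: "weighted_L1 n (g0 c)" for c
  proof -
    have "sobolev n 0 (\<lambda>t. p' M t + (1/4 * (r (Suc M) t * q t) + (- \<i> / 4 * (r M t * s t + p M t * \<kappa> t) + - \<i> / 2 * p M t)))"
      by (intro sobolev_add sobolev_cmult sobolev_mult p'M lev0 qsk0)
    moreover have "g0 1 = (\<lambda>t. p' M t + (1/4 * (r (Suc M) t * q t) + (- \<i> / 4 * (r M t * s t + p M t * \<kappa> t) + - \<i> / 2 * p M t)))"
      by (auto simp: g0_def algebra_simps)
    ultimately have "weighted_L1 n (g0 1)" by simp
    moreover have "weighted_L1 n (g0 2)" using sobolev_zero[of n 0] by (simp add: g0_def)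
    ultimately show ?thesis using exhaust_2[of c] by metis
  qed
  have g1: "weighted_L1 n (g1 c)" for c
  proof -
    have "sobolev n 0 (\<lambda>t. - \<i> / 4 * (r (Suc M) t * s t + p (Suc M) t * \<kappa> t) + - \<i> / 2 * p (Suc M) t)"
      "sobolev n 0 (\<lambda>t. - \<i> / 4 * (p (Suc M) t * s t + -1 * (r (Suc M) t * \<kappa> t)))"
      by (intro sobolev_add sobolev_cmult sobolev_mult lev0 qsk0)+
    moreover have "g1 1 = (\<lambda>t. - \<i> / 4 * (r (Suc M) t * s t + p (Suc M) t * \<kappa> t) + - \<i> / 2 * p (Suc M) t)"
      "g1 2 = (\<lambda>t. - \<i> / 4 * (p (Suc M) t * s t + -1 * (r (Suc M) t * \<kappa> t)))"
      by (auto simp: g1_def algebra_simps)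
    ultimately have "weighted_L1 n (g1 1)" "weighted_L1 n (g1 2)" by simp_all
    then show ?thesis using exhaust_2[of c] by metis
  qed
  define fr where "fr = (\<lambda>i c x k. osc_tail M g0 i c x k + osc_tail (Suc M) g1 i c x k)"
  have fr: "forcing n fr"
    unfolding fr_def by (rule forcing_add[OF osc_tail_facts(2)[OF g0] osc_tail_facts(2)[OF g1]])
  define A where "A = (\<lambda>l c. S c (Suc l) 0)"
  \<comment> \<open>As \<open>phase 2 = 0\<close>, the function \<open>osc i 2 M 0\<close> is the derivative of order \<open>i\<close> of \<open>1 / k ^ M\<close>.\<close>
  define R where "R = (\<lambda>i c k. A M c * osc i 2 M 0 k + volterra_sol kern fr i c 0 k)"
  have main: "jost 0 c 0 k = unit2 c + (\<Sum>l=1..m. A l c / k ^ l) + R 0 c k" if k: "k \<in> punctured_upper" for c k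
  proof -
    have k0: "k \<noteq> 0" using k by auto
    define z where "z = 1 / k"
    have z: "z \<noteq> 0" "1 / z = k" using k0 by (simp_all add: z_def)
    define F where "F = (\<lambda>c x. \<Sum>l\<le>M. z ^ l * S c (Suc l) x)"
    define \<rho> where "\<rho> = (\<lambda>c t. z ^ M * g0 c t + z ^ Suc M * g1 c t)"
    have Fprim: "prim (F c) (\<lambda>t. \<Sum>l\<le>M. z ^ l * S' c l t)" for c
      unfolding F_def by (intro prim_sum prim_cmult Sprim) simp
    have ode: "(\<Sum>l\<le>M. z ^ l * S' c l t) = - phase c k * F c t + (rhs k F c t + \<rho> c t)" for c t
    proof (cases "c = 1")
      case True
      have "(\<Sum>l\<le>M. z ^ l * p' l t) + (\<i> * (1 / z - z) / 2) * (\<Sum>l\<le>M. z ^ l * p (Suc l) t)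
        + q t / 4 * (\<Sum>l\<le>M. z ^ l * r (Suc l) t)
        - \<i> / 4 * z * (s t * (\<Sum>l\<le>M. z ^ l * r (Suc l) t) + \<kappa> t * (\<Sum>l\<le>M. z ^ l * p (Suc l) t))
        = z ^ M * g0 1 t + z ^ Suc M * g1 1 t"
        unfolding g0_def g1_def if_P[OF refl]
        by (rule residual_first[of z "\<lambda>l. p l t" "\<lambda>l. r l t" M "\<lambda>l. p' l t", OF z(1)]) (use pr p_rec in \<open>auto simp: M_def\<close>)
      then have A1: "(\<Sum>l\<le>M. z ^ l * p' l t) + (\<i> * (k - z) / 2) * F 1 t
        + q t / 4 * F 2 t - \<i> / 4 * z * (s t * F 2 t + \<kappa> t * F 1 t) = \<rho> 1 t"
        by (simp add: F_def S_def \<rho>_def z(2))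
      have B1: "rhs k F 1 t = - q t / 4 * F 2 t + \<i> / 4 * z * (s t * F 2 t + \<kappa> t * F 1 t)"
        unfolding rhs_components z_def by (simp add: add.commute)
      have C1: "phase 1 k = \<i> * (k - z) / 2" by (simp add: phase_def z_def)
      show ?thesis unfolding True A1[symmetric] B1 C1 by (simp add: S'_def)
    next
      case False
      then have c: "c = 2" using exhaust_2[of c] by simp
      have "(\<Sum>l\<le>M. z ^ l * r' l t) - q t / 4 * (\<Sum>l\<le>M. z ^ l * p (Suc l) t)
        - \<i> / 4 * z * (s t * (\<Sum>l\<le>M. z ^ l * p (Suc l) t) - \<kappa> t * (\<Sum>l\<le>M. z ^ l * r (Suc l) t))
        = z ^ Suc M * g1 2 t"
        using residual_second[of "\<lambda>l. p l t" "\<lambda>l. r' l t" M "q t" "s t" "\<kappa> t" "\<lambda>l. r l t" z] pr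
        by (simp add: g1_def r'_def)
      then have A2: "(\<Sum>l\<le>M. z ^ l * r' l t) - q t / 4 * F 1 t
        - \<i> / 4 * z * (s t * F 1 t - \<kappa> t * F 2 t) = \<rho> 2 t"
        by (simp add: F_def S_def \<rho>_def g0_def)
      have B2: "rhs k F 2 t = q t / 4 * F 1 t + \<i> / 4 * z * (s t * F 1 t - \<kappa> t * F 2 t)"
        unfolding rhs_components z_def by simp
      have C2: "phase 2 k = 0" by (simp add: phase_def)
      show ?thesis unfolding c A2[symmetric] B2 C2 by (simp add: S'_def)
    qed
    have Fprim': "prim (F c) (\<lambda>t. - phase c k * F c t + (rhs k F c t + \<rho> c t))" for c
      using Fprim[of c] unfolding ode .
    have Fb: "bounded (F c ` {0..})" for c
    proof -
      have "\<exists>B. \<forall>x\<ge>0. norm (S c (Suc l) x) \<le> B" if "l \<le> M" for l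
        using Sbdd[OF that, of c] by (auto simp: bounded_iff)
      then obtain B where B: "\<And>l x. l \<le> M \<Longrightarrow> x \<ge> 0 \<Longrightarrow> norm (S c (Suc l) x) \<le> B l" by metis
      have "norm (F c x) \<le> (\<Sum>l\<le>M. norm z ^ l * B l)" if "x \<ge> 0" for x
        unfolding F_def by (rule sum_norm_le) (use B that in \<open>auto simp: norm_mult norm_power intro!: mult_left_mono\<close>)
      then show ?thesis by (auto simp: bounded_iff)
    qed
    have Flim: "(F c \<longlongrightarrow> unit2 c) at_top" for c
    proof -
      have "(F c \<longlongrightarrow> (\<Sum>l\<le>M. z ^ l * (if l = 0 then unit2 c else 0))) at_top"
        unfolding F_def by (intro tendsto_sum tendsto_mult tendsto_const Slim) simp
      moreover have "(\<Sum>l\<le>M. z ^ l * (if l = 0 then unit2 c else 0)) = unit2 c"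
        by (subst sum.atMost_shift) simp
      ultimately show ?thesis by simp
    qed
    have \<rho>i: "\<rho> c absolutely_integrable_on {0..}" for c
      unfolding \<rho>_def
      by (intro set_integral_add(1) set_integrable_mult_right weighted_L1_imp_L1[OF g0] weighted_L1_imp_L1[OF g1])
    have Re: "Re (phase c k) \<le> 0" for c using k by (intro phase_Re) auto
    have fr0: "fr 0 c x k = integral {x..} (\<lambda>t. exp (of_real (t - x) * phase c k) * \<rho> c t)" if "0 \<le> x" for c x
    proof -
      have I: "(\<lambda>t. exp (of_real (t - x) * phase c k) * (z ^ M * g0 c t)) integrable_on {x..}"
        "(\<lambda>t. exp (of_real (t - x) * phase c k) * (z ^ Suc M * g1 c t)) integrable_on {x..}"
        by (intro absolutely_integrable_on_imp_integrable_on exp_mult_integrable Re that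
             set_integrable_mult_right weighted_L1_imp_L1[OF g0] weighted_L1_imp_L1[OF g1])+
      show ?thesis
        unfolding \<rho>_def distrib_left integral_add[OF I]
        by (simp add: fr_def osc_tail_def osc_0 z_def power_one_over divide_inverse mult_ac power_inverse)
    qed
    have s1: "solves (\<lambda>c x. integral {x..} (\<lambda>t. exp (of_real (t - x) * phase c k) * \<rho> c t)) k (\<lambda>c x. jost 0 c x k - F c x)"
      by (rule solves_of_residual[OF k Fprim' Fb Flim \<rho>i])
    have s2: "solves (\<lambda>c x. integral {x..} (\<lambda>t. exp (of_real (t - x) * phase c k) * \<rho> c t)) k (\<lambda>c x. volterra_sol kern fr 0 c x k)"
      by (rule solves_cong[OF solution_solves[OF fr k] fr0])
    have "jost 0 c 0 k = F c 0 + volterra_sol kern fr 0 c 0 k"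
      using solves_unique[OF s1 s2 k order_refl, of c] by (simp add: algebra_simps)
    also have "F c 0 = unit2 c + (\<Sum>l=1..m. A l c / k ^ l) + A M c * osc 0 2 M 0 k"
    proof -
      have A0: "A 0 c = unit2 c" using pr exhaust_2[of c] by (auto simp: A_def S_def)
      have "F c 0 = (\<Sum>l\<le>Suc m. A l c / k ^ l)"
        unfolding F_def A_def M_def z_def by (rule sum.cong) (simp_all add: power_one_over)
      also have "\<dots> = A 0 c + (\<Sum>l=1..m. A l c / k ^ l) + A (Suc m) c / k ^ Suc m"
        by (simp add: atMost_atLeast0 sum.atLeast_Suc_atMost)
      finally show ?thesis by (simp add: A0 M_def osc_power)
    qed
    finally show ?thesis by (simp add: R_def)
  qed
  obtain C1 where C1: "C1 \<ge> 0" "\<And>i c p t k. i \<le> n \<Longrightarrow> p \<le> M \<Longrightarrow> 0 \<le> t \<Longrightarrow> 0 \<le> Im k \<Longrightarrow> 1 \<le> norm k \<Longrightarrow>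
            norm (osc i c p t k) \<le> C1 * (1 + t) ^ n / norm k ^ p"
    using osc_uniform_bound[of 1 n M] by auto
  obtain C2 where C2: "C2 \<ge> 0" "\<And>i c x k. i \<le> n \<Longrightarrow> 0 \<le> x \<Longrightarrow> k \<in> region 1 \<Longrightarrow>
            norm (osc_tail M g0 i c x k) \<le> C2 / norm k ^ M"
    using osc_tail_facts(1)[where g=g0 and n=n and p=M, OF g0 zero_less_one] by blast
  obtain C3 where C3: "C3 \<ge> 0" "\<And>i c x k. i \<le> n \<Longrightarrow> 0 \<le> x \<Longrightarrow> k \<in> region 1 \<Longrightarrow>
            norm (osc_tail (Suc M) g1 i c x k) \<le> C3 / norm k ^ Suc M"
    using osc_tail_facts(1)[where g=g1 and n=n and p="Suc M", OF g1 zero_less_one] by blast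
  obtain C4 where C4: "C4 \<ge> 0" "\<And>f B k i c x. forcing n f \<Longrightarrow> k \<in> region 1 \<Longrightarrow> B \<ge> 0 \<Longrightarrow>
      (\<And>i c x. i \<le> n \<Longrightarrow> 0 \<le> x \<Longrightarrow> norm (f i c x k) \<le> B) \<Longrightarrow>
      i \<le> n \<Longrightarrow> 0 \<le> x \<Longrightarrow> norm (volterra_sol kern f i c x k) \<le> C4 * B"
    using solution_jet_bound[of 1] zero_less_one by metis
  define CA where "CA = norm (A M 1) + norm (A M 2)"
  show ?thesis
  proof (rule that[of A R "CA * C1 + C4 * (C2 + C3)"])
    show "jost 0 c 0 k = unit2 c + (\<Sum>l=1..m. A l c / k ^ l) + R 0 c k" if "k \<in> punctured_upper" for c k
      by (rule main[OF that])
    show "(R i c has_field_derivative R (Suc i) c k) (at k within punctured_upper)"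
      if "i < n" "k \<in> punctured_upper" for i c k
      unfolding R_def
      by (intro DERIV_add DERIV_cmult has_field_derivative_at_within[OF osc_deriv] solution_jets(1)[OF fr order_refl that])
         (use that in auto)
    show "norm (R i c k) \<le> (CA * C1 + C4 * (C2 + C3)) / norm k ^ Suc m"
      if i: "i \<le> n" and k: "k \<in> region 1" for i c k
    proof -
      have k1: "norm k \<ge> 1" "Im k \<ge> 0" using k by (auto simp: region_def)
      have "norm (osc i 2 M 0 k) \<le> C1 / norm k ^ M" using C1(2)[OF i order_refl order_refl k1(2,1)] by simp
      moreover have "norm (A M c) \<le> CA" using exhaust_2[of c] by (auto simp: CA_def)
      ultimately have "norm (A M c * osc i 2 M 0 k) \<le> CA * (C1 / norm k ^ M)"
        unfolding norm_mult by (intro mult_mono) (auto simp: CA_def)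
      moreover have "norm (volterra_sol kern fr i c 0 k) \<le> C4 * ((C2 + C3) / norm k ^ M)"
      proof (rule C4(2)[OF fr k _ _ i order_refl])
        show "0 \<le> (C2 + C3) / norm k ^ M" using C2 C3 by simp
        fix i c and x :: real assume ix: "i \<le> n" "0 \<le> x"
        have "norm k ^ M \<le> norm k ^ Suc M" using k1 by (intro power_increasing) auto
        then have "C3 / norm k ^ Suc M \<le> C3 / norm k ^ M"
          using C3(1) less_le_trans[OF zero_less_one k1(1)]
          by (intro divide_left_mono mult_pos_pos zero_less_power)
        then show "norm (fr i c x k) \<le> (C2 + C3) / norm k ^ M"
          unfolding fr_def add_divide_distrib
          using C2(2)[OF ix k, of c] C3(2)[OF ix k, of c] by (intro norm_triangle_le add_mono) auto
      qed
      ultimately have "norm (R i c k) \<le> CA * (C1 / norm k ^ M) + C4 * ((C2 + C3) / norm k ^ M)"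
        unfolding R_def by (intro norm_triangle_le add_mono)
      also have "\<dots> = (CA * C1 + C4 * (C2 + C3)) / norm k ^ Suc m"
        by (simp add: M_def add_divide_distrib distrib_left)
      finally show ?thesis .
    qed
  qed
qed

end

section \<open>Symmetries\<close>

context scattering
begin

lemma jost_prim:
  assumes k: "k \<in> punctured_upper"
  shows "prim (\<lambda>x. jost 0 c x k) (\<lambda>t. - phase c k * jost 0 c t k + rhs k (\<lambda>c x. jost 0 c x k) c t)"
    and "((\<lambda>x. jost 0 c x k) \<longlongrightarrow> unit2 c) at_top"
    and "bounded ((\<lambda>x. jost 0 c x k) ` {0..})"
proof -
  have k0: "k \<noteq> 0" using k by auto
  have V: "continuous_on {0..} (\<lambda>x. jost 0 c x k)" "bounded ((\<lambda>x. jost 0 c x k) ` {0..})" for c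
    using jost_solves[OF k] unfolding solves_def by blast+
  have eqV: "jost 0 c x k = unit2 c - integral {x..} (\<lambda>t. exp (of_real (t - x) * phase c k) * rhs k (\<lambda>c x. jost 0 c x k) c t)"
    if "0 \<le> x" for x
    using jost_solves[OF k] that unfolding solves_def by blast
  have R: "rhs k (\<lambda>c x. jost 0 c x k) c absolutely_integrable_on {0..}"
    by (rule rhs_integrable(1)[OF k0 V])
  have Re: "Re (phase c k) \<le> 0" using k by (intro phase_Re) auto
  have L: "phase c k = 0 \<or> unit2 c = 0" by (simp add: phase_def unit2_def)
  show "prim (\<lambda>x. jost 0 c x k) (\<lambda>t. - phase c k * jost 0 c t k + rhs k (\<lambda>c x. jost 0 c x k) c t)"
    by (rule volterra_imp_prim(1)[OF eqV R Re L])
  show "((\<lambda>x. jost 0 c x k) \<longlongrightarrow> unit2 c) at_top"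
    by (rule volterra_imp_prim(2)[OF eqV R Re L])
  show "bounded ((\<lambda>x. jost 0 c x k) ` {0..})" by (rule V(2))
qed

text \<open>The differential equation, boundedness and the limit at infinity characterise the solution. The symmetries below are
easier to verify in this form than for the integral equation.\<close>

lemma jost_unique:
  assumes k: "k \<in> punctured_upper"
    and y: "\<And>c. prim (y c) (\<lambda>t. - phase c k * y c t + rhs k y c t)"
    and b: "\<And>c. bounded (y c ` {0..})" and lim: "\<And>c. (y c \<longlongrightarrow> unit2 c) at_top"
    and x: "0 \<le> x"
  shows "jost 0 c x k = y c x"
proof (rule solves_unique[OF jost_solves[OF k] _ k x])
  have k0: "k \<noteq> 0" using k by auto
  have yc: "continuous_on {0..} (y c)" for c by (rule prim_continuous[OF y])
  have Re: "Re (phase c k) \<le> 0" for c using k by (intro phase_Re) auto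
  show "solves (\<lambda>c x. unit2 c) k y"
    unfolding solves_def
  proof (intro conjI allI impI yc b)
    fix c and x :: real assume x: "0 \<le> x"
    show "y c x = unit2 c - integral {x..} (\<lambda>t. exp (of_real (t - x) * phase c k) * rhs k y c t)"
      by (rule prim_imp_volterra[OF y rhs_integrable(1)[OF k0 yc b] Re lim _ x])
         (simp add: phase_def unit2_def)
  qed
qed

text \<open>Conjugation together with \<open>k \<mapsto> - cnj k\<close> fixes \<open>\<i> k\<close> and \<open>\<i> / k\<close>, through which alone \<open>k\<close> enters the equation with real coefficients.\<close>

lemma jost_reflection:
  assumes k: "k \<in> punctured_upper" and x: "0 \<le> x"
    and real: "\<And>t. cnj (q t) = q t" "\<And>t. cnj (s t) = s t" "\<And>t. cnj (\<kappa> t) = \<kappa> t"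
  shows "jost 0 c x k = cnj (jost 0 c x (- cnj k))"
proof -
  have k': "- cnj k \<in> punctured_upper" using k by auto
  have ph: "cnj (phase c (- cnj k)) = phase c k" for c
    by (simp add: phase_def diff_divide_distrib algebra_simps)
  have pt: "cnj (pot (- cnj k) c d t) = pot k c d t" for c d t
    using real by (simp add: pot_def coefA_def coefB_def)
  have rh: "cnj (rhs (- cnj k) (\<lambda>c x. jost 0 c x (- cnj k)) c t) = rhs k (\<lambda>c x. cnj (jost 0 c x (- cnj k))) c t" for c t
    unfolding rhs_def by (simp add: pt)
  show ?thesis
  proof (rule jost_unique[OF k _ _ _ x])
    fix c
    from prim_linear[OF jost_prim(1)[OF k', of c] bounded_linear_cnj]
    show "prim (\<lambda>x. cnj (jost 0 c x (- cnj k)))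
       (\<lambda>t. - phase c k * cnj (jost 0 c t (- cnj k)) + rhs k (\<lambda>c x. cnj (jost 0 c x (- cnj k))) c t)"
      by (simp add: ph rh)
    show "bounded ((\<lambda>x. cnj (jost 0 c x (- cnj k))) ` {0..})"
      using bounded_linear_image[OF jost_prim(3)[OF k', of c] bounded_linear_cnj] by (simp add: image_image)
    show "((\<lambda>x. cnj (jost 0 c x (- cnj k))) \<longlongrightarrow> unit2 c) at_top"
      using tendsto_cnj[OF jost_prim(2)[OF k', of c]] by (simp add: unit2_def if_distrib cong: if_cong)
  qed
qed

text \<open>For real \<open>k\<close> the differential equation has an anti-Hermitian coefficient matrix, so the Euclidean norm of the solution
is constant in \<open>x\<close>; at infinity it is \<open>1\<close>.\<close>

lemma jost_unitary:
  assumes k: "k \<in> \<real>" "k \<noteq> 0"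
    and real: "\<And>t. cnj (q t) = q t" "\<And>t. cnj (s t) = s t" "\<And>t. cnj (\<kappa> t) = \<kappa> t"
  shows "(cmod (jost 0 2 0 k))\<^sup>2 + (cmod (jost 0 1 0 k))\<^sup>2 = 1"
proof -
  have ku: "k \<in> punctured_upper" using k by (auto simp: complex_is_Real_iff)
  have kr: "cnj k = k" using k by (simp add: Reals_cnj_iff)
  define v where "v = (\<lambda>c x. jost 0 c x k)"
  define v' where "v' = (\<lambda>c t. - phase c k * v c t + rhs k v c t)"
  have P: "prim (v c) (v' c)" for c using jost_prim(1)[OF ku] unfolding v_def v'_def .
  have Pc: "prim (\<lambda>x. cnj (v c x)) (\<lambda>x. cnj (v' c x))" for c
    by (rule prim_linear[OF P bounded_linear_cnj])
  define N where "N = (\<lambda>x. v 1 x * cnj (v 1 x) + v 2 x * cnj (v 2 x))"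
  \<comment> \<open>The diagonal part of the equation is anti-Hermitian as well.\<close>
  have ph: "cnj (phase 1 k) = - phase 1 k" "phase 2 k = 0"
    by (simp_all add: phase_def kr)
  have z: "(v' 1 t * cnj (v 1 t) + v 1 t * cnj (v' 1 t)) + (v' 2 t * cnj (v 2 t) + v 2 t * cnj (v' 2 t)) = 0" for t
  proof -
    define J where "J = \<i> / 4 / k"
    have J: "cnj J = - J" by (simp add: J_def kr)
    define Q where "Q = q t / 4"
    have Q: "cnj Q = Q" using real by (simp add: Q_def)
    have r1: "rhs k v 1 t = - Q * v 2 t + J * (\<kappa> t * v 1 t + s t * v 2 t)"
      and r2: "rhs k v 2 t = Q * v 1 t + J * (s t * v 1 t - \<kappa> t * v 2 t)"
      unfolding rhs_components J_def Q_def by simp_all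
    show ?thesis
      unfolding v'_def r1 r2 by (simp add: ph real J Q algebra_simps)
  qed
  have "prim N (\<lambda>t. (v' 1 t * cnj (v 1 t) + v 1 t * cnj (v' 1 t)) + (v' 2 t * cnj (v 2 t) + v 2 t * cnj (v' 2 t)))"
    unfolding N_def by (intro prim_add prim_product P Pc)
  then have PN: "prim N (\<lambda>t. 0)" unfolding z .
  have const: "N x = N 0" if "0 \<le> x" for x using prim_eq[OF PN that] by simp
  have "(N \<longlongrightarrow> unit2 1 * cnj (unit2 1) + unit2 2 * cnj (unit2 2)) at_top"
    unfolding N_def v_def by (intro tendsto_intros jost_prim(2)[OF ku])
  then have l1: "(N \<longlongrightarrow> 1) at_top" by simp
  have "\<forall>\<^sub>F x in at_top. N 0 = N x" using eventually_ge_at_top[of 0] by eventually_elim (rule const[symmetric])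
  then have l2: "(N \<longlongrightarrow> N 0) at_top" by (rule Lim_transform_eventually[OF tendsto_const])
  have "N 0 = 1" by (rule tendsto_unique[OF _ l2 l1]) simp
  then have "complex_of_real ((cmod (v 1 0))\<^sup>2 + (cmod (v 2 0))\<^sup>2) = 1"
    unfolding N_def by (simp add: complex_norm_square[symmetric])
  then show ?thesis unfolding v_def by (metis add.commute of_real_eq_1_iff)
qed

end

text \<open>The algebra behind the gauge transformation, with \<open>J = \<i> / 4\<close> and \<open>z = 1 / k\<close>. A rotation by \<open>u\<^sub>0 / 2\<close> with cosine \<open>C\<close> and sine \<open>S\<close> has the
derivative \<open>H = u\<^sub>0\<^sub>x / 2\<close> of its angle; it makes the part of the coefficient matrix that is proportional to \<open>k\<close> diagonal, while
the diagonal part proportional to \<open>1 / k\<close> takes the form of the potential.\<close>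

lemma gauge_identity:
  fixes C S w1 w2 P H J k z :: complex
  assumes CS: "C * C + S * S = 1" and s: "s = 2 * S * C" and \<kappa>: "\<kappa> = - 2 * (S * S)"
  shows "(- H * S) * w1 + C * (- (2 * J * (k - z)) * w1 + (- P * w2 - J * k * (\<kappa> * w1 - s * w2)))
        + (-1) * ((H * C) * w2 + S * (P * w1 - J * k * (- s * w1 - \<kappa> * w2)))
      = - (2 * J * (k - z)) * (C * w1 - S * w2) + (- (P + H) * (S * w1 + C * w2)
         + J * z * (\<kappa> * (C * w1 - S * w2) + s * (S * w1 + C * w2)))" (is ?A)
    and "((H * C) * w1 + S * (- (2 * J * (k - z)) * w1 + (- P * w2 - J * k * (\<kappa> * w1 - s * w2))))
        + ((- H * S) * w2 + C * (P * w1 - J * k * (- s * w1 - \<kappa> * w2)))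
      = (P + H) * (C * w1 - S * w2) + J * z * (s * (C * w1 - S * w2) - \<kappa> * (S * w1 + C * w2))" (is ?B)
proof -
  show ?A unfolding s \<kappa> using CS by algebra
  show ?B unfolding s \<kappa> using CS by algebra
qed

text \<open>The rotated solution for \<open>(- u\<^sub>0, u\<^sub>1)\<close> at \<open>- 1 / k\<close> solves the differential equation for \<open>(u\<^sub>0, u\<^sub>1)\<close> at \<open>k\<close>. The phase takes the same
value at both points. The rotation tends to \<open>\<epsilon>\<close> times the identity at infinity, and the factor \<open>\<epsilon>\<close> in front restores the
normalisation. Here \<open>P\<close> and \<open>H\<close> stand for \<open>(u\<^sub>1 - u\<^sub>0\<^sub>x) / 4\<close> and \<open>u\<^sub>0\<^sub>x / 2\<close>.\<close>

theorem gauge_transformation: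
  fixes q q' s \<kappa> C S P H :: "real \<Rightarrow> complex"
  assumes X: "scattering n q s \<kappa>" and Y: "scattering n q' (\<lambda>t. - s t) \<kappa>"
    and C: "prim C (\<lambda>t. - H t * S t)" and S: "prim S (\<lambda>t. H t * C t)"
    and CS: "\<And>t. C t * C t + S t * S t = 1" and s: "\<And>t. s t = 2 * S t * C t" and \<kappa>: "\<And>t. \<kappa> t = - 2 * (S t * S t)"
    and q: "\<And>t. q t = 4 * (P t + H t)" and q': "\<And>t. q' t = 4 * P t"
    and bdd: "bounded (C ` {0..})" "bounded (S ` {0..})"
    and lim: "(C \<longlongrightarrow> \<epsilon>) at_top" "(S \<longlongrightarrow> 0) at_top" and \<epsilon>: "\<epsilon> * \<epsilon> = 1"
    and k: "k \<in> punctured_upper"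
  shows "scattering.jost q s \<kappa> 0 1 0 k = \<epsilon> *
           (C 0 * scattering.jost q' (\<lambda>t. - s t) \<kappa> 0 1 0 (- 1 / k) - S 0 * scattering.jost q' (\<lambda>t. - s t) \<kappa> 0 2 0 (- 1 / k))"
    and "scattering.jost q s \<kappa> 0 2 0 k = \<epsilon> *
           (S 0 * scattering.jost q' (\<lambda>t. - s t) \<kappa> 0 1 0 (- 1 / k) + C 0 * scattering.jost q' (\<lambda>t. - s t) \<kappa> 0 2 0 (- 1 / k))"
proof -
  interpret X: scattering n q s \<kappa> by (rule X)
  interpret Y: scattering n q' "\<lambda>t. - s t" \<kappa> by (rule Y)
  define k' where "k' = - 1 / k"
  have k0: "k \<noteq> 0" using k by auto
  have "Im k' \<ge> 0" using k unfolding k'_def by (simp add: Im_divide)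
  then have k': "k' \<in> punctured_upper" using k0 by (auto simp: k'_def)
  define J where "J = \<i> / 4"
  define z where "z = 1 / k"
  define w where "w = (\<lambda>c x. Y.jost 0 c x k')"
  have ph: "phase 1 k' = 2 * J * (k - z)" "phase 2 k' = 0" "phase 1 k = 2 * J * (k - z)" "phase 2 k = 0"
    using k0 by (simp_all add: phase_def k'_def J_def z_def algebra_simps)
  have rY: "Y.rhs k' w 1 t = - P t * w 2 t - J * k * (\<kappa> t * w 1 t - s t * w 2 t)"
    "Y.rhs k' w 2 t = P t * w 1 t - J * k * (- s t * w 1 t - \<kappa> t * w 2 t)" for t
    unfolding Y.rhs_components J_def k'_def q' using k0 by (simp_all add: algebra_simps)
  have W1: "prim (w 1) (\<lambda>t. - (2 * J * (k - z)) * w 1 t + (- P t * w 2 t - J * k * (\<kappa> t * w 1 t - s t * w 2 t)))"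
    using Y.jost_prim(1)[OF k', of 1] unfolding w_def[symmetric] ph rY[symmetric] by (simp add: w_def)
  have W2: "prim (w 2) (\<lambda>t. P t * w 1 t - J * k * (- s t * w 1 t - \<kappa> t * w 2 t))"
    using Y.jost_prim(1)[OF k', of 2] unfolding w_def[symmetric] ph rY[symmetric] by (simp add: w_def)
  have wl: "(w c \<longlongrightarrow> unit2 c) at_top" and wb: "bounded (w c ` {0..})" for c
    unfolding w_def by (rule Y.jost_prim(2,3)[OF k'])+
  define a where "a = (\<lambda>x. C x * w 1 x - S x * w 2 x)"
  define b where "b = (\<lambda>x. S x * w 1 x + C x * w 2 x)"
  define y where "y = (\<lambda>(c::2) x. \<epsilon> * (if c = 1 then a x else b x))"
  have pa: "prim a (\<lambda>t. - (2 * J * (k - z)) * a t + (- (P t + H t) * b t + J * z * (\<kappa> t * a t + s t * b t)))"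
  proof -
    have "prim (\<lambda>x. C x * w 1 x + (-1) * (S x * w 2 x)) (\<lambda>t. ((- H t * S t) * w 1 t + C t * (- (2 * J * (k - z)) * w 1 t
       + (- P t * w 2 t - J * k * (\<kappa> t * w 1 t - s t * w 2 t))))
        + (-1) * ((H t * C t) * w 2 t + S t * (P t * w 1 t - J * k * (- s t * w 1 t - \<kappa> t * w 2 t))))"
      by (intro prim_add prim_cmult prim_product C S W1 W2)
    then show ?thesis
    proof (rule prim_cong)
      fix t :: real
      show "C t * w 1 t + (-1) * (S t * w 2 t) = a t" by (simp add: a_def)
      show "((- H t * S t) * w 1 t + C t * (- (2 * J * (k - z)) * w 1 t
       + (- P t * w 2 t - J * k * (\<kappa> t * w 1 t - s t * w 2 t))))
        + (-1) * ((H t * C t) * w 2 t + S t * (P t * w 1 t - J * k * (- s t * w 1 t - \<kappa> t * w 2 t)))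
        = - (2 * J * (k - z)) * a t + (- (P t + H t) * b t + J * z * (\<kappa> t * a t + s t * b t))"
        unfolding gauge_identity(1)[OF CS s \<kappa>] a_def b_def ..
    qed
  qed
  have pb: "prim b (\<lambda>t. (P t + H t) * a t + J * z * (s t * a t - \<kappa> t * b t))"
  proof -
    have "prim (\<lambda>x. S x * w 1 x + C x * w 2 x) (\<lambda>t. ((H t * C t) * w 1 t + S t * (- (2 * J * (k - z)) * w 1 t
       + (- P t * w 2 t - J * k * (\<kappa> t * w 1 t - s t * w 2 t))))
        + ((- H t * S t) * w 2 t + C t * (P t * w 1 t - J * k * (- s t * w 1 t - \<kappa> t * w 2 t))))"
      by (intro prim_add prim_cmult prim_product C S W1 W2)
    then show ?thesis
      unfolding gauge_identity(2)[OF CS s \<kappa>] by (simp add: a_def b_def)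
  qed
  have rX: "X.rhs k y 1 t = \<epsilon> * (- (P t + H t) * b t + J * z * (\<kappa> t * a t + s t * b t))"
    "X.rhs k y 2 t = \<epsilon> * ((P t + H t) * a t + J * z * (s t * a t - \<kappa> t * b t))" for t
    unfolding X.rhs_components J_def z_def q y_def using k0 by (simp_all add: field_simps)
  have "X.jost 0 c 0 k = y c 0" for c
  proof (rule X.jost_unique[OF k _ _ _ order_refl])
    fix c
    show "prim (y c) (\<lambda>t. - phase c k * y c t + X.rhs k y c t)"
    proof (cases "c = 1")
      case True
      have "prim (\<lambda>x. \<epsilon> * a x) (\<lambda>t. \<epsilon> * (- (2 * J * (k - z)) * a t + (- (P t + H t) * b t + J * z * (\<kappa> t * a t + s t * b t))))"
        by (rule prim_cmult[OF pa])
      then show ?thesis unfolding True rX ph by (simp add: y_def algebra_simps)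
    next
      case False
      then have c: "c = 2" using exhaust_2[of c] by simp
      have "prim (\<lambda>x. \<epsilon> * b x) (\<lambda>t. \<epsilon> * ((P t + H t) * a t + J * z * (s t * a t - \<kappa> t * b t)))"
        by (rule prim_cmult[OF pb])
      then show ?thesis unfolding c rX ph by (simp add: y_def)
    qed
    have w12: "(w 1 \<longlongrightarrow> 0) at_top" "(w 2 \<longlongrightarrow> 1) at_top" using wl[of 1] wl[of 2] by simp_all
    have al: "(a \<longlongrightarrow> \<epsilon> * 0 - 0 * 1) at_top" and bl: "(b \<longlongrightarrow> 0 * 0 + \<epsilon> * 1) at_top"
      unfolding a_def b_def by (intro tendsto_intros lim w12)+
    have "((\<lambda>x. \<epsilon> * a x) \<longlongrightarrow> \<epsilon> * 0) at_top" "((\<lambda>x. \<epsilon> * b x) \<longlongrightarrow> \<epsilon> * \<epsilon>) at_top"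
      using tendsto_mult_left[OF al, of \<epsilon>] tendsto_mult_left[OF bl, of \<epsilon>] by simp_all
    then show "(y c \<longlongrightarrow> unit2 c) at_top"
      using exhaust_2[of c] by (auto simp: y_def \<epsilon>)
    have mb: "bounded ((\<lambda>x. f x * g x) ` A)" if fg: "bounded (f ` A)" "bounded (g ` A)" for f g :: "real \<Rightarrow> complex" and A
    proof -
      obtain M1 M2 where "\<And>x. x \<in> A \<Longrightarrow> norm (f x) \<le> M1" "\<And>x. x \<in> A \<Longrightarrow> norm (g x) \<le> M2"
        using fg unfolding bounded_iff by auto
      then have "norm (f x * g x) \<le> \<bar>M1\<bar> * \<bar>M2\<bar>" if "x \<in> A" for x
        unfolding norm_mult using that by (intro mult_mono) (auto intro: order_trans[OF _ abs_ge_self])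
      then show ?thesis unfolding bounded_iff by blast
    qed
    have "bounded (a ` {0..})" "bounded (b ` {0..})"
      unfolding a_def b_def by (intro bounded_minus_comp bounded_plus_comp mb bdd wb)+
    then have "bounded ((\<lambda>x. \<epsilon> * a x) ` {0..})" "bounded ((\<lambda>x. \<epsilon> * b x) ` {0..})"
      using bounded_linear_image[OF _ bounded_linear_mult_right[of \<epsilon>]] by (metis image_image)+
    then show "bounded (y c ` {0..})"
      using exhaust_2[of c] by (auto simp: y_def)
  qed
  from this[of 1] this[of 2]
  show "X.jost 0 1 0 k = \<epsilon> * (C 0 * Y.jost 0 1 0 (- 1 / k) - S 0 * Y.jost 0 2 0 (- 1 / k))"
    "X.jost 0 2 0 k = \<epsilon> * (S 0 * Y.jost 0 1 0 (- 1 / k) + C 0 * Y.jost 0 2 0 (- 1 / k))"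
    by (simp_all add: y_def a_def b_def w_def k'_def)
qed

section \<open>Derivatives up to the boundary and the solution X\<close>

text \<open>Every point of the set is a limit of others above it, so derivatives within the set are unique.\<close>

lemma deriv_within_eq:
  assumes "(f has_field_derivative D) (at k within punctured_upper)" "k \<in> punctured_upper"
  shows "deriv_within punctured_upper f k = D"
proof -
  have "k \<in> closure (punctured_upper - {k})"
    unfolding closure_approachable
  proof (intro allI impI)
    fix e :: real assume "e > 0"
    define y where "y = k + \<i> * of_real (e / 2)"
    have "Im y > 0" "dist y k < e" "y \<noteq> k"
      using assms(2) \<open>e > 0\<close> by (auto simp: y_def dist_norm norm_mult)
    moreover from this have "y \<noteq> 0" by auto
    ultimately show "\<exists>y\<in>punctured_upper - {k}. dist y k < e" by (intro bexI[of _ y]) auto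
  qed
  then have nt: "at k within punctured_upper \<noteq> bot"
    using not_trivial_limit_within by (auto simp: trivial_limit_def)
  show ?thesis
    unfolding deriv_within_def
  proof (rule the_equality)
    show "(f has_field_derivative D) (at k within punctured_upper)" by (rule assms(1))
    fix D' assume "(f has_field_derivative D') (at k within punctured_upper)"
    then show "D' = D"
      using tendsto_unique[OF nt] assms(1) unfolding has_field_derivative_iff by blast
  qed
qed

text \<open>Jets built from explicit formulas agree with the iterated derivatives, which makes the latter
computable without proving their existence order by order.\<close>

lemma nderiv_jet:
  assumes F: "\<And>i k. i < n \<Longrightarrow> k \<in> punctured_upper \<Longrightarrow>
      (F i has_field_derivative F (Suc i) k) (at k within punctured_upper)"
    and f: "\<And>k. k \<in> punctured_upper \<Longrightarrow> f k = F 0 k"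
  shows "j \<le> n \<Longrightarrow> k \<in> punctured_upper \<Longrightarrow> nderiv j f k = F j k"
proof (induction j arbitrary: k)
  case 0
  then show ?case using f by simp
next
  case (Suc j)
  have "(nderiv j f has_field_derivative F (Suc j) k) (at k within punctured_upper)"
    by (rule has_field_derivative_transform_within[OF F zero_less_one]) (use Suc in auto)
  then show ?case using deriv_within_eq Suc.prems by simp
qed

lemma nderiv_jet_exists:
  assumes F: "\<And>i k. i < n \<Longrightarrow> k \<in> punctured_upper \<Longrightarrow>
      (F i has_field_derivative F (Suc i) k) (at k within punctured_upper)"
    and f: "\<And>k. k \<in> punctured_upper \<Longrightarrow> f k = F 0 k"
    and c: "continuous_on punctured_upper (F n)" and j: "1 \<le> j" "j \<le> n"
  shows "nderiv_exists_continuous j f"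
  unfolding nderiv_exists_continuous_def
proof (intro conjI ballI)
  note N = nderiv_jet[where F=F and f=f and n=n, OF F f]
  fix k assume k: "k \<in> punctured_upper"
  have "(F (j - 1) has_field_derivative F (Suc (j - 1)) k) (at k within punctured_upper)"
    by (rule F) (use j k in auto)
  then have "(nderiv (j - 1) f has_field_derivative F (Suc (j - 1)) k) (at k within punctured_upper)"
    by (rule has_field_derivative_transform_within[OF _ zero_less_one k]) (rule N[symmetric], use j in auto)
  then show "nderiv (j - 1) f field_differentiable at k within punctured_upper"
    unfolding field_differentiable_def by blast
next
  note N = nderiv_jet[where F=F and f=f and n=n, OF F f]
  have "continuous_on punctured_upper (F j)"
    by (rule differentiable_chain_continuous[of n punctured_upper F, OF F c j(2) order_refl])
  then show "continuous_on punctured_upper (nderiv j f)"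
    by (rule continuous_on_eq) (rule N[symmetric], use j in auto)
qed

lemma column_component:
  fixes u0 u1 :: "real \<Rightarrow> real"
  assumes "k \<noteq> 0"
  shows "column 2 (exp_hat_pauli3 (\<i> * theta1 k * of_real (t - x)) (pot_U u0 u1 t k ** Y)) $ c
    = exp (of_real (t - x) * phase c k) * (\<Sum>d\<in>UNIV. (coefA (\<lambda>x. of_real (wderiv 1 u0 x + u1 x)) c d t
        + coefB (\<lambda>x. of_real (sin (u0 x))) (\<lambda>x. of_real (cos (u0 x) - 1)) c d t / k) * Y $ d $ 2)"
proof -
  define q where "q = complex_of_real (wderiv 1 u0 t + u1 t)"
  define s where "s = complex_of_real (sin (u0 t))"
  define \<kappa> where "\<kappa> = complex_of_real (cos (u0 t) - 1)"
  have e1: "exp (2 * (\<i> * theta1 k * of_real (t - x))) = exp (of_real (t - x) * phase 1 k)"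
    by (rule arg_cong[of _ _ exp]) (simp add: theta1_def phase_def)
  have U: "pot_U u0 u1 t k $ 1 $ 1 = \<i> / 4 * \<kappa> / k" "pot_U u0 u1 t k $ 1 $ 2 = - q / 4 + \<i> / 4 * s / k"
    "pot_U u0 u1 t k $ 2 $ 1 = q / 4 + \<i> / 4 * s / k" "pot_U u0 u1 t k $ 2 $ 2 = - (\<i> / 4 * \<kappa> / k)"
    using assms unfolding pot_U_def pauli1_def pauli2_def pauli3_def
    by (simp_all add: matrix_matrix_mult_def sum_2 mat_def vector_2 q_def s_def \<kappa>_def field_simps)
  have E: "exp_hat_pauli3 \<alpha> A $ 1 $ 2 = exp (2 * \<alpha>) * A $ 1 $ 2" "exp_hat_pauli3 \<alpha> A $ 2 $ 2 = A $ 2 $ 2" for \<alpha> A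
    unfolding exp_hat_pauli3_def exp_pauli3_def
    by (simp_all add: matrix_matrix_mult_def sum_2 vector_2 exp_double power2_eq_square exp_minus)
  show ?thesis
  proof (cases "c = 1")
    case True
    show ?thesis
      unfolding True column_def vec_lambda_beta E e1
      by (simp add: matrix_matrix_mult_def sum_2 U coefA_def coefB_def q_def s_def \<kappa>_def)
  next
    case False
    then have c: "c = 2" using exhaust_2[of c] by simp
    show ?thesis
      unfolding c column_def vec_lambda_beta E
      by (simp add: matrix_matrix_mult_def sum_2 U coefA_def coefB_def q_def s_def \<kappa>_def phase_def
            algebra_simps add_divide_distrib diff_divide_distrib)
  qed
qed

lemma vec_absolutely_integrable:
  fixes f :: "real \<Rightarrow> complex^2"
  assumes "\<And>c. (\<lambda>x. f x $ c) absolutely_integrable_on S"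
  shows "f absolutely_integrable_on S"
proof -
  have l: "bounded_linear (axis c :: complex \<Rightarrow> complex^2)" for c
  proof (rule linear_conv_bounded_linear[THEN iffD1], rule linearI)
    show "axis c (x + y) = axis c x + (axis c y :: complex^2)" for x y
      by (simp add: vec_eq_iff axis_def)
    show "axis c (r *\<^sub>R x) = r *\<^sub>R (axis c x :: complex^2)" for r x
      by (simp add: vec_eq_iff axis_def)
  qed
  have "(\<lambda>x. axis c (f x $ c) :: complex^2) absolutely_integrable_on S" for c
    using absolutely_integrable_linear[OF assms l] by (simp add: comp_def)
  then have "(\<lambda>x. axis 1 (f x $ 1) + axis 2 (f x $ 2) :: complex^2) absolutely_integrable_on S"
    by (intro set_integral_add(1))
  moreover have "axis 1 (f x $ 1) + axis 2 (f x $ 2) = f x" for x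
    by (simp add: vec_eq_iff axis_def forall_2)
  ultimately show ?thesis by simp
qed

context scattering
begin

text \<open>The weak derivative in the potential agrees with the continuous coefficient \<open>q\<close> only almost everywhere, which is
enough inside the integral.\<close>

lemma volterra_column_iff_solves:
  fixes u0 u1 :: "real \<Rightarrow> real"
  assumes qa: "AE x in lebesgue. x > 0 \<longrightarrow> q x = of_real (wderiv 1 u0 x + u1 x)"
    and s: "\<And>x. s x = of_real (sin (u0 x))" and \<kappa>: "\<And>x. \<kappa> x = of_real (cos (u0 x) - 1)"
    and k: "k \<in> punctured_upper"
  shows "volterra_column u0 u1 k 2 Y \<longleftrightarrow> solves (\<lambda>c x. unit2 c) k (\<lambda>c x. Y x $ c $ 2)"
proof -
  have k0: "k \<noteq> 0" using k by auto
  have Re: "Re (phase c k) \<le> 0" for c using k by (intro phase_Re) auto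
  define y where "y = (\<lambda>c x. Y x $ c $ 2)"
  define I where "I = (\<lambda>x t. column 2 (exp_hat_pauli3 (\<i> * theta1 k * of_real (t - x)) (pot_U u0 u1 t k ** Y t)))"
  define N where "N = insert 0 {x. \<not> (x > 0 \<longrightarrow> q x = of_real (wderiv 1 u0 x + u1 x))}"
  have N: "negligible N" unfolding N_def using AE_lebesgue_negligible[OF qa] by simp
  have sk: "s = (\<lambda>x. of_real (sin (u0 x)))" "\<kappa> = (\<lambda>x. of_real (cos (u0 x) - 1))" using s \<kappa> by auto
  have Ic: "I x t $ c = exp (of_real (t - x) * phase c k) * rhs k y c t" if "t \<ge> 0" "t \<notin> N" for x t c
  proof -
    have "q t = of_real (wderiv 1 u0 t + u1 t)" using that unfolding N_def by auto
    then have A: "coefA (\<lambda>x. of_real (wderiv 1 u0 x + u1 x)) c d t = coefA q c d t" for d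
      by (simp add: coefA_def)
    show ?thesis
      unfolding I_def column_component[OF k0] A rhs_def pot_def y_def sk[symmetric] ..
  qed
  have key: "(\<forall>x\<ge>0. column 2 (Y x) = column 2 (mat 1) - (LINT t:{x..}|lebesgue. I x t)) \<longleftrightarrow>
      (\<forall>c. \<forall>x\<ge>0. y c x = unit2 c - integral {x..} (\<lambda>t. exp (of_real (t - x) * phase c k) * rhs k y c t))"
    if yc: "\<And>c. continuous_on {0..} (y c)" and yb: "\<And>c. bounded (y c ` {0..})"
  proof -
    have comp: "(LINT t:{x..}|lebesgue. I x t) $ c = integral {x..} (\<lambda>t. exp (of_real (t - x) * phase c k) * rhs k y c t)"
      if x: "x \<ge> 0" for x c
    proof -
      have i: "(\<lambda>t. exp (of_real (t - x) * phase c k) * rhs k y c t) absolutely_integrable_on {x..}" for c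
        by (rule exp_mult_integrable[OF rhs_integrable(1)[OF k0 yc yb] Re x])
      have ic: "(\<lambda>t. I x t $ c) absolutely_integrable_on {x..}" for c
        by (rule absolutely_integrable_spike[OF i N]) (use Ic x in auto)
      have ii: "I x absolutely_integrable_on {x..}" by (rule vec_absolutely_integrable[OF ic])
      have "(LINT t:{x..}|lebesgue. I x t) $ c = (integral {x..} (I x)) $ c"
        using set_lebesgue_integral_eq_integral(2)[OF ii] by simp
      also have "\<dots> = integral {x..} (\<lambda>t. I x t $ c)"
        using integral_linear[OF absolutely_integrable_on_imp_integrable_on[OF ii] bounded_linear_vec_nth, of c]
        by (simp add: comp_def)
      also have "\<dots> = integral {x..} (\<lambda>t. exp (of_real (t - x) * phase c k) * rhs k y c t)"
        by (rule integral_spike[OF N]) (use Ic x in auto)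
      finally show ?thesis .
    qed
    have m: "column 2 (mat 1) $ c = unit2 c" for c :: 2
      by (simp add: column_def mat_def unit2_def)
    have "(column 2 (Y x) = column 2 (mat 1) - (LINT t:{x..}|lebesgue. I x t)) \<longleftrightarrow>
      (\<forall>c. y c x = unit2 c - integral {x..} (\<lambda>t. exp (of_real (t - x) * phase c k) * rhs k y c t))"
      if "x \<ge> 0" for x
      unfolding vec_eq_iff vector_minus_component comp[OF that] m by (simp add: column_def y_def)
    then show ?thesis by blast
  qed
  have cont: "continuous_on {0..} (\<lambda>x. column 2 (Y x)) \<longleftrightarrow> (\<forall>c. continuous_on {0..} (y c))"
  proof
    assume A: "continuous_on {0..} (\<lambda>x. column 2 (Y x))"
    have "continuous_on {0..} (\<lambda>x. column 2 (Y x) $ c)" for c by (intro continuous_intros A)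
    then show "\<forall>c. continuous_on {0..} (y c)" by (simp add: y_def column_def)
  next
    assume A: "\<forall>c. continuous_on {0..} (y c)"
    have "continuous_on {0..} (\<lambda>x. \<chi> c. y c x)" by (intro continuous_on_vec_lambda) (use A in auto)
    then show "continuous_on {0..} (\<lambda>x. column 2 (Y x))" by (simp add: y_def column_def)
  qed
  have bdd: "bounded ((\<lambda>x. column 2 (Y x)) ` {0..}) \<longleftrightarrow> (\<forall>c. bounded (y c ` {0..}))"
  proof
    assume A: "bounded ((\<lambda>x. column 2 (Y x)) ` {0..})"
    show "\<forall>c. bounded (y c ` {0..})"
    proof
      fix c
      from bounded_linear_image[OF A bounded_linear_vec_nth[of c]]
      show "bounded (y c ` {0..})" by (simp add: image_image y_def column_def)
    qed
  next
    assume A: "\<forall>c. bounded (y c ` {0..})"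
    obtain M1 M2 where M: "\<And>x. x \<ge> 0 \<Longrightarrow> norm (y 1 x) \<le> M1" "\<And>x. x \<ge> 0 \<Longrightarrow> norm (y 2 x) \<le> M2"
      using A[rule_format, of 1] A[rule_format, of 2] unfolding bounded_iff by auto
    have "norm (column 2 (Y x)) \<le> M1 + M2" if "x \<ge> 0" for x
    proof -
      have "norm (column 2 (Y x)) \<le> (\<Sum>c\<in>UNIV. norm (column 2 (Y x) $ c))"
        unfolding norm_vec_def by (rule L2_set_le_sum) simp
      also have "\<dots> \<le> M1 + M2" using M[OF that] by (simp add: sum_2 column_def y_def)
      finally show ?thesis .
    qed
    then show "bounded ((\<lambda>x. column 2 (Y x)) ` {0..})" unfolding bounded_iff by auto
  qed
  have V: "volterra_column u0 u1 k 2 Y \<longleftrightarrow> (\<forall>c. continuous_on {0..} (y c)) \<and> (\<forall>c. bounded (y c ` {0..})) \<and>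
      (\<forall>x\<ge>0. column 2 (Y x) = column 2 (mat 1) - (LINT t:{x..}|lebesgue. I x t))"
    unfolding volterra_column_def cont bdd I_def ..
  have W: "solves (\<lambda>c x. unit2 c) k (\<lambda>c x. Y x $ c $ 2) \<longleftrightarrow>
      (\<forall>c. continuous_on {0..} (y c)) \<and> (\<forall>c. bounded (y c ` {0..})) \<and>
      (\<forall>c. \<forall>x\<ge>0. y c x = unit2 c - integral {x..} (\<lambda>t. exp (of_real (t - x) * phase c k) * rhs k y c t))"
    unfolding solves_def y_def ..
  show ?thesis
    unfolding V W by (intro conj_cong refl key) (elim allE, assumption)+
qed

lemma sol_X_jost:
  fixes u0 u1 :: "real \<Rightarrow> real"
  assumes qa: "AE x in lebesgue. x > 0 \<longrightarrow> q x = of_real (wderiv 1 u0 x + u1 x)"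
    and s: "\<And>x. s x = of_real (sin (u0 x))" and \<kappa>: "\<And>x. \<kappa> x = of_real (cos (u0 x) - 1)"
    and k: "k \<in> punctured_upper"
  shows "sol_X u0 u1 0 k $ c $ 2 = jost 0 c 0 k"
proof -
  have "(THE v. \<exists>Y. volterra_column u0 u1 k 2 Y \<and> v = Y 0 $ c $ 2) = jost 0 c 0 k"
  proof (rule the_equality)
    show "\<exists>Y. volterra_column u0 u1 k 2 Y \<and> jost 0 c 0 k = Y 0 $ c $ 2"
      by (intro exI[of _ "\<lambda>x. \<chi> i j. jost 0 i x k"])
         (simp add: volterra_column_iff_solves[OF qa s \<kappa> k] jost_solves[OF k])
    fix v assume "\<exists>Y. volterra_column u0 u1 k 2 Y \<and> v = Y 0 $ c $ 2"
    then obtain Y :: "real \<Rightarrow> complex^2^2" where Y: "volterra_column u0 u1 k 2 Y" "v = Y 0 $ c $ 2" by blast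
    show "v = jost 0 c 0 k"
      unfolding Y(2) by (rule solves_unique[OF Y(1)[unfolded volterra_column_iff_solves[OF qa s \<kappa> k]] jost_solves[OF k] k order_refl])
  qed
  then show ?thesis unfolding sol_X_def by simp
qed

end

section \<open>The sine-Gordon data\<close>

lemma continuous_AE_equal:
  fixes f g :: "real \<Rightarrow> real"
  assumes f: "continuous_on {0..} f" and g: "continuous_on {0..} g"
    and ae: "AE x in lebesgue. x > 0 \<longrightarrow> f x = g x" and x: "x \<ge> 0"
  shows "f x = g x"
proof (rule ccontr)
  assume "f x \<noteq> g x"
  define e where "e = \<bar>f x - g x\<bar>"
  have e: "e > 0" using \<open>f x \<noteq> g x\<close> by (simp add: e_def)
  have "continuous_on {0..} (\<lambda>y. f y - g y)" by (intro continuous_intros f g)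
  then have "continuous (at x within {0..}) (\<lambda>y. f y - g y)"
    using x unfolding continuous_on_eq_continuous_within by auto
  from this[unfolded continuous_within_eps_delta, rule_format, OF e]
  obtain d where d: "d > 0" "\<And>y. y \<ge> 0 \<Longrightarrow> dist y x < d \<Longrightarrow> dist (f y - g y) (f x - g x) < e" by auto
  have "{x<..<x+d} \<subseteq> {y. \<not> (y > 0 \<longrightarrow> f y = g y)}"
  proof
    fix y assume y: "y \<in> {x<..<x+d}"
    then have "dist (f y - g y) (f x - g x) < e" using x by (intro d(2)) (auto simp: dist_real_def)
    then have "f y \<noteq> g y" by (auto simp: e_def dist_real_def)
    then show "y \<in> {y. \<not> (y > 0 \<longrightarrow> f y = g y)}" using y x by auto
  qed
  then have "negligible {x<..<x+d}" using AE_lebesgue_negligible[OF ae] negligible_subset by blast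
  moreover have "\<not> negligible {x<..<x+d}" by (rule open_not_negligible) (use d in auto)
  ultimately show False by blast
qed

lemma prim_has_vector_derivative:
  fixes f :: "real \<Rightarrow> 'a::euclidean_space"
  assumes f: "prim f f'" and c: "continuous_on {0..} f'" and x: "x \<ge> 0"
  shows "(f has_vector_derivative f' x) (at x within {0..})"
proof -
  have "((\<lambda>u. integral {0..u} f') has_vector_derivative f' x) (at x within {0..x+1})"
    by (rule integral_has_vector_derivative[OF continuous_on_subset[OF c]]) (use x in auto)
  then have "((\<lambda>u. f 0 + integral {0..u} f') has_vector_derivative 0 + f' x) (at x within {0..x+1})"
    by (intro has_vector_derivative_add has_vector_derivative_const)
  then have "(f has_vector_derivative 0 + f' x) (at x within {0..x+1})"
    by (rule has_vector_derivative_transform[rotated 2]) (use x in \<open>auto intro!: prim_eq[OF f]\<close>)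
  moreover have "at x within {0..x+1} = at x within {0..}"
    by (rule at_within_nhd[of x "{..<x+1}"]) auto
  ultimately show ?thesis by simp
qed

lemma prim_real_chain:
  fixes u h :: "real \<Rightarrow> real" and F F' :: "real \<Rightarrow> real"
  assumes u: "prim u h" and h: "continuous_on {0..} h"
    and F: "\<And>y. (F has_real_derivative F' y) (at y)" and F': "continuous_on UNIV F'"
  shows "prim (\<lambda>x. complex_of_real (F (u x))) (\<lambda>x. complex_of_real (F' (u x) * h x))"
proof -
  have "prim (\<lambda>x. F (u x)) (\<lambda>x. F' (u x) * h x)"
  proof (rule prim_of_derivative)
    fix x :: real assume x: "x \<ge> 0"
    have "(u has_real_derivative h x) (at x within {0..})"
      using prim_has_vector_derivative[OF u h x] by (simp add: has_real_derivative_iff_has_vector_derivative)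
    from DERIV_chain2[OF F this]
    show "((\<lambda>x. F (u x)) has_vector_derivative F' (u x) * h x) (at x within {0..})"
      by (simp add: has_real_derivative_iff_has_vector_derivative)
  next
    show "continuous_on {0..} (\<lambda>x. F' (u x) * h x)"
      by (intro continuous_on_mult h continuous_on_compose2[OF F' prim_continuous[OF u]]) auto
  qed
  from prim_linear[OF this bounded_linear_of_real] show ?thesis .
qed

text \<open>Both functions are bounded by \<open>\<bar>u x - 2 pi N\<bar>\<close>, which settles the order \<open>0\<close>. Their derivatives are \<open>(cos u - 1) h + h\<close> and
\<open>- (sin u) h\<close>, so each further order follows from the preceding one by the product theorem.\<close>

lemma sine_cosine_sobolev:
  fixes u h :: "real \<Rightarrow> real"
  assumes u: "prim u h" and h: "sobolev n r (\<lambda>x. of_real (h x))" and hc: "continuous_on {0..} h"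
    and w: "(\<lambda>x. (1 + x) ^ n * (u x - 2 * pi * of_int N)) absolutely_integrable_on {0..}"
  shows "j \<le> Suc r \<Longrightarrow> sobolev n j (\<lambda>x. of_real (sin (u x))) \<and> sobolev n j (\<lambda>x. of_real (cos (u x) - 1))"
proof (induction j)
  case 0
  have uc: "continuous_on {0..} u" by (rule prim_continuous[OF u])
  define v where "v = (\<lambda>x. u x - 2 * pi * of_int N)"
  have sv: "sin (u x) = sin (v x)" "cos (u x) = cos (v x)" for x
  proof -
    have e: "u x = v x + 2 * pi * of_int N" by (simp add: v_def)
    have p: "sin (2 * pi * of_int N) = 0" "cos (2 * pi * of_int N) = 1"
      by (rule sin_int_2pin cos_int_2pin)+
    show "sin (u x) = sin (v x)" "cos (u x) = cos (v x)"
      unfolding e sin_add cos_add p by simp_all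
  qed
  have le: "\<bar>sin (u x)\<bar> \<le> \<bar>v x\<bar>" "\<bar>cos (u x) - 1\<bar> \<le> \<bar>v x\<bar>" for x
  proof -
    show "\<bar>sin (u x)\<bar> \<le> \<bar>v x\<bar>" unfolding sv using abs_sin_x_le_abs_x by blast
    have "\<bar>sin (v x / 2)\<bar> \<le> 1" by simp
    moreover have "\<bar>sin (v x / 2)\<bar> \<le> \<bar>v x\<bar> / 2" using abs_sin_x_le_abs_x[of "v x / 2"] by simp
    ultimately have "\<bar>sin (v x / 2)\<bar> * \<bar>sin (v x / 2)\<bar> \<le> 1 * (\<bar>v x\<bar> / 2)" by (intro mult_mono) auto
    moreover have "cos (v x) = 1 - 2 * (sin (v x / 2))\<^sup>2" using cos_double_sin[of "v x / 2"] by simp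
    ultimately show "\<bar>cos (u x) - 1\<bar> \<le> \<bar>v x\<bar>" unfolding sv by (simp add: power2_eq_square abs_mult)
  qed
  have main: "weighted_L1 n (\<lambda>x. of_real (f (u x)))"
    if fc: "continuous_on UNIV f" and fl: "\<And>x. \<bar>f (u x)\<bar> \<le> \<bar>v x\<bar>" for f :: "real \<Rightarrow> real"
    unfolding weighted_L1_def
  proof (rule continuous_dominated_absolutely_integrable)
    show "continuous_on {0..} (\<lambda>x. (1 + x) ^ n *\<^sub>R complex_of_real (f (u x)))"
      by (intro continuous_intros continuous_on_compose2[OF fc uc]) auto
    show "(\<lambda>x. \<bar>(1 + x) ^ n * v x\<bar>) integrable_on {0..}"
      using w unfolding absolutely_integrable_on_def v_def by simp
    show "norm ((1 + x) ^ n *\<^sub>R complex_of_real (f (u x))) \<le> \<bar>(1 + x) ^ n * v x\<bar>" if "x \<in> {0..}" for x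
      using fl[of x] that by (simp add: abs_mult mult_left_mono)
  qed simp
  have "continuous_on UNIV (\<lambda>y::real. sin y)" "continuous_on UNIV (\<lambda>y::real. cos y - 1)"
    by (intro continuous_intros)+
  from main[OF this(1) le(1)] main[OF this(2) le(2)] show ?case
    unfolding sobolev.simps by (rule conjI)
next
  case (Suc j)
  define s where "s = (\<lambda>x. complex_of_real (sin (u x)))"
  define \<kappa> where "\<kappa> = (\<lambda>x. complex_of_real (cos (u x) - 1))"
  define H where "H = (\<lambda>x. complex_of_real (h x))"
  have ih: "sobolev n j s" "sobolev n j \<kappa>" using Suc by (simp_all add: s_def \<kappa>_def)
  have H: "sobolev n j H" using sobolev_mono[OF h] Suc.prems by (simp add: H_def)
  have uc: "continuous_on {0..} u" by (rule prim_continuous[OF u])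
  have m: "multiplier n j s" "multiplier n j \<kappa>"
  proof -
    have c: "continuous_on {0..} s" "continuous_on {0..} \<kappa>"
      unfolding s_def \<kappa>_def by (intro continuous_intros uc)+
    have "norm (s x) \<le> 1" for x by (simp add: s_def)
    moreover have "norm (\<kappa> x) \<le> 2" for x
    proof -
      have "\<bar>cos (u x) - 1\<bar> \<le> 2" using cos_le_one[of "u x"] cos_ge_minus_one[of "u x"] by linarith
      then show ?thesis unfolding \<kappa>_def norm_of_real .
    qed
    ultimately have b: "bounded (s ` {0..})" "bounded (\<kappa> ` {0..})"
      unfolding bounded_iff by blast+
    show "multiplier n j s" "multiplier n j \<kappa>"
      using ih c b by (cases j; auto intro: continuous_imp_measurable_on_sets_lebesgue)+
  qed
  have p1: "prim s (\<lambda>x. \<kappa> x * H x + H x)"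
    by (rule prim_cong[OF prim_real_chain[OF u hc DERIV_sin]])
       (auto simp: s_def \<kappa>_def H_def algebra_simps intro!: continuous_intros)
  have p2: "prim \<kappa> (\<lambda>x. -1 * (s x * H x))"
    by (rule prim_cong[OF prim_real_chain[OF u hc, of "\<lambda>y. cos y - 1" "\<lambda>y. - sin y"]])
       (auto simp: s_def \<kappa>_def H_def intro!: continuous_intros derivative_eq_intros)
  have "sobolev n j (\<lambda>x. \<kappa> x * H x + H x)" "sobolev n j (\<lambda>x. -1 * (s x * H x))"
    by (intro sobolev_add sobolev_cmult sobolev_mult H m)+
  then show ?case
    using p1 p2 sobolev_weighted_L1[OF ih(1)] sobolev_weighted_L1[OF ih(2)] unfolding s_def \<kappa>_def by auto
qed

text \<open>The derivatives of \<open>R (- 1 / k)\<close> by the chain rule, with coefficients \<open>e\<close> that do not depend on \<open>R\<close>. The powers of \<open>1 / k\<close> that occur in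
the \<open>j\<close>-th derivative have exponents from \<open>j\<close> to \<open>2 j\<close>.\<close>

lemma inversion_jets:
  fixes n :: nat
  shows "\<exists>e :: nat \<Rightarrow> nat \<Rightarrow> complex. \<forall>R.
    (\<forall>i<n. \<forall>k\<in>punctured_upper. (R i has_field_derivative R (Suc i) k) (at k within punctured_upper)) \<longrightarrow>
    (let G = \<lambda>j k. \<Sum>i\<le>j. e j i * R i (- 1 / k) / k ^ (j + i) in
      (\<forall>k. G 0 k = R 0 (- 1 / k)) \<and>
      (\<forall>j<n. \<forall>k\<in>punctured_upper. (G j has_field_derivative G (Suc j) k) (at k within punctured_upper)))"
proof -
  define e :: "nat \<Rightarrow> nat \<Rightarrow> complex" where "e = rec_nat (\<lambda>i. if i = 0 then 1 else 0)
     (\<lambda>j ej i. (if i \<le> j then - of_nat (j + i) * ej i else 0) + (if i = 0 then 0 else ej (i - 1)))"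
  have e0: "e 0 0 = 1" by (simp add: e_def)
  have eS: "e (Suc j) i = (if i \<le> j then - of_nat (j + i) * e j i else 0) + (if i = 0 then 0 else e j (i - 1))" for j i
    by (simp add: e_def)
  show ?thesis
  proof (intro exI[of _ e] allI impI)
    fix R :: "nat \<Rightarrow> complex \<Rightarrow> complex"
    assume R: "\<forall>i<n. \<forall>k\<in>punctured_upper. (R i has_field_derivative R (Suc i) k) (at k within punctured_upper)"
    define G where "G = (\<lambda>j k. \<Sum>i\<le>j. e j i * R i (- 1 / k) / k ^ (j + i))"
    have inv: "- 1 / k \<in> punctured_upper" if "k \<in> punctured_upper" for k
      using that by (auto simp: Im_divide)
    have "(G j has_field_derivative G (Suc j) k) (at k within punctured_upper)"
      if j: "j < n" and k: "k \<in> punctured_upper" for j k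
    proof -
      have k0: "k \<noteq> 0" using k by auto
      define z where "z = inverse k"
      have dz: "(inverse has_field_derivative - (z * z)) (at k within punctured_upper)"
        using DERIV_inverse[OF k0] by (simp add: power2_eq_square z_def has_field_derivative_at_within)
      have dm: "((\<lambda>k. - 1 / k) has_field_derivative z * z) (at k within punctured_upper)"
        using DERIV_minus[OF dz] by (simp add: divide_inverse)
      have dR: "((\<lambda>k. R i (- 1 / k)) has_field_derivative R (Suc i) (- 1 / k) * (z * z)) (at k within punctured_upper)"
        if "i \<le> j" for i
      proof -
        have "(R i has_field_derivative R (Suc i) (- 1 / k)) (at (- 1 / k) within punctured_upper)"
          using R that j inv[OF k] by simp
        then have "(R i has_field_derivative R (Suc i) (- 1 / k)) (at (- 1 / k) within (\<lambda>k. - 1 / k) ` punctured_upper)"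
          by (rule has_field_derivative_subset[OF _ image_subsetI[OF inv]])
        from DERIV_image_chain[OF this dm] show ?thesis by (simp add: comp_def)
      qed
      have dp: "((\<lambda>k. inverse k ^ p) has_field_derivative - of_nat p * z ^ Suc p) (at k within punctured_upper)" for p
      proof (cases p)
        case (Suc r)
        have eq: "- of_nat p * z ^ Suc p = (1 + of_nat r) * (- (z * z) * inverse k ^ r)"
          unfolding Suc by (simp add: z_def algebra_simps)
        show ?thesis unfolding eq unfolding Suc by (rule DERIV_power_Suc[OF dz])
      qed simp
      have dterm: "((\<lambda>k. R i (- 1 / k) * inverse k ^ (j + i)) has_field_derivative
          R (Suc i) (- 1 / k) * (z * z) * z ^ (j + i) + (- of_nat (j + i) * z ^ Suc (j + i)) * R i (- 1 / k))
          (at k within punctured_upper)" if "i \<le> j" for i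
        using DERIV_mult[OF dR[OF that] dp[of "j + i"]] unfolding z_def .
      have Gj: "G j = (\<lambda>k. \<Sum>i\<le>j. e j i * (R i (- 1 / k) * inverse k ^ (j + i)))"
        unfolding G_def by (simp add: divide_inverse power_inverse mult.assoc)
      have "(G j has_field_derivative (\<Sum>i\<le>j. e j i * (R (Suc i) (- 1 / k) * (z * z) * z ^ (j + i)
            + (- of_nat (j + i) * z ^ Suc (j + i)) * R i (- 1 / k)))) (at k within punctured_upper)"
        unfolding Gj by (rule DERIV_sum, rule DERIV_cmult, rule dterm) simp
      moreover have "(\<Sum>i\<le>j. e j i * (R (Suc i) (- 1 / k) * (z * z) * z ^ (j + i)
            + (- of_nat (j + i) * z ^ Suc (j + i)) * R i (- 1 / k))) = G (Suc j) k"
      proof -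
        \<comment> \<open>The parts of the next sum that come from differentiating \<open>R\<close> and the power of \<open>1 / k\<close>, respectively.\<close>
        define X where "X = (\<lambda>i. if i = 0 then 0 else e j (i - 1) * R i (- 1 / k) * z ^ (Suc j + i))"
        define Y where "Y = (\<lambda>i. if i \<le> j then - of_nat (j + i) * e j i * R i (- 1 / k) * z ^ (Suc j + i) else 0)"
        have "G (Suc j) k = (\<Sum>i\<le>Suc j. X i + Y i)"
          unfolding G_def
          by (rule sum.cong) (auto simp: eS X_def Y_def z_def divide_inverse power_inverse algebra_simps)
        also have "\<dots> = (\<Sum>i\<le>Suc j. X i) + (\<Sum>i\<le>j. Y i)"
          unfolding sum.distrib by (simp add: Y_def)
        also have "(\<Sum>i\<le>Suc j. X i) = (\<Sum>i\<le>j. e j i * R (Suc i) (- 1 / k) * z ^ (Suc j + Suc i))"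
          unfolding sum.atMost_Suc_shift by (simp add: X_def)
        finally show ?thesis
          unfolding sum.distrib[symmetric] by (simp add: Y_def algebra_simps)
      qed
      ultimately show ?thesis by simp
    qed
    moreover have "G 0 k = R 0 (- 1 / k)" for k by (simp add: G_def e0)
    ultimately show "let G = \<lambda>j k. \<Sum>i\<le>j. e j i * R i (- 1 / k) / k ^ (j + i) in
      (\<forall>k. G 0 k = R 0 (- 1 / k)) \<and>
      (\<forall>j<n. \<forall>k\<in>punctured_upper. (G j has_field_derivative G (Suc j) k) (at k within punctured_upper))"
      unfolding G_def[symmetric] Let_def by blast
  qed
qed

text \<open>The continuous representatives \<open>h\<close> of \<open>u\<^sub>0\<^sub>x\<close> and \<open>g\<close> of \<open>u\<^sub>1\<close>. They replace the weak derivatives in everything that follows.\<close>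

lemma potential_data:
  fixes m n :: nat and N :: int and u0 u1 :: "real \<Rightarrow> real"
  assumes cont: "continuous_on {0..} u0"
    and wd0: "weakly_differentiable (m + 2) u0" and wd1: "weakly_differentiable (m + 1) u1"
    and w: "(\<lambda>x. (1 + x) ^ n * (u0 x - 2 * pi * of_int N)) absolutely_integrable_on {0..}"
    and w0: "\<forall>i\<in>{1..m + 2}. (\<lambda>x. (1 + x) ^ n * wderiv i u0 x) absolutely_integrable_on {0..}"
    and w1: "\<forall>i\<in>{0..m + 1}. (\<lambda>x. (1 + x) ^ n * wderiv i u1 x) absolutely_integrable_on {0..}"
  obtains h g :: "real \<Rightarrow> real" where
    "sobolev n (Suc m) (\<lambda>x. of_real (h x))" "sobolev n (Suc m) (\<lambda>x. of_real (g x))"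
    "sobolev n (Suc m) (\<lambda>x. of_real (sin (u0 x)))" "sobolev n (Suc m) (\<lambda>x. of_real (cos (u0 x) - 1))"
    "prim u0 h" "continuous_on {0..} h" "(u0 \<longlongrightarrow> 2 * pi * of_int N) at_top"
    "AE x in lebesgue. x > 0 \<longrightarrow> h x + g x = wderiv 1 u0 x + u1 x"
proof -
  obtain h where h: "sobolev n (Suc m) (\<lambda>x. of_real (h x))" "AE x in lebesgue. x > 0 \<longrightarrow> h x = wderiv 1 u0 x"
    using weak_derivatives_sobolev[of "Suc m" n "\<lambda>i. wderiv (Suc i) u0"] w0 wderiv_step[OF wd0] by auto
  obtain g where g: "sobolev n (Suc m) (\<lambda>x. of_real (g x))" "AE x in lebesgue. x > 0 \<longrightarrow> g x = wderiv 0 u1 x"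
    using weak_derivatives_sobolev[of "Suc m" n "\<lambda>i. wderiv i u1"] w1 wderiv_step[OF wd1] by auto
  have real_part: "f absolutely_integrable_on {0..}" if "weighted_L1 n (\<lambda>x. of_real (f x))" for f
    using absolutely_integrable_linear[OF weighted_L1_imp_L1[OF that] bounded_linear_Re] by (simp add: comp_def)
  have to_weighted: "weighted_L1 n (\<lambda>x. of_real (f x))" if "(\<lambda>x. (1 + x) ^ n * f x) absolutely_integrable_on {0..}" for f
    using absolutely_integrable_linear[OF that bounded_linear_of_real]
    unfolding weighted_L1_def by (simp add: comp_def scaleR_conv_of_real)
  have hL: "h absolutely_integrable_on {0..}" by (rule real_part[OF sobolev_weighted_L1[OF h(1)]])
  have hc: "continuous_on {0..} h"
  proof -
    have "continuous_on {0..} (\<lambda>x. complex_of_real (h x))"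
      using multiplier_Suc[OF sobolev_imp_multiplier[OF h(1)]] by blast
    from continuous_on_Re[OF this] show ?thesis by simp
  qed
  have "wderiv 1 u0 absolutely_integrable_on {0..}"
    by (rule real_part[OF to_weighted]) (use w0 in auto)
  moreover have "is_weak_deriv 1 u0 (wderiv 1 u0)"
    using wderiv_step[OF wd0, of 0] by (simp add: wderiv_def)
  ultimately obtain C where C: "AE x in lebesgue. x > 0 \<longrightarrow> u0 x = C + integral {0..x} (wderiv 1 u0)"
    using weak_derivative_primitive by blast
  have hprim: "prim (\<lambda>x. C + integral {0..x} h) h"
    unfolding prim_def using set_integrable_subset[OF hL] by auto
  have "integral {0..x} h = integral {0..x} (wderiv 1 u0)" for x
  proof (rule integral_spike)
    show "negligible (insert 0 {x. \<not> (x > 0 \<longrightarrow> h x = wderiv 1 u0 x)})"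
      using AE_lebesgue_negligible[OF h(2)] by simp
  qed auto
  then have "AE x in lebesgue. x > 0 \<longrightarrow> C + integral {0..x} h = u0 x"
    using C by (simp add: eq_commute)
  then have eq: "C + integral {0..x} h = u0 x" if "x \<ge> 0" for x
    by (rule continuous_AE_equal[OF prim_continuous[OF hprim] cont _ that])
  have u0: "prim u0 h" by (rule prim_cong[OF hprim eq]) auto
  have lim: "(u0 \<longlongrightarrow> u0 0 + integral {0..} h) at_top" by (rule prim_L1_tendsto[OF u0 hL])
  \<comment> \<open>An integrable function with a limit has the limit \<open>0\<close>, so \<open>u0\<close> tends to \<open>2 pi N\<close> exactly.\<close>
  have "((\<lambda>x. complex_of_real (u0 x - 2 * pi * of_int N)) \<longlongrightarrow>
      of_real (u0 0 + integral {0..} h - 2 * pi * of_int N)) at_top"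
    by (intro tendsto_intros lim)
  then have "complex_of_real (u0 0 + integral {0..} h - 2 * pi * of_int N) = 0"
    by (rule L1_limit_zero[OF weighted_L1_imp_L1[OF to_weighted[OF w]]])
  then have L: "u0 0 + integral {0..} h = 2 * pi * of_int N" by (simp only: of_real_eq_0_iff)
  have sc: "sobolev n (Suc m) (\<lambda>x. of_real (sin (u0 x))) \<and> sobolev n (Suc m) (\<lambda>x. of_real (cos (u0 x) - 1))"
    by (rule sine_cosine_sobolev[OF u0 h(1) hc w]) simp
  have "AE x in lebesgue. x > 0 \<longrightarrow> h x + g x = wderiv 1 u0 x + u1 x"
    using h(2) g(2) by eventually_elim (simp add: wderiv_def)
  then show ?thesis using that[OF h(1) g(1) _ _ u0 hc lim[unfolded L]] sc by blast
qed

lemma holomorphic_jets: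
  assumes "f holomorphic_on - {0}" "k \<noteq> 0"
  shows "((deriv ^^ i) f has_field_derivative (deriv ^^ Suc i) f k) (at k within S)"
proof -
  have "(deriv ^^ i) f holomorphic_on - {0}" by (rule holomorphic_higher_deriv[OF assms(1)]) auto
  then have "((deriv ^^ i) f has_field_derivative deriv ((deriv ^^ i) f) k) (at k)"
    by (rule holomorphic_derivI) (use assms in auto)
  then show ?thesis by (simp add: has_field_derivative_at_within)
qed

lemma norm_vector_2_diff:
  fixes x y x' y' :: complex
  shows "norm (vector [x, y] - vector [x', y'] :: complex^2) \<le> norm (x - x') + norm (y - y')"
proof -
  have "norm (vector [x, y] - vector [x', y'] :: complex^2)
     \<le> (\<Sum>c\<in>UNIV. norm ((vector [x, y] - vector [x', y'] :: complex^2) $ c))"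
    unfolding norm_vec_def by (rule L2_set_le_sum) simp
  then show ?thesis by (simp add: sum_2 vector_2)
qed

lemma mat_G0_mult:
  "mat_G0 u0 N x *v (vector [v, w] :: complex^2) =
     vector [(-1) powi N * (of_real (cos (u0 x / 2)) * v - of_real (sin (u0 x / 2)) * w),
             (-1) powi N * (of_real (sin (u0 x / 2)) * v + of_real (cos (u0 x / 2)) * w)]"
  unfolding mat_G0_def
  by (simp add: vec_eq_iff forall_2 matrix_vector_mult_def matrix_matrix_mult_def sum_2 mat_def vector_2 algebra_simps)

theorem theorem5p1:
  fixes m n :: nat and N :: int and u0 u1 :: "real \<Rightarrow> real"
  assumes "m \<ge> 1" and "n \<ge> 1"
    and "continuous_on {0..} u0"
    and "weakly_differentiable (m + 2) u0"
    and "weakly_differentiable (m + 1) u1"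
    and "(\<lambda>x. (1 + x) ^ n * (u0 x - 2 * pi * of_int N)) absolutely_integrable_on {0..}"
    and "\<forall>i\<in>{1..m + 2}. (\<lambda>x. (1 + x) ^ n * wderiv i u0 x) absolutely_integrable_on {0..}"
    and "\<forall>i\<in>{0..m + 1}. (\<lambda>x. (1 + x) ^ n * wderiv i u1 x) absolutely_integrable_on {0..}"
  defines "a \<equiv> spec_a u0 u1" and "b \<equiv> spec_b u0 u1"
  shows
    "(continuous_on {k. Im k \<ge> 0} a \<and> continuous_on {k. Im k \<ge> 0} b \<and>
      a analytic_on {k. Im k > 0} \<and> b analytic_on {k. Im k > 0}) \<and>
     (\<forall>j\<in>{1..n}. nderiv_exists_continuous j a \<and> nderiv_exists_continuous j b) \<and>
     (\<exists>ac bc ah bh :: nat \<Rightarrow> complex. \<forall>j\<in>{0..n}.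
        (\<lambda>k. norm (vector [nderiv j b k, nderiv j a k]
             - (vector [(deriv ^^ j) (\<lambda>z. \<Sum>i=1..m. bc i / z ^ i) k,
                       (deriv ^^ j) (\<lambda>z. 1 + (\<Sum>i=1..m. ac i / z ^ i)) k] :: complex^2)))
          \<in> O[inf at_infinity (principal {k. Im k \<ge> 0})](\<lambda>k. norm (1 / k ^ (m + 1))) \<and>
        (\<lambda>k. norm (vector [nderiv j b k, nderiv j a k]
             - mat_G0 u0 N 0 *v
                (vector [(deriv ^^ j) (\<lambda>z. \<Sum>i=1..m. bh i * z ^ i) k,
                        (deriv ^^ j) (\<lambda>z. 1 + (\<Sum>i=1..m. ah i * z ^ i)) k] :: complex^2)))
          \<in> O[at 0 within {k. Im k \<ge> 0}](\<lambda>k. norm (k powi (int m + 1 - 2 * int j)))) \<and>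
     (\<forall>k. Im k \<ge> 0 \<longrightarrow> a k = cnj (a (- cnj k)) \<and> b k = cnj (b (- cnj k))) \<and>
     (\<forall>k\<in>\<real>. (cmod (a k))\<^sup>2 + (cmod (b k))\<^sup>2 = 1)"
proof -
  obtain h g where hs: "sobolev n (Suc m) (\<lambda>x. of_real (h x))" and gs: "sobolev n (Suc m) (\<lambda>x. of_real (g x))"
    and ss: "sobolev n (Suc m) (\<lambda>x. of_real (sin (u0 x)))" and ks: "sobolev n (Suc m) (\<lambda>x. of_real (cos (u0 x) - 1))"
    and u0: "prim u0 h" and hc: "continuous_on {0..} h" and ulim: "(u0 \<longlongrightarrow> 2 * pi * of_int N) at_top"
    and ae: "AE x in lebesgue. x > 0 \<longrightarrow> h x + g x = wderiv 1 u0 x + u1 x"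
    by (rule potential_data[OF assms(3-8)]) (rule that; assumption)
  define q where "q = (\<lambda>x. complex_of_real (h x) + of_real (g x))"
  define q' where "q' = (\<lambda>x. complex_of_real (g x) + (-1) * of_real (h x))"
  define s where "s = (\<lambda>x. complex_of_real (sin (u0 x)))"
  define \<kappa> where "\<kappa> = (\<lambda>x. complex_of_real (cos (u0 x) - 1))"
  define C where "C = (\<lambda>x. complex_of_real (cos (u0 x / 2)))"
  define S where "S = (\<lambda>x. complex_of_real (sin (u0 x / 2)))"
  define H where "H = (\<lambda>x. complex_of_real (h x / 2))"
  define P where "P = (\<lambda>x. complex_of_real ((g x - h x) / 4))"
  \<comment> \<open>The limit at infinity of the cosine of \<open>u0 / 2\<close>.\<close>
  define \<epsilon> where "\<epsilon> = (-1 :: complex) powi N"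
  have qS: "sobolev n (Suc m) q" "sobolev n (Suc m) q'" "sobolev n (Suc m) s" "sobolev n (Suc m) \<kappa>"
    unfolding q_def q'_def s_def \<kappa>_def by (intro sobolev_add sobolev_cmult hs gs ss ks)+
  have sS: "sobolev n (Suc m) (\<lambda>t. - s t)" using sobolev_cmult[OF qS(3), of "-1"] by simp
  have m1: "1 \<le> Suc m" by simp
  \<comment> \<open>The problem for \<open>(u0, u1)\<close>, and the one for \<open>(- u0, u1)\<close> which describes it near \<open>k = 0\<close>.\<close>
  interpret X: scattering n q s \<kappa>
    by (unfold_locales; rule sobolev_mono[OF _ m1]; rule qS)
  interpret Y: scattering n q' "\<lambda>t. - s t" \<kappa>
    by (unfold_locales; rule sobolev_mono[OF _ m1]; (rule qS | rule sS))
  define X0 where "X0 = (\<lambda>c k. X.jost 0 c 0 k)"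
  define Y0 where "Y0 = (\<lambda>c k. Y.jost 0 c 0 k)"

  have ab: "b k = X0 1 k" "a k = X0 2 k" if k: "k \<in> punctured_upper" for k
  proof -
    have "AE x in lebesgue. x > 0 \<longrightarrow> q x = of_real (wderiv 1 u0 x + u1 x)"
      using ae by eventually_elim (auto simp: q_def simp flip: of_real_add)
    then have "sol_X u0 u1 0 k $ c $ 2 = X0 c k" for c
      unfolding X0_def by (rule X.sol_X_jost[OF _ _ _ k]) (simp_all add: s_def \<kappa>_def)
    then show "b k = X0 1 k" "a k = X0 2 k" using k by (simp_all add: a_def b_def spec_a_def spec_b_def)
  qed

  have uh: "prim (\<lambda>x. complex_of_real (cos (u0 x / 2))) (\<lambda>x. complex_of_real (- sin (u0 x / 2) / 2 * h x))"
    "prim (\<lambda>x. complex_of_real (sin (u0 x / 2))) (\<lambda>x. complex_of_real (cos (u0 x / 2) / 2 * h x))"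
    by (rule prim_real_chain[OF u0 hc, of "\<lambda>y. cos (y / 2)" "\<lambda>y. - sin (y / 2) / 2"]
             prim_real_chain[OF u0 hc, of "\<lambda>y. sin (y / 2)" "\<lambda>y. cos (y / 2) / 2"];
        (auto intro!: derivative_eq_intros continuous_intros)[1])+
  have Cp: "prim C (\<lambda>t. - H t * S t)" "prim S (\<lambda>t. H t * C t)"
    by (rule prim_cong[OF uh(1)] prim_cong[OF uh(2)]; simp add: C_def S_def H_def)+
  have CS: "C t * C t + S t * S t = 1" for t
    using sin_cos_squared_add[of "u0 t / 2"]
    by (simp add: C_def S_def power2_eq_square add.commute flip: of_real_mult of_real_add)
  have s2: "s t = 2 * S t * C t" for t
  proof -
    have "sin (u0 t) = 2 * sin (u0 t / 2) * cos (u0 t / 2)" using sin_double[of "u0 t / 2"] by simp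
    then show ?thesis unfolding s_def S_def C_def by simp
  qed
  have k2: "\<kappa> t = - 2 * (S t * S t)" for t
  proof -
    have eq: "cos (u0 t) - 1 = - 2 * (sin (u0 t / 2) * sin (u0 t / 2))"
      using cos_double_sin[of "u0 t / 2"] by (simp add: power2_eq_square)
    show ?thesis unfolding \<kappa>_def S_def eq by simp
  qed
  have qP: "q t = 4 * (P t + H t)" "q' t = 4 * P t" for t
    by (simp_all add: q_def q'_def P_def H_def field_simps)
  have Cb: "norm (C t) \<le> 1" "norm (S t) \<le> 1" for t by (simp_all add: C_def S_def)
  have bdd: "bounded (C ` {0..})" "bounded (S ` {0..})" using Cb unfolding bounded_iff by blast+
  have "((\<lambda>x. complex_of_real (cos (u0 x / 2))) \<longlongrightarrow> of_real (cos (2 * pi * of_int N / 2))) at_top"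
    "((\<lambda>x. complex_of_real (sin (u0 x / 2))) \<longlongrightarrow> of_real (sin (2 * pi * of_int N / 2))) at_top"
    by (intro tendsto_intros ulim, simp)+
  moreover have "complex_of_real (cos (2 * pi * of_int N / 2)) = \<epsilon>" "sin (2 * pi * of_int N / 2) = 0"
    by (simp_all add: \<epsilon>_def power_int_minus_left)
  ultimately have lim: "(C \<longlongrightarrow> \<epsilon>) at_top" "(S \<longlongrightarrow> 0) at_top" unfolding C_def S_def by simp_all
  have ee: "\<epsilon> * \<epsilon> = 1" by (simp add: \<epsilon>_def)
  have en: "norm \<epsilon> = 1" by (simp add: \<epsilon>_def power_int_minus_left)
  have er: "cnj \<epsilon> = \<epsilon>" by (simp add: \<epsilon>_def power_int_minus_left)
  have gauge: "X0 1 k = \<epsilon> * (C 0 * Y0 1 (- 1 / k) - S 0 * Y0 2 (- 1 / k))"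
    "X0 2 k = \<epsilon> * (S 0 * Y0 1 (- 1 / k) + C 0 * Y0 2 (- 1 / k))" if "k \<in> punctured_upper" for k
    unfolding X0_def Y0_def
    by (rule gauge_transformation[OF X.scattering_axioms Y.scattering_axioms Cp CS s2 k2 qP bdd lim ee that])+

  have Xjet: "(X.jost i c 0 has_field_derivative X.jost (Suc i) c 0 k) (at k within punctured_upper)"
    if "i < n" "k \<in> punctured_upper" for i c k
    unfolding X.jost_def by (rule X.solution_jets(1)[OF const_forcing order_refl that])
  have Xcont: "continuous_on punctured_upper (X.jost n c 0)" for c
    unfolding X.jost_def by (rule X.solution_jets(2)[OF const_forcing order_refl])

  obtain AX RX CX where AX: "\<And>c k. k \<in> punctured_upper \<Longrightarrow> X.jost 0 c 0 k = unit2 c + (\<Sum>l=1..m. AX l c / k ^ l) + RX 0 c k"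
    and RX: "\<And>i c k. i < n \<Longrightarrow> k \<in> punctured_upper \<Longrightarrow> (RX i c has_field_derivative RX (Suc i) c k) (at k within punctured_upper)"
    and CX: "\<And>i c k. i \<le> n \<Longrightarrow> k \<in> region 1 \<Longrightarrow> norm (RX i c k) \<le> CX / norm k ^ Suc m"
  proof (rule X.expansion_at_infinity[OF qS(1,3,4)], goal_cases)
    case (1 A R C)
    show ?case by (rule 1(1)[of A R C]; rule 1(2-); assumption)
  qed
  obtain AY RY CY where AY: "\<And>c k. k \<in> punctured_upper \<Longrightarrow> Y.jost 0 c 0 k = unit2 c + (\<Sum>l=1..m. AY l c / k ^ l) + RY 0 c k"
    and RY: "\<And>i c k. i < n \<Longrightarrow> k \<in> punctured_upper \<Longrightarrow> (RY i c has_field_derivative RY (Suc i) c k) (at k within punctured_upper)"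
    and CY: "\<And>i c k. i \<le> n \<Longrightarrow> k \<in> region 1 \<Longrightarrow> norm (RY i c k) \<le> CY / norm k ^ Suc m"
  proof (rule Y.expansion_at_infinity[OF qS(2) sS qS(4)], goal_cases)
    case (1 A R C)
    show ?case by (rule 1(1)[of A R C]; rule 1(2-); assumption)
  qed

  define bc where "bc = (\<lambda>l. AX l 1)"
  define ac where "ac = (\<lambda>l. AX l 2)"
  \<comment> \<open>The expansion in powers of \<open>1 / (- 1 / k) = - k\<close> explains the signs.\<close>
  define bh where "bh = (\<lambda>l. (-1) ^ l * AY l 1)"
  define ah where "ah = (\<lambda>l. (-1) ^ l * AY l 2)"
  define Pb where "Pb = (\<lambda>z. \<Sum>i=1..m. bc i / z ^ i)"
  define Pa where "Pa = (\<lambda>z. 1 + (\<Sum>i=1..m. ac i / z ^ i))"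
  define Qb where "Qb = (\<lambda>z. \<Sum>i=1..m. bh i * z ^ i)"
  define Qa where "Qa = (\<lambda>z. 1 + (\<Sum>i=1..m. ah i * z ^ i))"
  have hol: "Pb holomorphic_on - {0}" "Pa holomorphic_on - {0}" "Qb holomorphic_on - {0}" "Qa holomorphic_on - {0}"
    unfolding Pb_def Pa_def Qb_def Qa_def by (auto intro!: holomorphic_intros)

  have large: "nderiv j b k = (deriv ^^ j) Pb k + RX j 1 k" "nderiv j a k = (deriv ^^ j) Pa k + RX j 2 k"
    if "j \<le> n" "k \<in> punctured_upper" for j k
  proof -
    show "nderiv j b k = (deriv ^^ j) Pb k + RX j 1 k"
      by (rule nderiv_jet[where n=n and F="\<lambda>j k. (deriv ^^ j) Pb k + RX j 1 k" and f=b, OF _ _ that])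
         ((rule DERIV_add[OF holomorphic_jets[OF hol(1)] RX]; simp), simp add: ab X0_def AX Pb_def bc_def)
    show "nderiv j a k = (deriv ^^ j) Pa k + RX j 2 k"
      by (rule nderiv_jet[where n=n and F="\<lambda>j k. (deriv ^^ j) Pa k + RX j 2 k" and f=a, OF _ _ that])
         ((rule DERIV_add[OF holomorphic_jets[OF hol(2)] RX]; simp), simp add: ab X0_def AX Pa_def ac_def)
  qed

  obtain e :: "nat \<Rightarrow> nat \<Rightarrow> complex" where e: "\<And>R. (\<forall>i<n. \<forall>k\<in>punctured_upper. (R i has_field_derivative R (Suc i) k) (at k within punctured_upper)) \<Longrightarrow>
      (\<forall>k. (\<Sum>i\<le>0. e 0 i * R i (- 1 / k) / k ^ (0 + i)) = R 0 (- 1 / k)) \<and>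
      (\<forall>j<n. \<forall>k\<in>punctured_upper. ((\<lambda>k. \<Sum>i\<le>j. e j i * R i (- 1 / k) / k ^ (j + i)) has_field_derivative
          (\<Sum>i\<le>Suc j. e (Suc j) i * R i (- 1 / k) / k ^ (Suc j + i))) (at k within punctured_upper))"
    using inversion_jets[of n] unfolding Let_def by blast
  define G where "G = (\<lambda>c j k. \<Sum>i\<le>j. e j i * RY i c (- 1 / k) / k ^ (j + i))"
  have G0: "G c 0 k = RY 0 c (- 1 / k)" for c k
    using e[of "\<lambda>i. RY i c"] RY unfolding G_def by blast
  have Gd: "(G c j has_field_derivative G c (Suc j) k) (at k within punctured_upper)"
    if "j < n" "k \<in> punctured_upper" for c j k
    using e[of "\<lambda>i. RY i c"] RY that unfolding G_def by blast
  have YQ: "Y0 1 (- 1 / k) = Qb k + G 1 0 k" "Y0 2 (- 1 / k) = Qa k + G 2 0 k" if k: "k \<in> punctured_upper" for k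
  proof -
    have "- 1 / k \<in> punctured_upper" using k by (auto simp: Im_divide)
    note * = AY[OF this]
    have "c' / (- 1 / k) ^ l = (-1) ^ l * c' * k ^ l" for c' l
    proof -
      have pw: "(- 1 / k) ^ l = (-1) ^ l / k ^ l" by (rule power_divide)
      show ?thesis unfolding pw by (cases "even l") simp_all
    qed
    then show "Y0 1 (- 1 / k) = Qb k + G 1 0 k" "Y0 2 (- 1 / k) = Qa k + G 2 0 k"
      unfolding Y0_def * G0 by (simp_all only: Qb_def Qa_def bh_def ah_def unit2_simps add_0)
  qed
  have XQ: "X0 1 k = \<epsilon> * (C 0 * (Qb k + G 1 0 k) - S 0 * (Qa k + G 2 0 k))"
    "X0 2 k = \<epsilon> * (S 0 * (Qb k + G 1 0 k) + C 0 * (Qa k + G 2 0 k))" if "k \<in> punctured_upper" for k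
    unfolding gauge[OF that] YQ[OF that] by (rule refl)+
  have small: "nderiv j b k = \<epsilon> * (C 0 * ((deriv ^^ j) Qb k + G 1 j k) - S 0 * ((deriv ^^ j) Qa k + G 2 j k))"
    "nderiv j a k = \<epsilon> * (S 0 * ((deriv ^^ j) Qb k + G 1 j k) + C 0 * ((deriv ^^ j) Qa k + G 2 j k))"
    if "j \<le> n" "k \<in> punctured_upper" for j k
  proof -
    show "nderiv j b k = \<epsilon> * (C 0 * ((deriv ^^ j) Qb k + G 1 j k) - S 0 * ((deriv ^^ j) Qa k + G 2 j k))"
    proof (rule nderiv_jet[where n=n and f=b and
          F="\<lambda>j k. \<epsilon> * (C 0 * ((deriv ^^ j) Qb k + G 1 j k) - S 0 * ((deriv ^^ j) Qa k + G 2 j k))", OF _ _ that])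
      fix i k assume "i < n" "k \<in> punctured_upper"
      then show "((\<lambda>k. \<epsilon> * (C 0 * ((deriv ^^ i) Qb k + G 1 i k) - S 0 * ((deriv ^^ i) Qa k + G 2 i k))) has_field_derivative
         \<epsilon> * (C 0 * ((deriv ^^ Suc i) Qb k + G 1 (Suc i) k) - S 0 * ((deriv ^^ Suc i) Qa k + G 2 (Suc i) k))) (at k within punctured_upper)"
        by (intro DERIV_cmult DERIV_diff DERIV_add holomorphic_jets[OF hol(3)] holomorphic_jets[OF hol(4)] Gd) auto
    qed (simp add: ab XQ)
    show "nderiv j a k = \<epsilon> * (S 0 * ((deriv ^^ j) Qb k + G 1 j k) + C 0 * ((deriv ^^ j) Qa k + G 2 j k))"
    proof (rule nderiv_jet[where n=n and f=a and
          F="\<lambda>j k. \<epsilon> * (S 0 * ((deriv ^^ j) Qb k + G 1 j k) + C 0 * ((deriv ^^ j) Qa k + G 2 j k))", OF _ _ that])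
      fix i k assume "i < n" "k \<in> punctured_upper"
      then show "((\<lambda>k. \<epsilon> * (S 0 * ((deriv ^^ i) Qb k + G 1 i k) + C 0 * ((deriv ^^ i) Qa k + G 2 i k))) has_field_derivative
         \<epsilon> * (S 0 * ((deriv ^^ Suc i) Qb k + G 1 (Suc i) k) + C 0 * ((deriv ^^ Suc i) Qa k + G 2 (Suc i) k))) (at k within punctured_upper)"
        by (intro DERIV_cmult DERIV_add holomorphic_jets[OF hol(3)] holomorphic_jets[OF hol(4)] Gd) auto
    qed (simp add: ab XQ)
  qed

  \<comment> \<open>The remainder at \<open>- 1 / k\<close> is of order \<open>k ^ (m + 1)\<close> in every derivative, and the chain rule divides it by at most \<open>k ^ (2 j)\<close>.\<close>
  define K where "K = (\<Sum>j\<le>n. \<Sum>i\<le>j. norm (e j i)) * \<bar>CY\<bar>"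
  have Gbound: "norm (G c j k) \<le> K * norm k powi (int m + 1 - 2 * int j)"
    if j: "j \<le> n" and k: "k \<in> punctured_upper" "norm k \<le> 1" for c j k
  proof -
    have kp: "norm k > 0" using k by auto
    have z: "- 1 / k \<in> region 1" using k kp by (auto simp: region_def Im_divide norm_divide field_simps)
    have summand: "norm (e j i * RY i c (- 1 / k) / k ^ (j + i)) \<le> norm (e j i) * (\<bar>CY\<bar> * norm k powi (int m + 1 - 2 * int j))"
      if i: "i \<le> j" for i
    proof -
      have "norm (RY i c (- 1 / k)) \<le> CY / norm (- 1 / k) ^ Suc m" by (rule CY[OF _ z]) (use i j in simp)
      also have "\<dots> = CY * norm k ^ Suc m" by (simp add: norm_divide power_divide)
      also have "\<dots> \<le> \<bar>CY\<bar> * norm k ^ Suc m" by (intro mult_right_mono) auto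
      finally have "norm (RY i c (- 1 / k)) / norm k ^ (j + i) \<le> \<bar>CY\<bar> * norm k ^ Suc m / norm k ^ (j + i)"
        by (intro divide_right_mono) auto
      also have "norm k ^ Suc m / norm k ^ (j + i) = norm k powi (int m + 1 - int (j + i))"
      proof -
        have "norm k powi (int (Suc m) - int (j + i)) = norm k powi int (Suc m) / norm k powi int (j + i)"
          by (rule power_int_diff) (use kp in simp)
        then show ?thesis unfolding power_int_of_nat by (simp add: add.commute)
      qed
      then have "\<bar>CY\<bar> * norm k ^ Suc m / norm k ^ (j + i) = \<bar>CY\<bar> * norm k powi (int m + 1 - int (j + i))"
        by (metis times_divide_eq_right)
      also have "\<dots> \<le> \<bar>CY\<bar> * norm k powi (int m + 1 - 2 * int j)"
        using kp k(2) i by (intro mult_left_mono power_int_decreasing) auto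
      finally have "norm (RY i c (- 1 / k)) / norm k ^ (j + i) \<le> \<bar>CY\<bar> * norm k powi (int m + 1 - 2 * int j)" .
      then have "norm (e j i) * (norm (RY i c (- 1 / k)) / norm k ^ (j + i)) \<le> norm (e j i) * (\<bar>CY\<bar> * norm k powi (int m + 1 - 2 * int j))"
        by (intro mult_left_mono) auto
      then show ?thesis by (simp add: norm_mult norm_divide norm_power)
    qed
    have "norm (G c j k) \<le> (\<Sum>i\<le>j. norm (e j i) * (\<bar>CY\<bar> * norm k powi (int m + 1 - 2 * int j)))"
      unfolding G_def by (rule sum_norm_le) (use summand in auto)
    also have "\<dots> = (\<Sum>i\<le>j. norm (e j i)) * (\<bar>CY\<bar> * norm k powi (int m + 1 - 2 * int j))"
      by (simp add: sum_distrib_right)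
    also have "\<dots> \<le> (\<Sum>j\<le>n. \<Sum>i\<le>j. norm (e j i)) * (\<bar>CY\<bar> * norm k powi (int m + 1 - 2 * int j))"
      using j kp by (intro mult_right_mono member_le_sum[of j "{..n}" "\<lambda>j. \<Sum>i\<le>j. norm (e j i)"] sum_nonneg) auto
    finally show ?thesis unfolding K_def by (simp add: mult.assoc)
  qed

  have nt: "at 0 within closed_upper \<noteq> bot"
  proof -
    have "(0::complex) \<in> closure (closed_upper - {0})"
      unfolding closure_approachable
    proof (intro allI impI)
      fix r :: real assume "r > 0"
      then show "\<exists>y\<in>closed_upper - {0}. dist y 0 < r"
        by (intro bexI[of _ "\<i> * of_real (r / 2)"]) (auto simp: norm_mult)
    qed
    then show ?thesis using not_trivial_limit_within by (auto simp: trivial_limit_def)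
  qed
  have ev0: "\<forall>\<^sub>F k in at 0 within closed_upper. k \<in> punctured_upper \<and> norm k \<le> 1"
    unfolding eventually_at by (intro exI[of _ 1]) auto
  have Glim: "(G c 0 \<longlongrightarrow> 0) (at 0 within closed_upper)" for c
  proof (rule Lim_null_comparison)
    show "\<forall>\<^sub>F k in at 0 within closed_upper. norm (G c 0 k) \<le> K * norm k ^ Suc m"
      using ev0
    proof eventually_elim
      case (elim k)
      have "norm (G c 0 k) \<le> K * norm k powi (int m + 1 - 2 * int 0)" using Gbound[of 0 k c] elim by blast
      also have "int m + 1 - 2 * int 0 = int (Suc m)" by simp
      finally show ?case unfolding power_int_of_nat .
    qed
    have "((\<lambda>k::complex. K * norm k ^ Suc m) \<longlongrightarrow> K * norm (0::complex) ^ Suc m) (at 0 within closed_upper)"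
      by (intro tendsto_intros)
    then show "((\<lambda>k::complex. K * norm k ^ Suc m) \<longlongrightarrow> 0) (at 0 within closed_upper)" by simp
  qed
  have Qlim: "(Qb \<longlongrightarrow> 0) (at 0 within closed_upper)" "(Qa \<longlongrightarrow> 1) (at 0 within closed_upper)"
  proof -
    have "(Qb \<longlongrightarrow> (\<Sum>i=1..m. bh i * 0 ^ i)) (at 0 within closed_upper)"
      "(Qa \<longlongrightarrow> 1 + (\<Sum>i=1..m. ah i * 0 ^ i)) (at 0 within closed_upper)"
      unfolding Qb_def Qa_def by (intro tendsto_intros)+
    moreover have "(\<Sum>i=1..m. c i * 0 ^ i) = 0" for c :: "nat \<Rightarrow> complex"
      by (rule sum.neutral) auto
    ultimately show "(Qb \<longlongrightarrow> 0) (at 0 within closed_upper)" "(Qa \<longlongrightarrow> 1) (at 0 within closed_upper)" by simp_all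
  qed
  have lim0: "(X0 1 \<longlongrightarrow> - \<epsilon> * S 0) (at 0 within closed_upper)" "(X0 2 \<longlongrightarrow> \<epsilon> * C 0) (at 0 within closed_upper)"
  proof -
    have "((\<lambda>k. \<epsilon> * (C 0 * (Qb k + G 1 0 k) - S 0 * (Qa k + G 2 0 k))) \<longlongrightarrow>
        \<epsilon> * (C 0 * (0 + 0) - S 0 * (1 + 0))) (at 0 within closed_upper)"
      by (intro tendsto_intros Qlim Glim)
    moreover have "\<forall>\<^sub>F k in at 0 within closed_upper. \<epsilon> * (C 0 * (Qb k + G 1 0 k) - S 0 * (Qa k + G 2 0 k)) = X0 1 k"
      using ev0 by eventually_elim (simp add: XQ)
    ultimately have "(X0 1 \<longlongrightarrow> \<epsilon> * (C 0 * (0 + 0) - S 0 * (1 + 0))) (at 0 within closed_upper)"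
      by (rule Lim_transform_eventually)
    then show "(X0 1 \<longlongrightarrow> - \<epsilon> * S 0) (at 0 within closed_upper)" by simp
    have "((\<lambda>k. \<epsilon> * (S 0 * (Qb k + G 1 0 k) + C 0 * (Qa k + G 2 0 k))) \<longlongrightarrow>
        \<epsilon> * (S 0 * (0 + 0) + C 0 * (1 + 0))) (at 0 within closed_upper)"
      by (intro tendsto_intros Qlim Glim)
    moreover have "\<forall>\<^sub>F k in at 0 within closed_upper. \<epsilon> * (S 0 * (Qb k + G 1 0 k) + C 0 * (Qa k + G 2 0 k)) = X0 2 k"
      using ev0 by eventually_elim (simp add: XQ)
    ultimately have "(X0 2 \<longlongrightarrow> \<epsilon> * (S 0 * (0 + 0) + C 0 * (1 + 0))) (at 0 within closed_upper)"
      by (rule Lim_transform_eventually)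
    then show "(X0 2 \<longlongrightarrow> \<epsilon> * C 0) (at 0 within closed_upper)" by simp
  qed
  have X0_sol: "X0 c k = sol_X u0 u1 0 k $ c $ 2" if "k \<in> punctured_upper" for c k
    using ab[OF that] that exhaust_2[of c] by (auto simp: a_def b_def spec_a_def spec_b_def)
  \<comment> \<open>The values at \<open>0\<close> are limits by definition, and the expansion at \<open>0\<close> identifies them.\<close>
  have at0: "b 0 = - \<epsilon> * S 0" "a 0 = \<epsilon> * C 0"
  proof -
    have evs: "\<forall>\<^sub>F k in at 0 within closed_upper. X0 c k = sol_X u0 u1 0 k $ c $ 2" for c
      using ev0 by eventually_elim (rule X0_sol, blast)
    show "b 0 = - \<epsilon> * S 0"
      using tendsto_Lim[OF nt Lim_transform_eventually[OF lim0(1) evs]] by (simp add: b_def spec_b_def)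
    show "a 0 = \<epsilon> * C 0"
      using tendsto_Lim[OF nt Lim_transform_eventually[OF lim0(2) evs]] by (simp add: a_def spec_a_def)
  qed

  have diff: "(b has_field_derivative X.jost 1 1 0 k) (at k within punctured_upper)"
    "(a has_field_derivative X.jost 1 2 0 k) (at k within punctured_upper)" if k: "k \<in> punctured_upper" for k
  proof -
    have n0: "0 < n" using assms(2) by simp
    show "(b has_field_derivative X.jost 1 1 0 k) (at k within punctured_upper)"
      by (rule has_field_derivative_transform_within[OF Xjet[OF n0 k, of 1, folded One_nat_def] zero_less_one k]) (simp add: ab X0_def)
    show "(a has_field_derivative X.jost 1 2 0 k) (at k within punctured_upper)"
      by (rule has_field_derivative_transform_within[OF Xjet[OF n0 k, of 2, folded One_nat_def] zero_less_one k]) (simp add: ab X0_def)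
  qed
  have cont: "continuous_on closed_upper f"
    if f: "\<And>k. k \<in> punctured_upper \<Longrightarrow> continuous (at k within punctured_upper) f"
      and f0: "(f \<longlongrightarrow> f 0) (at 0 within closed_upper)" for f :: "complex \<Rightarrow> complex"
    unfolding continuous_on_def
  proof
    fix k assume k: "k \<in> closed_upper"
    show "(f \<longlongrightarrow> f k) (at k within closed_upper)"
    proof (cases "k = 0")
      case False
      have "at k within closed_upper = at k within punctured_upper"
        by (rule at_within_nhd[of k "- {0}"]) (use False in auto)
      then show ?thesis using f[of k] False k by (simp add: continuous_within)
    qed (use f0 in simp)
  qed
  have part_a: "continuous_on closed_upper a" "continuous_on closed_upper b"
  proof -
    have "\<forall>\<^sub>F k in at 0 within closed_upper. X0 2 k = a k" "\<forall>\<^sub>F k in at 0 within closed_upper. X0 1 k = b k"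
      using ev0 by (eventually_elim, simp add: ab)+
    then have "(a \<longlongrightarrow> a 0) (at 0 within closed_upper)" "(b \<longlongrightarrow> b 0) (at 0 within closed_upper)"
      unfolding at0 using Lim_transform_eventually lim0 by blast+
    then show "continuous_on closed_upper a" "continuous_on closed_upper b"
      using cont diff DERIV_continuous by blast+
  qed
  have part_a': "f analytic_on {k. Im k > 0}"
    if f: "\<And>k. k \<in> punctured_upper \<Longrightarrow> (f has_field_derivative D k) (at k within punctured_upper)" for f D
  proof -
    have op: "open {k. Im k > 0}" by (rule open_halfspace_Im_gt)
    have "(f has_field_derivative D k) (at k)" if "Im k > 0" for k
    proof -
      have "at k within punctured_upper = at k"
        by (rule at_within_open_subset[OF _ op]) (use that in auto)
      then show ?thesis using f[of k] that by (cases "k = 0") auto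
    qed
    then have "f holomorphic_on {k. Im k > 0}" unfolding holomorphic_on_open[OF op] by auto
    then show ?thesis using analytic_on_open[OF op] by blast
  qed
  have part_b: "nderiv_exists_continuous j a \<and> nderiv_exists_continuous j b" if "j \<in> {1..n}" for j
    using nderiv_jet_exists[where n=n and F="\<lambda>j. X.jost j 2 0" and f=a, OF Xjet _ Xcont]
      nderiv_jet_exists[where n=n and F="\<lambda>j. X.jost j 1 0" and f=b, OF Xjet _ Xcont] that
    by (simp add: ab X0_def)

  have part_c1: "(\<lambda>k. norm (vector [nderiv j b k, nderiv j a k]
             - (vector [(deriv ^^ j) Pb k, (deriv ^^ j) Pa k] :: complex^2)))
          \<in> O[inf at_infinity (principal {k. Im k \<ge> 0})](\<lambda>k. norm (1 / k ^ (m + 1)))" if j: "j \<le> n" for j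
  proof (rule bigoI[of _ "2 * CX"])
    have "\<forall>\<^sub>F k in at_infinity. k \<in> {k. Im k \<ge> 0} \<longrightarrow>
       norm (norm (vector [nderiv j b k, nderiv j a k] - (vector [(deriv ^^ j) Pb k, (deriv ^^ j) Pa k] :: complex^2)))
         \<le> 2 * CX * norm (norm (1 / k ^ (m + 1)))"
      unfolding eventually_at_infinity
    proof (intro exI[of _ 1] allI impI)
      fix k :: complex assume k: "1 \<le> norm k" "k \<in> {k. Im k \<ge> 0}"
      then have kr: "k \<in> region 1" and kp: "k \<in> punctured_upper" by (auto simp: region_def)
      have "norm (vector [nderiv j b k, nderiv j a k] - (vector [(deriv ^^ j) Pb k, (deriv ^^ j) Pa k] :: complex^2))
          \<le> norm (RX j 1 k) + norm (RX j 2 k)"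
        using norm_vector_2_diff[of "nderiv j b k" "nderiv j a k" "(deriv ^^ j) Pb k" "(deriv ^^ j) Pa k"]
        by (simp add: large[OF j kp])
      also have "\<dots> \<le> CX / norm k ^ Suc m + CX / norm k ^ Suc m" by (intro add_mono CX j kr)
      finally show "norm (norm (vector [nderiv j b k, nderiv j a k] - (vector [(deriv ^^ j) Pb k, (deriv ^^ j) Pa k] :: complex^2)))
         \<le> 2 * CX * norm (norm (1 / k ^ (m + 1)))"
        by (simp add: norm_divide norm_power norm_mult)
    qed
    then show "\<forall>\<^sub>F k in inf at_infinity (principal {k. Im k \<ge> 0}).
       norm (norm (vector [nderiv j b k, nderiv j a k] - (vector [(deriv ^^ j) Pb k, (deriv ^^ j) Pa k] :: complex^2)))
         \<le> 2 * CX * norm (norm (1 / k ^ (m + 1)))"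
      unfolding eventually_inf_principal .
  qed
  have part_c2: "(\<lambda>k. norm (vector [nderiv j b k, nderiv j a k]
             - mat_G0 u0 N 0 *v (vector [(deriv ^^ j) Qb k, (deriv ^^ j) Qa k] :: complex^2)))
          \<in> O[at 0 within {k. Im k \<ge> 0}](\<lambda>k. norm (k powi (int m + 1 - 2 * int j)))" if j: "j \<le> n" for j
  proof (rule bigoI[of _ "4 * K"])
    show "\<forall>\<^sub>F k in at 0 within {k. Im k \<ge> 0}. norm (norm (vector [nderiv j b k, nderiv j a k]
             - mat_G0 u0 N 0 *v (vector [(deriv ^^ j) Qb k, (deriv ^^ j) Qa k] :: complex^2)))
        \<le> 4 * K * norm (norm (k powi (int m + 1 - 2 * int j)))"
      using ev0
    proof eventually_elim
      case (elim k)
      then have kp: "k \<in> punctured_upper" and k1: "norm k \<le> 1" by blast+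
      define B where "B = K * norm k powi (int m + 1 - 2 * int j)"
      have GB: "norm (G c j k) \<le> B" for c unfolding B_def by (rule Gbound[OF j kp k1])
      have M: "mat_G0 u0 N 0 *v (vector [v, w] :: complex^2) = vector [\<epsilon> * (C 0 * v - S 0 * w), \<epsilon> * (S 0 * v + C 0 * w)]" for v w
        unfolding mat_G0_mult \<epsilon>_def C_def S_def ..
      have CB: "norm (C 0 * G c j k) \<le> B" "norm (S 0 * G c j k) \<le> B" for c
      proof -
        have "norm (C 0) * norm (G c j k) \<le> 1 * B" "norm (S 0) * norm (G c j k) \<le> 1 * B"
          by (intro mult_mono Cb GB; simp)+
        then show "norm (C 0 * G c j k) \<le> B" "norm (S 0 * G c j k) \<le> B" by (simp_all add: norm_mult)
      qed
      have "norm (vector [nderiv j b k, nderiv j a k]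
             - mat_G0 u0 N 0 *v (vector [(deriv ^^ j) Qb k, (deriv ^^ j) Qa k] :: complex^2))
         \<le> norm (\<epsilon> * (C 0 * G 1 j k - S 0 * G 2 j k)) + norm (\<epsilon> * (S 0 * G 1 j k + C 0 * G 2 j k))"
      proof -
        have 1: "nderiv j b k - \<epsilon> * (C 0 * (deriv ^^ j) Qb k - S 0 * (deriv ^^ j) Qa k) = \<epsilon> * (C 0 * G 1 j k - S 0 * G 2 j k)"
          unfolding small(1)[OF j kp] by (simp add: algebra_simps)
        have 2: "nderiv j a k - \<epsilon> * (S 0 * (deriv ^^ j) Qb k + C 0 * (deriv ^^ j) Qa k) = \<epsilon> * (S 0 * G 1 j k + C 0 * G 2 j k)"
          unfolding small(2)[OF j kp] by (simp add: algebra_simps)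
        show ?thesis unfolding M 1[symmetric] 2[symmetric] by (rule norm_vector_2_diff)
      qed
      also have "\<dots> \<le> (B + B) + (B + B)"
        unfolding norm_mult[of \<epsilon>] en mult_1 by (intro add_mono norm_triangle_le norm_triangle_le_diff CB)
      finally show ?case by (simp add: B_def norm_power_int)
    qed
  qed

  have real: "cnj (q t) = q t" "cnj (s t) = s t" "cnj (\<kappa> t) = \<kappa> t" for t
    by (simp_all add: q_def s_def \<kappa>_def)
  have part_d: "a k = cnj (a (- cnj k)) \<and> b k = cnj (b (- cnj k))" if k: "Im k \<ge> 0" for k
  proof (cases "k = 0")
    case True
    have "cnj (C 0) = C 0" "cnj (S 0) = S 0" by (simp_all add: C_def S_def)
    then show ?thesis using True by (simp add: at0 er)
  next
    case False
    then have kp: "k \<in> punctured_upper" "- cnj k \<in> punctured_upper" using k by auto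
    show ?thesis
      unfolding ab[OF kp(1)] ab[OF kp(2)] X0_def
      using X.jost_reflection[OF kp(1) order_refl real] by blast
  qed
  have part_e: "(cmod (a k))\<^sup>2 + (cmod (b k))\<^sup>2 = 1" if k: "k \<in> \<real>" for k
  proof (cases "k = 0")
    case True
    have "cmod (C 0) = \<bar>cos (u0 0 / 2)\<bar>" "cmod (S 0) = \<bar>sin (u0 0 / 2)\<bar>" by (simp_all add: C_def S_def)
    then show ?thesis using True by (simp add: at0 norm_mult en)
  next
    case False
    then have kp: "k \<in> punctured_upper" using k by (auto simp: complex_is_Real_iff)
    show ?thesis unfolding ab[OF kp] X0_def by (rule X.jost_unitary[OF k False real])
  qed

  show ?thesis
  proof (intro conjI)
    show "continuous_on {k. Im k \<ge> 0} a" "continuous_on {k. Im k \<ge> 0} b" by (rule part_a)+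
    show "a analytic_on {k. Im k > 0}" by (rule part_a'[OF diff(2)])
    show "b analytic_on {k. Im k > 0}" by (rule part_a'[OF diff(1)])
    show "\<forall>j\<in>{1..n}. nderiv_exists_continuous j a \<and> nderiv_exists_continuous j b"
      using part_b by blast
    show "\<exists>ac bc ah bh :: nat \<Rightarrow> complex. \<forall>j\<in>{0..n}.
        (\<lambda>k. norm (vector [nderiv j b k, nderiv j a k]
             - (vector [(deriv ^^ j) (\<lambda>z. \<Sum>i=1..m. bc i / z ^ i) k,
                       (deriv ^^ j) (\<lambda>z. 1 + (\<Sum>i=1..m. ac i / z ^ i)) k] :: complex^2)))
          \<in> O[inf at_infinity (principal {k. Im k \<ge> 0})](\<lambda>k. norm (1 / k ^ (m + 1))) \<and>
        (\<lambda>k. norm (vector [nderiv j b k, nderiv j a k]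
             - mat_G0 u0 N 0 *v
                (vector [(deriv ^^ j) (\<lambda>z. \<Sum>i=1..m. bh i * z ^ i) k,
                        (deriv ^^ j) (\<lambda>z. 1 + (\<Sum>i=1..m. ah i * z ^ i)) k] :: complex^2)))
          \<in> O[at 0 within {k. Im k \<ge> 0}](\<lambda>k. norm (k powi (int m + 1 - 2 * int j)))"
      using part_c1 part_c2 unfolding Pb_def Pa_def Qb_def Qa_def
      by (intro exI[of _ ac] exI[of _ bc] exI[of _ ah] exI[of _ bh] ballI conjI) auto
    show "\<forall>k. Im k \<ge> 0 \<longrightarrow> a k = cnj (a (- cnj k)) \<and> b k = cnj (b (- cnj k))"
      using part_d by blast
    show "\<forall>k\<in>\<real>. (cmod (a k))\<^sup>2 + (cmod (b k))\<^sup>2 = 1" using part_e by blast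
  qed
qed

end
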